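(* Let $G$ be a compact Hausdorff group, $X$ a complete operator space and $\nu\in M(G,X)$. (i) Let $1\leq p<\infty$. If $f\in L^p(G)$ then $f*\nu\in P_p(G,X)$. Further, $\|f*\nu\|_{P_p(G,X)}\leq\|f\|_p\|\nu\|$. (ii) Let $1<p<\infty$. If $\nu\in M_p(G,X)$ and $f\in L^q(G)$ with $q'>p$, then $f*\nu\in P_r(G,X)$ where $\frac1p+\frac1q=1+\frac1r$. Further, $\|f*\nu\|_{P_r(G,X)}\leq\|f\|_q\|\nu\|_{p,m_G}$.
   Context: $m_G$ is normalized Haar measure; $p'$ denotes the conjugate exponent of $p$; exponents $q$ satisfy $q\ge1$. $M(G,X)$ is the space of $\sigma$-additive $X$-valued vector measures on the Borel $\sigma$-algebra $\mathfrak{B}(G)$; $\|\nu\|=\sup_{x'\in B_{X'}}|\langle\nu,x'\rangle|(G)$ is the semivariation ($B_{X'}$ the closed unit ball of the dual $X'$, $\langle\nu,x'\rangle(A)=\langle\nu(A),x'\rangle$). For $1\le p<\infty$ the $p$-semivariation is $\|\nu\|_{p,m_G}=\sup\|\sum_{A\in\rho}\alpha_A\nu(A)\|_X$, the supremum over finite Borel partitions $\rho$ of $G$ and scalars $\alpha_A$ with $\sum_{A\in\rho}\alpha_A\chi_A$ in the closed unit ball of $L^{p'}(G)$; $\|\nu\|_{\infty,m_G}=\sup_{m_G(A)>0}\|\nu(A)\|/m_G(A)$. $M_p(G,X)$ is the space of $X$-valued vector measures with finite $p$-semivariation, normed by it. An $X$-valued simple function $\phi$ on $G$ is identified with the measure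 $\nu_\phi(A)=\int_A\phi\,dm_G$; $P_p(G,X)$ is the closure in $M_p(G,X)$ of the $X$-valued simple functions, with norm $\|\phi\|_{P_p(G,X)}=\|\nu_\phi\|_{p,m_G}=\sup_{x'\in B_{X'}}\|\langle\phi,x'\rangle\|_p$. For $f\in L^1(G)$, $f*\nu:=\mu_f*\nu$ with $d\mu_f=f\,dm_G$, where $\mu*\nu(A)=\int_G\mu(At^{-1})\,d\nu(t)$, $A\in\mathfrak{B}(G)$, for a complex Radon measure $\mu$ on $G$. *)

theory Defs
  imports "HOL-Analysis.Analysis" "HOL-Probability.Essential_Supremum"
begin

(* Groups are rendered with the class topological_group_add, whose operation is written
   additively but is not assumed commutative: s t is s + t, t^{-1} is - t, and A t^{-1} is
   (\<lambda>a. a - t) ` A. *)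

section \<open>Complex Banach spaces and operator spaces\<close>

class scaleC =
  fixes scaleC :: "complex \<Rightarrow> 'a \<Rightarrow> 'a"  (infixr \<open>*\<^sub>C\<close> 75)

class complex_banach = banach + scaleC +
  assumes scaleC_add_right: "c *\<^sub>C (x + y) = c *\<^sub>C x + c *\<^sub>C y"
    and scaleC_add_left: "(c + d) *\<^sub>C x = c *\<^sub>C x + d *\<^sub>C x"
    and scaleC_scaleC: "c *\<^sub>C (d *\<^sub>C x) = (c * d) *\<^sub>C x"
    and scaleC_of_real: "complex_of_real r *\<^sub>C x = r *\<^sub>R x"
    and norm_scaleC: "norm (c *\<^sub>C x) = cmod c * norm x"

(* Matrices are functions of two indices; only the entries below the stated sizes count.
   This is the norm of the n x m matrix a as an operator from l^2_m to l^2_n. *)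
definition scalar_matrix_norm :: "nat \<Rightarrow> nat \<Rightarrow> (nat \<Rightarrow> nat \<Rightarrow> complex) \<Rightarrow> real" where
  "scalar_matrix_norm n m a =
     Sup {sqrt (\<Sum>i<n. (cmod (\<Sum>j<m. a i j * \<xi> j))\<^sup>2) |\<xi> :: nat \<Rightarrow> complex. (\<Sum>j<m. (cmod (\<xi> j))\<^sup>2) \<le> 1}"

(* Complete abstract operator spaces: a norm on every M_n(X), satisfying Ruan's axioms
   (the last two), that is the given complete norm for n = 1. *)
class operator_space = complex_banach +
  fixes matrix_norm :: "nat \<Rightarrow> (nat \<Rightarrow> nat \<Rightarrow> 'a) \<Rightarrow> real"
  assumes matrix_norm_cong:
      "(\<And>i j. i < n \<Longrightarrow> j < n \<Longrightarrow> v i j = w i j) \<Longrightarrow> matrix_norm n v = matrix_norm n w"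
    and matrix_norm_eq_0: "matrix_norm n v = 0 \<longleftrightarrow> (\<forall>i<n. \<forall>j<n. v i j = 0)"
    and matrix_norm_triangle:
      "matrix_norm n (\<lambda>i j. v i j + w i j) \<le> matrix_norm n v + matrix_norm n w"
    and matrix_norm_scaleC: "matrix_norm n (\<lambda>i j. c *\<^sub>C v i j) = cmod c * matrix_norm n v"
    and matrix_norm_1: "matrix_norm 1 v = norm (v 0 0)"
    and matrix_norm_direct_sum:
      "matrix_norm (m + n)
         (\<lambda>i j. if i < m \<and> j < m then v i j
                else if m \<le> i \<and> m \<le> j then w (i - m) (j - m) else 0)
       = max (matrix_norm m v) (matrix_norm n w)"
    and matrix_norm_mult:
      "matrix_norm n (\<lambda>i j. \<Sum>k<m. \<Sum>l<m. (a i k * b l j) *\<^sub>C v k l)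
       \<le> scalar_matrix_norm n m a * matrix_norm m v * scalar_matrix_norm m n b"

definition dual_unit_ball :: "('x::complex_banach \<Rightarrow> complex) set" where
  "dual_unit_ball = {x'. (\<forall>x y. x' (x + y) = x' x + x' y) \<and> (\<forall>c x. x' (c *\<^sub>C x) = c * x' x) \<and>
                         (\<forall>x. cmod (x' x) \<le> norm x)}"

section \<open>Haar measure and Lebesgue spaces\<close>

definition radon_finite_measure :: "'g::topological_space measure \<Rightarrow> bool" where
  "radon_finite_measure M \<longleftrightarrow> sets M = sets borel \<and> finite_measure M \<and>
     (\<forall>A\<in>sets M. emeasure M A = (INF U\<in>{U. open U \<and> A \<subseteq> U}. emeasure M U)) \<and>
     (\<forall>A\<in>sets M. emeasure M A = (SUP K\<in>{K. compact K \<and> K \<in> sets M \<and> K \<subseteq> A}. emeasure M K))"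

definition normalized_haar_measure :: "'g::topological_group_add measure \<Rightarrow> bool" where
  "normalized_haar_measure M \<longleftrightarrow> radon_finite_measure M \<and> emeasure M UNIV = 1 \<and>
     (\<forall>g. \<forall>A\<in>sets M. emeasure M ((\<lambda>a. g + a) ` A) = emeasure M A)"

(* In ennreal, 1/0 = \<infinity> and 1/\<infinity> = 0, so 1' = \<infinity> and \<infinity>' = 1. *)
definition conjugate_exponent :: "ennreal \<Rightarrow> ennreal" where
  "conjugate_exponent p = 1 / (1 - 1 / p)"

definition Lp_norm :: "ennreal \<Rightarrow> 'a measure \<Rightarrow> ('a \<Rightarrow> complex) \<Rightarrow> ennreal" where
  "Lp_norm p M f =
     (if p = \<infinity> then esssup M (\<lambda>x. ennreal (cmod (f x)))
      else let I = (\<integral>\<^sup>+x. ennreal (cmod (f x) powr enn2real p) \<partial>M)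
           in if I = \<infinity> then \<infinity> else ennreal (enn2real I powr (1 / enn2real p)))"

definition Lp_space :: "ennreal \<Rightarrow> 'a measure \<Rightarrow> ('a \<Rightarrow> complex) set" where
  "Lp_space p M = {f \<in> borel_measurable M. Lp_norm p M f < \<infinity>}"

section \<open>Vector measures\<close>

(* Set functions are total; only their values on Borel sets are ever used. *)
definition vector_measure :: "('g::topological_space set \<Rightarrow> 'x::real_normed_vector) \<Rightarrow> bool" where
  "vector_measure \<nu> \<longleftrightarrow>
     (\<forall>A :: nat \<Rightarrow> 'g set. range A \<subseteq> sets borel \<and> disjoint_family A \<longrightarrow>
        (\<lambda>i. \<nu> (A i)) sums \<nu> (\<Union>i. A i))"

definition borel_partitions :: "'g::topological_space set set set" where
  "borel_partitions = {\<rho>. finite \<rho> \<and> \<rho> \<subseteq> sets borel \<and> partition_on UNIV \<rho>}"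

definition total_variation :: "('g::topological_space set \<Rightarrow> complex) \<Rightarrow> ennreal" where
  "total_variation \<mu> = (SUP \<rho>\<in>borel_partitions. \<Sum>A\<in>\<rho>. ennreal (cmod (\<mu> A)))"

definition semivariation :: "('g::topological_space set \<Rightarrow> 'x::complex_banach) \<Rightarrow> ennreal" where
  "semivariation \<nu> = (SUP x'\<in>dual_unit_ball. total_variation (\<lambda>A. x' (\<nu> A)))"

definition p_semivariation ::
    "ennreal \<Rightarrow> 'g::topological_space measure \<Rightarrow> ('g set \<Rightarrow> 'x::complex_banach) \<Rightarrow> ennreal" where
  "p_semivariation p M \<nu> =
     (if p = \<infinity> then SUP A\<in>{A \<in> sets borel. emeasure M A > 0}. ennreal (norm (\<nu> A)) / emeasure M A
      else SUP (\<rho>, \<alpha>)\<in>{(\<rho>, \<alpha>). \<rho> \<in> borel_partitions \<and>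
                Lp_norm (conjugate_exponent p) M (\<lambda>t. \<Sum>A\<in>\<rho>. \<alpha> A * indicator A t) \<le> 1}.
             ennreal (norm (\<Sum>A\<in>\<rho>. \<alpha> A *\<^sub>C \<nu> A)))"

definition M_space ::
    "ennreal \<Rightarrow> 'g::topological_space measure \<Rightarrow> ('g set \<Rightarrow> 'x::complex_banach) set" where
  "M_space p M = {\<nu>. vector_measure \<nu> \<and> p_semivariation p M \<nu> < \<infinity>}"

(* A |-> \<integral>_A \<phi> dM for simple \<phi>, written out since the Bochner integral of the library
   needs a second countable target. *)
definition simple_density ::
    "'g::topological_space measure \<Rightarrow> ('g \<Rightarrow> 'x::complex_banach) \<Rightarrow> 'g set \<Rightarrow> 'x" where
  "simple_density M \<phi> A = (\<Sum>x\<in>range \<phi>. measure M (A \<inter> \<phi> -` {x}) *\<^sub>R x)"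

(* Normed by p_semivariation p M, like M_space p M. *)
definition P_space ::
    "ennreal \<Rightarrow> 'g::topological_space measure \<Rightarrow> ('g set \<Rightarrow> 'x::complex_banach) set" where
  "P_space p M = {\<nu> \<in> M_space p M. \<forall>\<epsilon>>0. \<exists>\<phi>. simple_function borel \<phi> \<and>
                    p_semivariation p M (\<lambda>A. \<nu> A - simple_density M \<phi> A) < \<epsilon>}"

section \<open>Integration against a vector measure and convolution\<close>

definition simple_vm_integral ::
    "('g::topological_space set \<Rightarrow> 'x::complex_banach) \<Rightarrow> ('g \<Rightarrow> complex) \<Rightarrow> 'x" where
  "simple_vm_integral \<nu> s = (\<Sum>c\<in>range s. c *\<^sub>C \<nu> (s -` {c}))"

(* For bounded Borel functions h, by uniform approximation; this suffices for convolutions,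
   as t |-> \<mu> (A t^{-1}) is bounded. *)
definition vm_integral ::
    "('g::topological_space set \<Rightarrow> 'x::complex_banach) \<Rightarrow> ('g \<Rightarrow> complex) \<Rightarrow> 'x" where
  "vm_integral \<nu> h =
     (THE y. \<exists>s. (\<forall>n. simple_function borel (s n)) \<and> uniform_limit UNIV s h sequentially \<and>
                 (\<lambda>n. simple_vm_integral \<nu> (s n)) \<longlonglongrightarrow> y)"

definition convolution ::
    "('g::topological_group_add set \<Rightarrow> complex) \<Rightarrow> ('g set \<Rightarrow> 'x::complex_banach) \<Rightarrow> 'g set \<Rightarrow> 'x" where
  "convolution \<mu> \<nu> A = vm_integral \<nu> (\<lambda>t. \<mu> ((\<lambda>a. a - t) ` A))"

definition fun_convolution ::
    "'g::topological_group_add measure \<Rightarrow> ('g \<Rightarrow> complex) \<Rightarrow> ('g set \<Rightarrow> 'x::complex_banach) \<Rightarrow> 'g set \<Rightarrow> 'x"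
  where "fun_convolution M f \<nu> = convolution (\<lambda>A. set_lebesgue_integral M A f) \<nu>"

end

theory Submission
  imports Defs
begin

text \<open>
  In multiplicative notation, write \<open>h A t\<close> for the integral of \<open>f\<close> over \<open>A t\<^sup>-\<^sup>1\<close>. A linear combination
  \<open>\<Sum>A. \<alpha> A *\<^sub>C (f * \<nu>) A\<close>, as it occurs in the \<open>p\<close>-semivariation of \<open>f * \<nu>\<close>, is the integral
  against \<open>\<nu>\<close> of \<open>H t = (\<Sum>A. \<alpha> A * h A t) = \<integral> g s * f (s t\<^sup>-\<^sup>1) ds\<close>, where \<open>g\<close> is the simple
  function with values \<open>\<alpha> A\<close>. So the norm estimates reduce to scalar estimates of \<open>H\<close>. For (i),
  Hoelder's inequality and right invariance of Haar measure bound \<open>H\<close> uniformly by the \<open>p\<close>-norm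
  of \<open>f\<close>, and integrals of bounded functions are controlled by the semivariation. For (ii),
  Young's inequality bounds the \<open>p'\<close>-norm of \<open>H\<close>, and the \<open>p\<close>-semivariation of \<open>\<nu>\<close> controls
  integrals in terms of that norm.

  That \<open>f * \<nu>\<close> is a limit of simple functions follows from the estimates: they allow \<open>f\<close> to be
  replaced by a simple function, and translation is continuous in mean, so by compactness finitely
  many translates \<open>f (s x\<^sup>-\<^sup>1)\<close> approximate all of them. Partitioning the group accordingly turns the
  integral against \<open>\<nu>\<close> into the finite sum \<open>\<Sum>x. f (s x\<^sup>-\<^sup>1) *\<^sub>C \<nu> (B x)\<close>, a simple function
  of \<open>s\<close> (\<open>fun_convolution_in_P_space\<close>).

  The group need not be second countable, so \<open>(s, t) \<mapsto> s t\<close> need not be measurable for the product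
  of the Borel algebras and Fubini's theorem is not at hand. In its place, compactness gives
  one inequality between iterated integrals (\<open>nn_integral_translates_le_compact\<close>). It suffices twice:
  to show that a left invariant measure on a compact group is right invariant, and for Young's
  inequality.

  Three more facts enter: every vector is normed by a functional (the Hahn-Banach theorem),
  which relates the semivariation to norms; vector measures have bounded range, hence finite
  semivariation; and \<open>h A\<close> is continuous, so that its integral against \<open>\<nu>\<close> exists.
\<close>

section \<open>The norm is attained on the dual unit ball\<close>

definition sublinear :: "('a::real_vector \<Rightarrow> real) \<Rightarrow> bool" where
  "sublinear p \<longleftrightarrow> (\<forall>x y. p (x + y) \<le> p x + p y) \<and> (\<forall>c x. c > 0 \<longrightarrow> p (c *\<^sub>R x) \<le> c * p x)"

lemma sublinear_add: "sublinear p \<Longrightarrow> p (x + y) \<le> p x + p y"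
  and sublinear_scale_le: "sublinear p \<Longrightarrow> c > 0 \<Longrightarrow> p (c *\<^sub>R x) \<le> c * p x"
  by (auto simp: sublinear_def)

lemma sublinear_scale:
  assumes "sublinear p" "c > 0"
  shows "p (c *\<^sub>R x) = c * p x"
proof (rule antisym)
  show "p (c *\<^sub>R x) \<le> c * p x"
    using assms by (rule sublinear_scale_le)
  have "p ((1 / c) *\<^sub>R (c *\<^sub>R x)) \<le> (1 / c) * p (c *\<^sub>R x)"
    using assms by (intro sublinear_scale_le) auto
  then show "c * p x \<le> p (c *\<^sub>R x)"
    using assms by (simp add: field_simps)
qed

lemma sublinear_zero: "sublinear p \<Longrightarrow> p 0 = 0"
  using sublinear_scale[of p 2 0] by simp

lemma sublinear_norm: "sublinear (norm :: 'a::real_normed_vector \<Rightarrow> real)"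
  by (auto simp: sublinear_def norm_triangle_ineq)

text \<open>For sublinear \<open>p\<close>, the largest sublinear functional below \<open>p\<close> whose value at \<open>- a\<close> is at most
  \<open>- p a\<close>.\<close>

definition tilt :: "'a::real_vector \<Rightarrow> ('a \<Rightarrow> real) \<Rightarrow> 'a \<Rightarrow> real" where
  "tilt a p x = (INF t\<in>{0..}. p (x + t *\<^sub>R a) - t * p a)"

lemma tilt_le:
  assumes "sublinear p" "t \<ge> 0"
  shows "tilt a p x \<le> p (x + t *\<^sub>R a) - t * p a"
  unfolding tilt_def
proof (rule cINF_lower)
  show "bdd_below ((\<lambda>t. p (x + t *\<^sub>R a) - t * p a) ` {0..})"
  proof (rule bdd_belowI2)
    fix t :: real assume "t \<in> {0..}"
    then have *: "t * p a = p (t *\<^sub>R a)"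
      using sublinear_scale[OF assms(1), of t a] sublinear_zero[OF assms(1)] by (cases "t = 0") auto
    have "p (t *\<^sub>R a) \<le> p (x + t *\<^sub>R a) + p (- x)"
      using sublinear_add[OF assms(1), of "x + t *\<^sub>R a" "- x"] by simp
    then show "- p (- x) \<le> p (x + t *\<^sub>R a) - t * p a"
      using * by simp
  qed
qed (use assms in auto)

lemma tilt_greatest:
  assumes "\<And>t. t \<ge> 0 \<Longrightarrow> b \<le> p (x + t *\<^sub>R a) - t * p a"
  shows "b \<le> tilt a p x"
  unfolding tilt_def by (rule cINF_greatest) (use assms in auto)

lemma sublinear_tilt:
  assumes p: "sublinear p"
  shows "sublinear (tilt a p)"
  unfolding sublinear_def
proof (intro conjI allI impI)
  fix x y
  have *: "tilt a p (x + y) \<le> (p (x + s *\<^sub>R a) - s * p a) + (p (y + t *\<^sub>R a) - t * p a)"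
    if "s \<ge> 0" "t \<ge> 0" for s t
  proof -
    have "tilt a p (x + y) \<le> p (x + y + (s + t) *\<^sub>R a) - (s + t) * p a"
      using p that by (intro tilt_le) auto
    also have "x + y + (s + t) *\<^sub>R a = (x + s *\<^sub>R a) + (y + t *\<^sub>R a)"
      by (simp add: algebra_simps)
    finally show ?thesis
      using sublinear_add[OF p, of "x + s *\<^sub>R a" "y + t *\<^sub>R a"] by (simp add: algebra_simps)
  qed
  have "tilt a p (x + y) - (p (x + s *\<^sub>R a) - s * p a) \<le> tilt a p y" if "s \<ge> 0" for s
    using *[OF that] by (intro tilt_greatest) (auto simp: algebra_simps)
  then have "tilt a p (x + y) - tilt a p y \<le> tilt a p x"
    by (intro tilt_greatest) (auto simp: algebra_simps)
  then show "tilt a p (x + y) \<le> tilt a p x + tilt a p y"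
    by simp
next
  fix c :: real and x assume c: "c > 0"
  have "tilt a p (c *\<^sub>R x) / c \<le> tilt a p x"
  proof (rule tilt_greatest)
    fix t :: real assume "t \<ge> 0"
    then have "tilt a p (c *\<^sub>R x) \<le> p (c *\<^sub>R x + (c * t) *\<^sub>R a) - (c * t) * p a"
      using p c by (intro tilt_le) auto
    also have "c *\<^sub>R x + (c * t) *\<^sub>R a = c *\<^sub>R (x + t *\<^sub>R a)"
      by (simp add: algebra_simps)
    finally show "tilt a p (c *\<^sub>R x) / c \<le> p (x + t *\<^sub>R a) - t * p a"
      using c sublinear_scale[OF p c, of "x + t *\<^sub>R a"] by (simp add: field_simps)
  qed
  then show "tilt a p (c *\<^sub>R x) \<le> c * tilt a p x"
    using c by (simp add: field_simps)
qed

lemma tilt_le_self: "sublinear p \<Longrightarrow> tilt a p x \<le> p x"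
  using tilt_le[of p 0 a x] by simp

lemma tilt_uminus: "sublinear p \<Longrightarrow> tilt a p (- a) \<le> - p a"
  using tilt_le[of p 1 a "- a"] sublinear_zero[of p] by simp

text \<open>Tilting never raises a sublinear functional, so a minimal one is fixed by every tilt, and
  this says that it is superadditive. Minimal functionals exist by Zorn's lemma: pointwise infima
  of chains of sublinear functionals are sublinear.\<close>

lemma minimal_sublinear_exists:
  fixes q :: "'a::real_vector \<Rightarrow> real"
  assumes q: "sublinear q"
  shows "\<exists>p. sublinear p \<and> p \<le> q \<and> (\<forall>p'. sublinear p' \<and> p' \<le> p \<longrightarrow> p' = p)"
proof -
  define A where "A = {p. sublinear p \<and> p \<le> q}"
  have "\<exists>m\<in>A. \<forall>a\<in>A. m \<ge> a \<longrightarrow> a = m"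
  proof (rule predicate_Zorn)
    show "partial_order_on A (relation_of (\<ge>) A)"
      by (rule partial_order_on_relation_ofI) auto
    fix C assume C: "C \<in> Chains (relation_of (\<ge>) A)"
    then have CA: "C \<subseteq> A" and total: "\<And>p p'. p \<in> C \<Longrightarrow> p' \<in> C \<Longrightarrow> p \<le> p' \<or> p' \<le> p"
      by (auto simp: Chains_def relation_of_def)
    show "\<exists>u\<in>A. \<forall>a\<in>C. a \<ge> u"
    proof (cases "C = {}")
      case True
      then show ?thesis using q by (auto simp: A_def)
    next
      case False
      define u where "u x = (INF p\<in>C. p x)" for x
      have u_le: "u x \<le> p x" if "p \<in> C" for p x
        unfolding u_def
      proof (rule cINF_lower[OF _ that], rule bdd_belowI2)
        fix p' assume p': "p' \<in> C"
        then have "sublinear p'" "p' (- x) \<le> q (- x)"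
          using CA by (auto simp: A_def le_fun_def)
        then show "- q (- x) \<le> p' x"
          using sublinear_add[of p' x "- x"] sublinear_zero[of p'] by simp
      qed
      have u_greatest: "b \<le> u x" if "\<And>p. p \<in> C \<Longrightarrow> b \<le> p x" for b x
        unfolding u_def using False that by (intro cINF_greatest) auto
      have "sublinear u"
        unfolding sublinear_def
      proof (intro conjI allI impI)
        fix x y
        have *: "u (x + y) \<le> p x + p' y" if "p \<in> C" "p' \<in> C" for p p'
        proof -
          have tot: "p \<le> p' \<or> p' \<le> p" "p \<in> C" "p' \<in> C"
            using total that by auto
          obtain r where r: "r \<in> C" "r \<le> p" "r \<le> p'"
            using tot by auto
          have "u (x + y) \<le> r x + r y"
            using u_le[OF r(1), of "x + y"] sublinear_add[of r x y] r(1) CA by (force simp: A_def)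
          then show ?thesis
            using le_funD[OF r(2), of x] le_funD[OF r(3), of y] by linarith
        qed
        have "u (x + y) - p x \<le> u y" if "p \<in> C" for p
          using *[OF that] by (intro u_greatest) (auto simp: algebra_simps)
        then have "u (x + y) - u y \<le> u x"
          by (intro u_greatest) (auto simp: algebra_simps)
        then show "u (x + y) \<le> u x + u y" by simp
      next
        fix c :: real and x assume c: "c > 0"
        have "u (c *\<^sub>R x) / c \<le> u x"
        proof (rule u_greatest)
          fix p assume p: "p \<in> C"
          have "u (c *\<^sub>R x) \<le> c * p x"
            using u_le[OF p, of "c *\<^sub>R x"] sublinear_scale_le[of p c x] p CA c by (force simp: A_def)
          then show "u (c *\<^sub>R x) / c \<le> p x"
            using c by (simp add: field_simps)
        qed
        then show "u (c *\<^sub>R x) \<le> c * u x" using c by (simp add: field_simps)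
      qed
      moreover have "u \<le> q"
      proof (rule le_funI)
        fix x
        obtain p where p: "p \<in> C" using False by auto
        then have "p x \<le> q x" using CA by (auto simp: A_def le_fun_def)
        then show "u x \<le> q x" using u_le[OF p, of x] by simp
      qed
      ultimately show ?thesis
        using u_le by (intro bexI[of _ u]) (auto simp: A_def le_fun_def)
    qed
  qed
  then obtain p where p: "p \<in> A" "\<And>a. a \<in> A \<Longrightarrow> a \<le> p \<Longrightarrow> a = p" by auto
  have "p' = p" if "sublinear p'" "p' \<le> p" for p'
    using p(2)[of p'] p(1) that by (auto simp: A_def)
  then show ?thesis
    using p(1) by (auto simp: A_def)
qed

text \<open>The Hahn-Banach theorem.\<close>

lemma exists_linear_below_sublinear:
  fixes q :: "'a::real_vector \<Rightarrow> real"
  assumes q: "sublinear q"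
  shows "\<exists>p. linear p \<and> (\<forall>x. p x \<le> q x)"
proof -
  obtain p where p: "sublinear p" "p \<le> q" and min: "\<And>p'. sublinear p' \<Longrightarrow> p' \<le> p \<Longrightarrow> p' = p"
    using minimal_sublinear_exists[OF q] by blast
  have tilt: "tilt a p = p" for a
    using sublinear_tilt[OF p(1)] tilt_le_self[OF p(1)] by (intro min) (auto simp: le_fun_def)
  have add: "p (x + a) = p x + p a" for x a
  proof (rule antisym)
    have "p x \<le> p (x + 1 *\<^sub>R a) - 1 * p a"
      using tilt_le[OF p(1), of 1 a x] unfolding tilt by simp
    then show "p x + p a \<le> p (x + a)" by simp
  qed (use p(1) in \<open>rule sublinear_add\<close>)
  have minus: "p (- x) = - p x" for x
    using add[of x "- x"] sublinear_zero[OF p(1)] by simp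
  have "p (c *\<^sub>R x) = c *\<^sub>R p x" for c x
  proof (cases c "0 :: real" rule: linorder_cases)
    case less
    then have "p ((- c) *\<^sub>R x) = (- c) * p x"
      by (intro sublinear_scale[OF p(1)]) auto
    then show ?thesis using minus[of "c *\<^sub>R x"] by simp
  next
    case equal
    then show ?thesis using sublinear_zero[OF p(1)] by simp
  next
    case greater
    then show ?thesis using sublinear_scale[OF p(1)] by simp
  qed
  then have "linear p"
    by (intro linearI add) auto
  then show ?thesis
    using p(2) by (auto simp: le_fun_def)
qed

subsection \<open>Scalar multiplication\<close>

lemma scaleC_zero_right [simp]: "c *\<^sub>C (0::'a::complex_banach) = 0"
  using norm_scaleC[of c "0::'a"] by simp

lemma scaleC_zero_left [simp]: "0 *\<^sub>C (x::'a::complex_banach) = 0"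
  using norm_scaleC[of 0 x] by simp

lemma scaleC_minus_right: "c *\<^sub>C (- x::'a::complex_banach) = - (c *\<^sub>C x)"
  using scaleC_add_right[of c x "- x"] by (simp add: eq_neg_iff_add_eq_0 add.commute)

lemma scaleC_diff_right: "c *\<^sub>C (x - y::'a::complex_banach) = c *\<^sub>C x - c *\<^sub>C y"
  using scaleC_add_right[of c x "- y"] by (simp add: scaleC_minus_right)

lemma scaleC_sum_right: "c *\<^sub>C (\<Sum>i\<in>I. x i :: 'a::complex_banach) = (\<Sum>i\<in>I. c *\<^sub>C x i)"
  by (induction I rule: infinite_finite_induct) (auto simp: scaleC_add_right)

lemma scaleC_sum_left: "(\<Sum>i\<in>I. c i) *\<^sub>C (x :: 'a::complex_banach) = (\<Sum>i\<in>I. c i *\<^sub>C x)"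
  by (induction I rule: infinite_finite_induct) (auto simp: scaleC_add_left)

lemma scaleC_one [simp]: "1 *\<^sub>C (x::'a::complex_banach) = x"
  using scaleC_of_real[of 1 x] by simp

lemma scaleR_conv_scaleC: "r *\<^sub>R (x::'a::complex_banach) = complex_of_real r *\<^sub>C x"
  by (simp add: scaleC_of_real)

text \<open>A real functional below the tilt of the norm at \<open>x\<close> takes the value \<open>norm x\<close> at \<open>x\<close>; it is the
  real part of a complex functional, whose bound follows by rotating the argument.\<close>

lemma norm_attained_on_dual_unit_ball:
  fixes x :: "'a::complex_banach"
  shows "\<exists>x'\<in>dual_unit_ball. norm x \<le> cmod (x' x)"
proof -
  obtain \<phi> :: "'a \<Rightarrow> real" where lin: "linear \<phi>" and le: "\<And>y. \<phi> y \<le> tilt x norm y"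
    using exists_linear_below_sublinear[OF sublinear_tilt[OF sublinear_norm]] by metis
  have le_norm: "\<phi> y \<le> norm y" for y
    using le[of y] tilt_le_self[OF sublinear_norm, of x y] by simp
  have x: "norm x \<le> \<phi> x"
    using le[of "- x"] tilt_uminus[OF sublinear_norm, of x] linear_neg[OF lin, of x] by simp
  define x' where "x' y = Complex (\<phi> y) (- \<phi> (\<i> *\<^sub>C y))" for y
  have scale: "x' (c *\<^sub>C y) = c * x' y" for c y
  proof -
    have 1: "c *\<^sub>C y = Re c *\<^sub>R y + Im c *\<^sub>R (\<i> *\<^sub>C y)"
      unfolding scaleR_conv_scaleC scaleC_scaleC
      by (subst scaleC_add_left[symmetric]) (simp add: mult.commute flip: complex_eq)
    have 2: "\<i> *\<^sub>C (c *\<^sub>C y) = Re c *\<^sub>R (\<i> *\<^sub>C y) - Im c *\<^sub>R y"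
    proof -
      have "\<i> * c = complex_of_real (Re c) * \<i> + complex_of_real (- Im c)"
        by (simp add: complex_eq_iff)
      then have "\<i> *\<^sub>C (c *\<^sub>C y) = Re c *\<^sub>R (\<i> *\<^sub>C y) + (- Im c) *\<^sub>R y"
        by (simp only: scaleR_conv_scaleC scaleC_scaleC scaleC_add_left)
      then show ?thesis by simp
    qed
    have "x' (c *\<^sub>C y) = Complex (\<phi> (Re c *\<^sub>R y + Im c *\<^sub>R (\<i> *\<^sub>C y)))
        (- \<phi> (Re c *\<^sub>R (\<i> *\<^sub>C y) - Im c *\<^sub>R y))"
      unfolding x'_def 2 by (simp only: 1)
    then show ?thesis
      by (simp add: x'_def linear_add[OF lin] linear_diff[OF lin] linear_scale[OF lin] complex_eq_iff)
  qed
  have "cmod (x' y) \<le> norm y" for y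
  proof (cases "x' y = 0")
    case False
    define c where "c = cnj (x' y) / cmod (x' y)"
    have "x' (c *\<^sub>C y) = complex_of_real (cmod (x' y))"
      using False complex_norm_square[of "x' y"] unfolding scale c_def
      by (simp add: field_simps power2_eq_square)
    then have "cmod (x' y) = \<phi> (c *\<^sub>C y)"
      by (simp add: x'_def complex_eq_iff)
    also have "\<dots> \<le> norm (c *\<^sub>C y)" by (rule le_norm)
    also have "\<dots> = norm y" using False by (simp add: norm_scaleC c_def norm_divide)
    finally show ?thesis .
  qed auto
  moreover have "x' (y + z) = x' y + x' z" for y z
    unfolding x'_def scaleC_add_right linear_add[OF lin] by (simp add: complex_eq_iff)
  ultimately have "x' \<in> dual_unit_ball"
    using scale by (simp add: dual_unit_ball_def)
  moreover have "norm x \<le> cmod (x' x)"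
    using x abs_Re_le_cmod[of "x' x"] by (simp add: x'_def)
  ultimately show ?thesis by blast
qed

section \<open>Integration against a vector measure\<close>

definition finitely_additive :: "('g::topological_space set \<Rightarrow> 'v::ab_group_add) \<Rightarrow> bool" where
  "finitely_additive \<mu> \<longleftrightarrow>
     (\<forall>A\<in>sets borel. \<forall>B\<in>sets borel. A \<inter> B = {} \<longrightarrow> \<mu> (A \<union> B) = \<mu> A + \<mu> B)"

lemma finitely_additive_Un:
  assumes "finitely_additive \<mu>" "A \<in> sets borel" "B \<in> sets borel" "A \<inter> B = {}"
  shows "\<mu> (A \<union> B) = \<mu> A + \<mu> B"
  using assms unfolding finitely_additive_def by blast

lemma finitely_additive_empty: "finitely_additive \<mu> \<Longrightarrow> \<mu> {} = 0"
  using finitely_additive_Un[of \<mu> "{}" "{}"] by simp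

lemma finitely_additive_UN:
  assumes \<mu>: "finitely_additive \<mu>" and "finite I" "\<And>i. i \<in> I \<Longrightarrow> A i \<in> sets borel"
    "disjoint_family_on A I"
  shows "\<mu> (\<Union>i\<in>I. A i) = (\<Sum>i\<in>I. \<mu> (A i))"
  using assms(2-)
proof (induction I rule: finite_induct)
  case empty
  then show ?case using finitely_additive_empty[OF \<mu>] by simp
next
  case (insert j I)
  have "A j \<inter> (\<Union>i\<in>I. A i) = {}"
    using insert.hyps insert.prems by (auto simp: disjoint_family_on_def)
  moreover have "A j \<in> sets borel" "(\<Union>i\<in>I. A i) \<in> sets borel"
    using insert.prems insert.hyps by auto
  ultimately have "\<mu> (A j \<union> (\<Union>i\<in>I. A i)) = \<mu> (A j) + \<mu> (\<Union>i\<in>I. A i)"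
    using \<mu> by (auto simp: finitely_additive_def)
  then show ?case
    using insert by (simp add: disjoint_family_on_mono[OF subset_insertI])
qed

lemma fibre_in_borel: "simple_function borel u \<Longrightarrow> u -` {y} \<in> sets borel"
  using simple_functionD(2)[of borel u "{y}"] by simp

lemma finite_range_simple: "simple_function (borel :: 'g::topological_space measure) u \<Longrightarrow> finite (range u)"
  using simple_functionD(1)[of borel u] by simp

text \<open>Integrals of simple functions may be computed on any finer partition into fibres; this yields
  their linearity, by passing to a function that separates the values of all summands.\<close>

lemma sum_fibres_comp:
  fixes \<mu> :: "'g::topological_space set \<Rightarrow> 'v::ab_group_add" and b :: "'c \<Rightarrow> 'v \<Rightarrow> 'w::ab_group_add"
  assumes \<mu>: "finitely_additive \<mu>" and u: "simple_function borel u"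
    and b: "\<And>c v w. b c (v + w) = b c v + b c w"
  shows "(\<Sum>x\<in>range (\<lambda>t. k (u t)). b x (\<mu> ((\<lambda>t. k (u t)) -` {x})))
       = (\<Sum>y\<in>range u. b (k y) (\<mu> (u -` {y})))"
proof -
  have fin: "finite (range u)" using finite_range_simple[OF u] .
  have b0: "b c 0 = 0" for c using b[of c 0 0] by simp
  have b_sum: "b c (sum g J) = (\<Sum>j\<in>J. b c (g j))" for c and J :: "'d set" and g
    by (induction J rule: infinite_finite_induct) (auto simp: b b0)
  have "(\<Sum>y\<in>range u. b (k y) (\<mu> (u -` {y}))) =
        (\<Sum>x\<in>k ` range u. \<Sum>y | y \<in> range u \<and> k y = x. b (k y) (\<mu> (u -` {y})))"
    by (rule sum.image_gen[OF fin])
  also have "\<dots> = (\<Sum>x\<in>k ` range u. b x (\<mu> ((\<lambda>t. k (u t)) -` {x})))"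
  proof (rule sum.cong[OF refl])
    fix x
    let ?Y = "{y. y \<in> range u \<and> k y = x}"
    have "(\<lambda>t. k (u t)) -` {x} = (\<Union>y\<in>?Y. u -` {y})" by auto
    also have "\<mu> \<dots> = (\<Sum>y\<in>?Y. \<mu> (u -` {y}))"
      using \<mu> fin fibre_in_borel[OF u]
      by (intro finitely_additive_UN) (auto simp: disjoint_family_on_def)
    finally show "(\<Sum>y\<in>?Y. b (k y) (\<mu> (u -` {y}))) = b x (\<mu> ((\<lambda>t. k (u t)) -` {x}))"
      by (simp add: b_sum)
  qed
  finally show ?thesis by (simp add: image_image)
qed

lemma vector_measure_finitely_additive:
  fixes \<nu> :: "'g::topological_space set \<Rightarrow> 'x::real_normed_vector"
  assumes \<nu>: "vector_measure \<nu>"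
  shows "finitely_additive \<nu>"
  unfolding finitely_additive_def
proof (intro ballI impI)
  have "(\<lambda>i::nat. \<nu> {}) sums \<nu> (\<Union>i::nat. {})"
    using \<nu> unfolding vector_measure_def by (auto simp: disjoint_family_on_def)
  then have 0: "\<nu> {} = 0"
    using summable_LIMSEQ_zero[of "\<lambda>i::nat. \<nu> {}"] by (auto simp: sums_iff LIMSEQ_const_iff)
  fix A B :: "'g set" assume AB: "A \<in> sets borel" "B \<in> sets borel" "A \<inter> B = {}"
  have "(\<lambda>i. \<nu> (binaryset A B i)) sums \<nu> (\<Union>i. binaryset A B i)"
  proof -
    have "disjoint_family (binaryset A B)"
      using AB(3) by (simp add: disjoint_family_on_def binaryset_def Int_commute)
    moreover have "range (binaryset A B) \<subseteq> sets borel"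
      using AB by (auto simp: range_binaryset_eq)
    ultimately show ?thesis
      using \<nu> unfolding vector_measure_def by blast
  qed
  moreover have "(\<lambda>i. \<nu> (binaryset A B i)) sums (\<nu> A + \<nu> B)"
    using 0 by (rule binaryset_sums)
  ultimately show "\<nu> (A \<union> B) = \<nu> A + \<nu> B"
    by (auto simp: UN_binaryset_eq dest: sums_unique2)
qed

lemma vector_measure_Diff:
  assumes "vector_measure \<nu>" "A \<in> sets borel" "B \<in> sets borel" "B \<subseteq> A"
  shows "\<nu> (A - B) = \<nu> A - \<nu> B"
proof -
  have "\<nu> ((A - B) \<union> B) = \<nu> (A - B) + \<nu> B"
    using assms by (intro finitely_additive_Un vector_measure_finitely_additive) auto
  moreover have "(A - B) \<union> B = A" using assms by auto
  ultimately show ?thesis by simp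
qed

text \<open>If \<open>\<nu>\<close> were unbounded, one could split off disjoint sets of measure larger than one forever,
  keeping a remainder on which \<open>\<nu>\<close> is still unbounded; but the measures of disjoint sets tend to 0.\<close>

lemma vector_measure_bounded:
  fixes \<nu> :: "'g::topological_space set \<Rightarrow> 'x::real_normed_vector"
  assumes \<nu>: "vector_measure \<nu>"
  shows "\<exists>C. \<forall>A\<in>sets borel. norm (\<nu> A) \<le> C"
proof (rule ccontr)
  define unb where "unb E \<longleftrightarrow> E \<in> sets borel \<and> (\<forall>C. \<exists>A\<in>sets borel. A \<subseteq> E \<and> norm (\<nu> A) > C)" for E
  assume "\<not> ?thesis"
  then have unb_UNIV: "unb UNIV"
    by (auto simp: unb_def not_le)
  have step: "\<exists>E'. unb E' \<and> E' \<subseteq> E \<and> norm (\<nu> (E - E')) > 1" if "unb E" for E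
  proof -
    have E: "E \<in> sets borel" using that by (simp add: unb_def)
    obtain A where A: "A \<in> sets borel" "A \<subseteq> E" "norm (\<nu> A) > norm (\<nu> E) + 1"
      using \<open>unb E\<close> unfolding unb_def by metis
    have EA: "norm (\<nu> (E - A)) > 1"
      using vector_measure_Diff[OF \<nu> E A(1,2)] norm_triangle_ineq2[of "\<nu> A" "\<nu> E"] A(3)
      by (simp add: norm_minus_commute)
    show ?thesis
    proof (cases "unb A")
      case True
      then show ?thesis using A EA by (intro exI[of _ A]) auto
    next
      case False
      then obtain C where C: "\<And>B. B \<in> sets borel \<Longrightarrow> B \<subseteq> A \<Longrightarrow> norm (\<nu> B) \<le> C"
        using A by (auto simp: unb_def not_less)
      have "unb (E - A)"
        unfolding unb_def
      proof (intro conjI allI)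
        fix D
        obtain B where B: "B \<in> sets borel" "B \<subseteq> E" "norm (\<nu> B) > C + D"
          using \<open>unb E\<close> unfolding unb_def by metis
        have "\<nu> (B \<inter> A \<union> (B - A)) = \<nu> (B \<inter> A) + \<nu> (B - A)"
          using A(1) B(1) by (intro finitely_additive_Un vector_measure_finitely_additive \<nu>) auto
        moreover have "B \<inter> A \<union> (B - A) = B" by auto
        ultimately have "norm (\<nu> B) \<le> norm (\<nu> (B \<inter> A)) + norm (\<nu> (B - A))"
          using norm_triangle_ineq by metis
        moreover have "norm (\<nu> (B \<inter> A)) \<le> C" using A B by (intro C) auto
        ultimately have "norm (\<nu> (B - A)) > D" using B by simp
        then show "\<exists>B\<in>sets borel. B \<subseteq> E - A \<and> norm (\<nu> B) > D"
          using A B by (intro bexI[of _ "B - A"]) auto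
      qed (use E A in auto)
      moreover have "E - (E - A) = A" using A by auto
      moreover have "norm (\<nu> A) > 1" using A(3) norm_ge_zero[of "\<nu> E"] by linarith
      ultimately show ?thesis by (intro exI[of _ "E - A"]) auto
    qed
  qed
  have "\<exists>E. \<forall>n::nat. unb (E n) \<and> (E (Suc n) \<subseteq> E n \<and> norm (\<nu> (E n - E (Suc n))) > 1)"
    using unb_UNIV step by (intro dependent_nat_choice) auto
  then obtain E where E: "\<And>n::nat. unb (E n)" "\<And>n. E (Suc n) \<subseteq> E n"
    "\<And>n. norm (\<nu> (E n - E (Suc n))) > 1"
    by auto
  define D where "D n = E n - E (Suc n)" for n
  have "decseq E" using E(2) by (rule decseq_SucI)
  then have "D i \<inter> D j = {}" if "i < j" for i j
    using that decseqD[of E "Suc i" j] by (auto simp: D_def)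
  then have "disjoint_family D"
    unfolding disjoint_family_on_def by (metis Int_commute linorder_neqE_nat)
  moreover have "range D \<subseteq> sets borel"
    using E(1) by (auto simp: D_def unb_def)
  ultimately have "(\<lambda>i. \<nu> (D i)) sums \<nu> (\<Union>i. D i)"
    using \<nu> by (auto simp: vector_measure_def)
  then have "(\<lambda>i. \<nu> (D i)) \<longlonglongrightarrow> 0"
    by (auto simp: sums_iff intro: summable_LIMSEQ_zero)
  then have "\<forall>\<^sub>F i in sequentially. norm (\<nu> (D i)) < 1"
    by (metis tendsto_norm_zero order_tendstoD(2) zero_less_one)
  then show False
    using E(3) by (auto simp: D_def eventually_sequentially dest: less_asym)
qed

text \<open>The terms of one sign add up to the value of \<open>\<mu>\<close> on a union.\<close>

lemma sum_abs_le_2_bound: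
  fixes \<mu> :: "'g::topological_space set \<Rightarrow> real"
  assumes \<mu>: "finitely_additive \<mu>" and C: "\<And>A. A \<in> sets borel \<Longrightarrow> \<bar>\<mu> A\<bar> \<le> C"
    and \<rho>: "finite \<rho>" "\<rho> \<subseteq> sets borel" "disjoint \<rho>"
  shows "(\<Sum>A\<in>\<rho>. \<bar>\<mu> A\<bar>) \<le> 2 * C"
proof -
  have part: "\<bar>\<Sum>A\<in>\<sigma>. \<mu> A\<bar> \<le> C" if "\<sigma> \<subseteq> \<rho>" for \<sigma>
  proof -
    have "\<mu> (\<Union>A\<in>\<sigma>. A) = (\<Sum>A\<in>\<sigma>. \<mu> A)"
      using \<rho> that by (intro finitely_additive_UN[OF \<mu>])
        (auto simp: finite_subset disjoint_family_on_def dest: disjointD subsetD)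
    moreover have "(\<Union>A\<in>\<sigma>. A) \<in> sets borel"
      using \<rho> that by (intro sets.finite_UN) (auto intro: finite_subset)
    ultimately show ?thesis using C by metis
  qed
  have "(\<Sum>A\<in>\<rho>. \<bar>\<mu> A\<bar>) = (\<Sum>A\<in>{A\<in>\<rho>. \<mu> A \<ge> 0}. \<bar>\<mu> A\<bar>) + (\<Sum>A\<in>{A\<in>\<rho>. \<not> \<mu> A \<ge> 0}. \<bar>\<mu> A\<bar>)"
    using \<rho>(1) by (subst sum.union_disjoint[symmetric]) (auto intro: sum.cong)
  also have "\<dots> = (\<Sum>A\<in>{A\<in>\<rho>. \<mu> A \<ge> 0}. \<mu> A) + (\<Sum>A\<in>{A\<in>\<rho>. \<not> \<mu> A \<ge> 0}. - \<mu> A)"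
    by (intro arg_cong2[of _ _ _ _ "(+)"] sum.cong) auto
  also have "\<dots> \<le> 2 * C"
    using part[of "{A\<in>\<rho>. \<mu> A \<ge> 0}"] part[of "{A\<in>\<rho>. \<not> \<mu> A \<ge> 0}"] by (simp add: sum_negf)
  finally show ?thesis .
qed

lemma dual_unit_ballD:
  assumes "x' \<in> dual_unit_ball"
  shows "x' (x + y) = x' x + x' y" "x' (c *\<^sub>C x) = c * x' x" "cmod (x' x) \<le> norm x" "x' 0 = 0"
    "x' (\<Sum>i\<in>I. f i) = (\<Sum>i\<in>I. x' (f i))"
proof -
  show add: "x' (x + y) = x' x + x' y" and "x' (c *\<^sub>C x) = c * x' x" "cmod (x' x) \<le> norm x" for x y
    using assms by (auto simp: dual_unit_ball_def)
  show 0: "x' 0 = 0" using add[of 0 0] by simp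
  show "x' (\<Sum>i\<in>I. f i) = (\<Sum>i\<in>I. x' (f i))"
    by (induction I rule: infinite_finite_induct) (auto simp: add 0)
qed

lemma semivariation_finite:
  fixes \<nu> :: "'g::topological_space set \<Rightarrow> 'x::complex_banach"
  assumes \<nu>: "vector_measure \<nu>"
  shows "semivariation \<nu> < \<infinity>"
proof -
  obtain C where C: "\<And>A. A \<in> sets borel \<Longrightarrow> norm (\<nu> A) \<le> C"
    using vector_measure_bounded[OF \<nu>] by auto
  note add = vector_measure_finitely_additive[OF \<nu>]
  have "semivariation \<nu> \<le> ennreal (4 * C)"
    unfolding semivariation_def total_variation_def
  proof (intro SUP_least)
    fix x' :: "'x \<Rightarrow> complex" and \<rho> :: "'g set set" assume x': "x' \<in> dual_unit_ball" and "\<rho> \<in> borel_partitions"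
    then have \<rho>: "finite \<rho>" "\<rho> \<subseteq> sets borel" "disjoint \<rho>"
      by (auto simp: borel_partitions_def partition_on_def)
    have le: "cmod (x' (\<nu> A)) \<le> C" if "A \<in> sets borel" for A
      using dual_unit_ballD(3)[OF x', of "\<nu> A"] C[OF that] by simp
    have Re: "(\<Sum>A\<in>\<rho>. \<bar>Re (x' (\<nu> A))\<bar>) \<le> 2 * C"
      using add \<rho> by (intro sum_abs_le_2_bound)
        (auto simp: finitely_additive_def dual_unit_ballD[OF x'] intro: order_trans[OF abs_Re_le_cmod le])
    have Im: "(\<Sum>A\<in>\<rho>. \<bar>Im (x' (\<nu> A))\<bar>) \<le> 2 * C"
      using add \<rho> by (intro sum_abs_le_2_bound)
        (auto simp: finitely_additive_def dual_unit_ballD[OF x'] intro: order_trans[OF abs_Im_le_cmod le])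
    have "(\<Sum>A\<in>\<rho>. cmod (x' (\<nu> A))) \<le> (\<Sum>A\<in>\<rho>. \<bar>Re (x' (\<nu> A))\<bar> + \<bar>Im (x' (\<nu> A))\<bar>)"
      by (intro sum_mono cmod_le)
    also have "\<dots> \<le> 4 * C" using Re Im by (simp add: sum.distrib)
    finally show "(\<Sum>A\<in>\<rho>. ennreal (cmod (x' (\<nu> A)))) \<le> ennreal (4 * C)"
      by (subst sum_ennreal) (auto intro: ennreal_leI)
  qed
  also have "\<dots> < \<infinity>" by simp
  finally show ?thesis .
qed

subsection \<open>Simple functions\<close>

lemma simple_vm_integral_comp:
  fixes \<nu> :: "'g::topological_space set \<Rightarrow> 'x::complex_banach"
  assumes "finitely_additive \<nu>" "simple_function borel u"
  shows "simple_vm_integral \<nu> (\<lambda>t. k (u t)) = (\<Sum>y\<in>range u. k y *\<^sub>C \<nu> (u -` {y}))"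
  unfolding simple_vm_integral_def
  by (rule sum_fibres_comp[OF assms, where b="\<lambda>c v. c *\<^sub>C v"]) (rule scaleC_add_right)

lemma simple_density_comp:
  fixes M :: "'g::topological_space measure" and k :: "'c \<Rightarrow> 'x::complex_banach"
  assumes M: "sets M = sets borel" "finite_measure M" and u: "simple_function borel u" and A: "A \<in> sets borel"
  shows "simple_density M (\<lambda>t. k (u t)) A = (\<Sum>y\<in>range u. measure M (A \<inter> u -` {y}) *\<^sub>R k y)"
proof -
  interpret finite_measure M by (rule M(2))
  have "finitely_additive (\<lambda>E. measure M (A \<inter> E))"
    unfolding finitely_additive_def
  proof (intro ballI impI)
    fix E F :: "'g set" assume "E \<in> sets borel" "F \<in> sets borel" "E \<inter> F = {}"
    then show "measure M (A \<inter> (E \<union> F)) = measure M (A \<inter> E) + measure M (A \<inter> F)"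
      using A M(1) finite_measure_Union[of "A \<inter> E" "A \<inter> F"] by (auto simp: Int_Un_distrib)
  qed
  from sum_fibres_comp[OF this u, where b="\<lambda>x r. r *\<^sub>R x" and k=k] show ?thesis
    unfolding simple_density_def by (simp add: scaleR_add_left)
qed

lemma simple_vm_integral_add:
  fixes \<nu> :: "'g::topological_space set \<Rightarrow> 'x::complex_banach"
  assumes \<nu>: "finitely_additive \<nu>" and u: "simple_function borel u" and v: "simple_function borel v"
  shows "simple_vm_integral \<nu> (\<lambda>t. u t + c * v t) = simple_vm_integral \<nu> u + c *\<^sub>C simple_vm_integral \<nu> v"
proof -
  let ?w = "\<lambda>t. (u t, v t)"
  note comp = simple_vm_integral_comp[OF \<nu> simple_function_Pair[OF u v]]
  have "simple_vm_integral \<nu> (\<lambda>t. u t + c * v t)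
      = (\<Sum>y\<in>range ?w. (fst y + c * snd y) *\<^sub>C \<nu> (?w -` {y}))"
    using comp[of "\<lambda>y. fst y + c * snd y"] by simp
  also have "\<dots> = (\<Sum>y\<in>range ?w. fst y *\<^sub>C \<nu> (?w -` {y})) + c *\<^sub>C (\<Sum>y\<in>range ?w. snd y *\<^sub>C \<nu> (?w -` {y}))"
    unfolding scaleC_sum_right sum.distrib[symmetric] scaleC_add_left scaleC_scaleC ..
  finally show ?thesis
    using comp[of fst] comp[of snd] by simp
qed

lemma fibres_borel_partition:
  assumes "simple_function borel s"
  shows "(\<lambda>c. s -` {c}) ` range s \<in> borel_partitions"
  unfolding borel_partitions_def partition_on_def
  using finite_range_simple[OF assms] fibre_in_borel[OF assms]
  by (auto simp: disjoint_def)

lemma inj_on_fibres: "inj_on (\<lambda>c. s -` {c}) (range s)"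
  by (auto simp: inj_on_def)

text \<open>A functional that norms the integral turns it into a sum of scalars bounded by a total variation.\<close>

lemma norm_simple_vm_integral_le_semivariation:
  fixes \<nu> :: "'g::topological_space set \<Rightarrow> 'x::complex_banach"
  assumes \<nu>: "vector_measure \<nu>" and s: "simple_function borel s" and B: "\<And>t. cmod (s t) \<le> B"
  shows "norm (simple_vm_integral \<nu> s) \<le> B * enn2real (semivariation \<nu>)"
proof -
  have B0: "B \<ge> 0" using B[of undefined] norm_ge_zero[of "s undefined"] by linarith
  obtain x' where x': "x' \<in> dual_unit_ball" "norm (simple_vm_integral \<nu> s) \<le> cmod (x' (simple_vm_integral \<nu> s))"
    using norm_attained_on_dual_unit_ball by blast
  have "(\<Sum>c\<in>range s. ennreal (cmod (x' (\<nu> (s -` {c})))))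
      = (\<Sum>A\<in>(\<lambda>c. s -` {c}) ` range s. ennreal (cmod (x' (\<nu> A))))"
    by (subst sum.reindex[OF inj_on_fibres]) simp
  also have "\<dots> \<le> total_variation (\<lambda>A. x' (\<nu> A))"
    unfolding total_variation_def by (rule SUP_upper[OF fibres_borel_partition[OF s]])
  also have "\<dots> \<le> semivariation \<nu>"
    unfolding semivariation_def by (rule SUP_upper[OF x'(1)])
  finally have "enn2real (\<Sum>c\<in>range s. ennreal (cmod (x' (\<nu> (s -` {c}))))) \<le> enn2real (semivariation \<nu>)"
    using semivariation_finite[OF \<nu>] by (intro enn2real_mono) auto
  then have var: "(\<Sum>c\<in>range s. cmod (x' (\<nu> (s -` {c})))) \<le> enn2real (semivariation \<nu>)"
    by (subst (asm) sum_ennreal) (auto simp: enn2real_ennreal sum_nonneg)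
  have "cmod (x' (simple_vm_integral \<nu> s)) \<le> (\<Sum>c\<in>range s. cmod (c * x' (\<nu> (s -` {c}))))"
    unfolding simple_vm_integral_def dual_unit_ballD[OF x'(1)] by (rule norm_sum)
  also have "\<dots> \<le> (\<Sum>c\<in>range s. B * cmod (x' (\<nu> (s -` {c}))))"
    using B by (intro sum_mono) (auto simp: norm_mult intro: mult_right_mono)
  also have "\<dots> \<le> B * enn2real (semivariation \<nu>)"
    using var B0 by (simp add: mult_left_mono flip: sum_distrib_left)
  finally show ?thesis using x'(2) by simp
qed

lemma conjugate_exponent_real:
  assumes "1 < p"
  shows "conjugate_exponent (ennreal p) = ennreal (p / (p - 1))"
proof -
  have "1 - 1 / ennreal p = ennreal ((p - 1) / p)"
    using assms by (simp add: divide_ennreal ennreal_minus diff_divide_distrib flip: ennreal_1)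
  then show ?thesis
    using assms unfolding conjugate_exponent_def by (simp add: divide_ennreal flip: ennreal_1)
qed

lemma Lp_norm_le_iff:
  assumes "1 \<le> p" "C \<ge> 0"
  shows "Lp_norm (ennreal p) M f \<le> ennreal C \<longleftrightarrow> (\<integral>\<^sup>+x. ennreal (cmod (f x) powr p) \<partial>M) \<le> ennreal (C powr p)"
proof (cases "(\<integral>\<^sup>+x. ennreal (cmod (f x) powr p) \<partial>M) = \<infinity>")
  case True
  then show ?thesis using assms by (simp add: Lp_norm_def top_unique)
next
  case False
  then obtain I where I: "I \<ge> 0" "(\<integral>\<^sup>+x. ennreal (cmod (f x) powr p) \<partial>M) = ennreal I"
    by (cases "\<integral>\<^sup>+x. ennreal (cmod (f x) powr p) \<partial>M") auto
  have "I powr (1 / p) \<le> C \<longleftrightarrow> I \<le> C powr p"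
  proof
    assume "I powr (1 / p) \<le> C"
    then have "(I powr (1 / p)) powr p \<le> C powr p" using assms by (intro powr_mono2) auto
    then show "I \<le> C powr p" using assms I by (simp add: powr_powr)
  next
    assume "I \<le> C powr p"
    then have "I powr (1 / p) \<le> (C powr p) powr (1 / p)" using assms I by (intro powr_mono2) auto
    then show "I powr (1 / p) \<le> C" using assms by (simp add: powr_powr)
  qed
  then show ?thesis using assms I by (simp add: Lp_norm_def)
qed

text \<open>The function \<open>s / C\<close> is one of those over which the supremum defining the \<open>p\<close>-semivariation is
  taken. A bound \<open>C > 0\<close> in place of the exact norm includes functions of norm zero.\<close>

lemma norm_simple_vm_integral_le_p_semivariation:
  fixes \<nu> :: "'g::topological_space set \<Rightarrow> 'x::complex_banach"
  assumes M: "sets M = sets borel" and p: "1 < p" and fin: "p_semivariation (ennreal p) M \<nu> < \<infinity>"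
    and s: "simple_function borel s" and C: "C > 0"
    and le: "(\<integral>\<^sup>+t. ennreal (cmod (s t) powr (p / (p - 1))) \<partial>M) \<le> ennreal (C powr (p / (p - 1)))"
  shows "norm (simple_vm_integral \<nu> s) \<le> C * enn2real (p_semivariation (ennreal p) M \<nu>)"
proof -
  let ?P = "p / (p - 1)"
  have sM [measurable]: "s \<in> borel_measurable M"
    unfolding measurable_cong_sets[OF M refl] using s by (rule borel_measurable_simple_function)
  define \<rho> where "\<rho> = (\<lambda>c. s -` {c}) ` range s"
  define \<alpha> where "\<alpha> A = s (SOME t. t \<in> A) / complex_of_real C" for A
  have \<rho>: "\<rho> \<in> borel_partitions" unfolding \<rho>_def by (rule fibres_borel_partition[OF s])
  have \<alpha>: "\<alpha> (s -` {c}) = c / complex_of_real C" if "c \<in> range s" for c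
  proof -
    from that have "\<exists>t. t \<in> s -` {c}" by auto
    then have "(SOME t. t \<in> s -` {c}) \<in> s -` {c}" by (rule someI_ex)
    then show ?thesis by (simp add: \<alpha>_def)
  qed
  have g: "(\<Sum>A\<in>\<rho>. \<alpha> A * indicator A t) = s t / complex_of_real C" for t
  proof -
    have "(\<Sum>A\<in>\<rho>. \<alpha> A * indicator A t) = (\<Sum>c\<in>range s. \<alpha> (s -` {c}) * indicator (s -` {c}) t)"
      unfolding \<rho>_def by (subst sum.reindex[OF inj_on_fibres]) simp
    also have "\<dots> = (\<Sum>c\<in>range s. if c = s t then s t / complex_of_real C else 0)"
      by (intro sum.cong) (auto simp: \<alpha> indicator_def)
    also have "\<dots> = s t / complex_of_real C"
      using finite_range_simple[OF s] by simp
    finally show ?thesis .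
  qed
  have "Lp_norm (ennreal ?P) M (\<lambda>t. s t / complex_of_real C) \<le> ennreal 1"
  proof (subst Lp_norm_le_iff)
    have "(\<integral>\<^sup>+t. ennreal (cmod (s t / complex_of_real C) powr ?P) \<partial>M)
        = (\<integral>\<^sup>+t. ennreal (1 / C powr ?P) * ennreal (cmod (s t) powr ?P) \<partial>M)"
      using C by (intro nn_integral_cong) (simp add: norm_divide powr_divide flip: ennreal_mult')
    also have "\<dots> \<le> ennreal (1 / C powr ?P) * (\<integral>\<^sup>+t. ennreal (cmod (s t) powr ?P) \<partial>M)"
      using sM by (subst nn_integral_cmult) auto
    also have "\<dots> \<le> ennreal (1 / C powr ?P) * ennreal (C powr ?P)"
      by (intro mult_left_mono le) auto
    also have "\<dots> = ennreal (1 powr ?P)" using C by (simp flip: ennreal_mult')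
    finally show "(\<integral>\<^sup>+t. ennreal (cmod (s t / complex_of_real C) powr ?P) \<partial>M) \<le> ennreal (1 powr ?P)" .
  qed (use p in \<open>auto simp: field_simps\<close>)
  then have Lp: "Lp_norm (conjugate_exponent (ennreal p)) M (\<lambda>t. \<Sum>A\<in>\<rho>. \<alpha> A * indicator A t) \<le> 1"
    unfolding g conjugate_exponent_real[OF p] by simp
  have "simple_vm_integral \<nu> s = complex_of_real C *\<^sub>C (\<Sum>A\<in>\<rho>. \<alpha> A *\<^sub>C \<nu> A)"
    unfolding \<rho>_def simple_vm_integral_def using C
    by (subst sum.reindex[OF inj_on_fibres]) (auto simp: scaleC_sum_right scaleC_scaleC \<alpha> intro!: sum.cong)
  moreover have "ennreal (norm (\<Sum>A\<in>\<rho>. \<alpha> A *\<^sub>C \<nu> A)) \<le> p_semivariation (ennreal p) M \<nu>"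
    unfolding p_semivariation_def if_not_P[OF ennreal_neq_top, folded infinity_ennreal_def]
    by (rule SUP_upper2[where i="(\<rho>, \<alpha>)"]) (use \<rho> Lp in simp_all)
  then have "norm (\<Sum>A\<in>\<rho>. \<alpha> A *\<^sub>C \<nu> A) \<le> enn2real (p_semivariation (ennreal p) M \<nu>)"
    using enn2real_mono[of "ennreal (norm (\<Sum>A\<in>\<rho>. \<alpha> A *\<^sub>C \<nu> A))"] fin by simp
  ultimately show ?thesis
    using C by (simp add: norm_scaleC mult_left_mono)
qed

subsection \<open>Uniform limits of simple functions\<close>

definition regulated :: "('g::topological_space \<Rightarrow> complex) \<Rightarrow> bool" where
  "regulated h \<longleftrightarrow> (\<exists>s. (\<forall>n. simple_function borel (s n)) \<and> uniform_limit UNIV s h sequentially)"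

lemma simple_function_add_mult:
  fixes u v :: "'g::topological_space \<Rightarrow> complex"
  assumes "simple_function borel u" "simple_function borel v"
  shows "simple_function borel (\<lambda>t. u t + c * v t)"
  using simple_function_compose1[OF simple_function_Pair[OF assms], of "\<lambda>y. fst y + c * snd y"] by simp

lemma scaleC_minus_one: "(- 1) *\<^sub>C (x::'a::complex_banach) = - x"
  using scaleC_of_real[of "- 1" x] by simp

lemma dist_simple_vm_integral_le:
  fixes \<nu> :: "'g::topological_space set \<Rightarrow> 'x::complex_banach"
  assumes \<nu>: "vector_measure \<nu>" and u: "simple_function borel u" and v: "simple_function borel v"
    and B: "\<And>t. dist (u t) (v t) \<le> B"
  shows "dist (simple_vm_integral \<nu> u) (simple_vm_integral \<nu> v) \<le> B * enn2real (semivariation \<nu>)"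
proof -
  have "simple_function borel (\<lambda>t. u t + (- 1) * v t)"
    by (rule simple_function_add_mult[OF u v])
  then have "norm (simple_vm_integral \<nu> (\<lambda>t. u t + (- 1) * v t)) \<le> B * enn2real (semivariation \<nu>)"
    using B by (intro norm_simple_vm_integral_le_semivariation[OF \<nu>]) (auto simp: dist_norm)
  then show ?thesis
    unfolding simple_vm_integral_add[OF vector_measure_finitely_additive[OF \<nu>] u v] scaleC_minus_one
    by (simp add: dist_norm)
qed

text \<open>Sequences with the same uniform limit have integrals that approach each other, because the
  semivariation is finite. So the limit of the integrals exists and depends on \<open>h\<close> only, as
  the definite description in \<^const>\<open>vm_integral\<close> demands.\<close>

lemma vm_integral_tendsto:
  fixes \<nu> :: "'g::topological_space set \<Rightarrow> 'x::complex_banach"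
  assumes \<nu>: "vector_measure \<nu>" and s: "\<And>n. simple_function borel (s n)"
    and lim: "uniform_limit UNIV s h sequentially"
  shows "(\<lambda>n. simple_vm_integral \<nu> (s n)) \<longlonglongrightarrow> vm_integral \<nu> h"
proof -
  define S where "S = enn2real (semivariation \<nu>)"
  have S: "S \<ge> 0" by (simp add: S_def)
  have close: "\<exists>N. \<forall>n\<ge>N. \<forall>k\<ge>N. dist (simple_vm_integral \<nu> (u n)) (simple_vm_integral \<nu> (v k)) < e"
    if u: "\<And>n. simple_function borel (u n)" "uniform_limit UNIV u h sequentially"
      and v: "\<And>n. simple_function borel (v n)" "uniform_limit UNIV v h sequentially"
      and e: "e > 0" for u v and e :: real
  proof -
    define d where "d = e / (2 * (S + 1))"
    have d: "d > 0" "2 * d * (S + 1) = e"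
      using e S by (auto simp: d_def divide_simps)
    have "\<forall>\<^sub>F n in sequentially. \<forall>t\<in>UNIV. dist (u n t) (h t) < d"
      "\<forall>\<^sub>F n in sequentially. \<forall>t\<in>UNIV. dist (v n t) (h t) < d"
      using u(2) v(2) d by (auto dest: uniform_limitD)
    then obtain N1 N2 where N1: "\<And>n t. n \<ge> N1 \<Longrightarrow> dist (u n t) (h t) < d"
      and N2: "\<And>n t. n \<ge> N2 \<Longrightarrow> dist (v n t) (h t) < d"
      unfolding eventually_sequentially by blast
    have "dist (simple_vm_integral \<nu> (u n)) (simple_vm_integral \<nu> (v k)) < e"
      if "n \<ge> max N1 N2" "k \<ge> max N1 N2" for n k
    proof -
      have "dist (u n t) (v k t) \<le> 2 * d" for t
        using dist_triangle2[of "u n t" "v k t" "h t"] N1[of n t] N2[of k t] that by simp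
      then have "dist (simple_vm_integral \<nu> (u n)) (simple_vm_integral \<nu> (v k)) \<le> (2 * d) * S"
        unfolding S_def by (intro dist_simple_vm_integral_le \<nu> u v)
      also have "\<dots> < 2 * d * (S + 1)" using d(1) by simp
      finally show ?thesis unfolding d(2) .
    qed
    then show ?thesis by blast
  qed
  have "Cauchy (\<lambda>n. simple_vm_integral \<nu> (s n))"
    unfolding Cauchy_def using close[OF s lim s lim] by blast
  then obtain y where y: "(\<lambda>n. simple_vm_integral \<nu> (s n)) \<longlonglongrightarrow> y"
    by (auto simp: Cauchy_convergent_iff convergent_def)
  have "vm_integral \<nu> h = y"
    unfolding vm_integral_def
  proof (rule the_equality)
    fix z
    assume "\<exists>s. (\<forall>n. simple_function borel (s n)) \<and> uniform_limit UNIV s h sequentially \<and>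
                 (\<lambda>n. simple_vm_integral \<nu> (s n)) \<longlonglongrightarrow> z"
    then obtain u where u: "\<And>n. simple_function borel (u n)" "uniform_limit UNIV u h sequentially"
      and z: "(\<lambda>n. simple_vm_integral \<nu> (u n)) \<longlonglongrightarrow> z" by blast
    have "(\<lambda>n. dist (simple_vm_integral \<nu> (u n)) (simple_vm_integral \<nu> (s n))) \<longlonglongrightarrow> 0"
      unfolding LIMSEQ_def using close[OF u s lim] by (auto simp: dist_real_def) blast
    moreover have "(\<lambda>n. dist (simple_vm_integral \<nu> (u n)) (simple_vm_integral \<nu> (s n))) \<longlonglongrightarrow> dist z y"
      using z y by (rule tendsto_dist)
    ultimately have "dist z y = 0" by (rule LIMSEQ_unique[symmetric])
    then show "z = y" by simp
  qed (use s lim y in blast)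
  then show ?thesis using y by simp
qed

lemma regulated_simple: "simple_function borel u \<Longrightarrow> regulated u"
  unfolding regulated_def by (rule exI[of _ "\<lambda>n. u"]) (simp add: uniform_limit_const)

lemma vm_integral_simple:
  fixes \<nu> :: "'g::topological_space set \<Rightarrow> 'x::complex_banach"
  assumes \<nu>: "vector_measure \<nu>" and u: "simple_function borel u"
  shows "vm_integral \<nu> u = simple_vm_integral \<nu> u"
proof -
  have "(\<lambda>n::nat. simple_vm_integral \<nu> u) \<longlonglongrightarrow> vm_integral \<nu> u"
    by (rule vm_integral_tendsto[OF \<nu>]) (auto intro: u uniform_limit_const)
  then show ?thesis by (simp add: LIMSEQ_const_iff)
qed

lemma uniform_limit_add_mult:
  fixes u v :: "'g \<Rightarrow> complex"
  assumes "uniform_limit UNIV s u F" "uniform_limit UNIV r v F"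
  shows "uniform_limit UNIV (\<lambda>n t. s n t + c * r n t) (\<lambda>t. u t + c * v t) F"
  by (rule uniform_limit_add[OF assms(1) bounded_linear.uniform_limit[OF bounded_linear_mult_right assms(2)]])

lemma regulated_add:
  assumes "regulated u" "regulated v"
  shows "regulated (\<lambda>t. u t + c * v t)"
proof -
  obtain s r where s: "\<And>n. simple_function borel (s n)" "uniform_limit UNIV s u sequentially"
    and r: "\<And>n. simple_function borel (r n)" "uniform_limit UNIV r v sequentially"
    using assms unfolding regulated_def by blast
  show ?thesis
    unfolding regulated_def
    using simple_function_add_mult[OF s(1) r(1)] uniform_limit_add_mult[OF s(2) r(2)]
    by (intro exI[of _ "\<lambda>n t. s n t + c * r n t"]) blast
qed

lemma tendsto_scaleC:
  fixes x :: "'b \<Rightarrow> 'x::complex_banach"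
  assumes "(x \<longlongrightarrow> x0) F"
  shows "((\<lambda>n. c *\<^sub>C x n) \<longlongrightarrow> c *\<^sub>C x0) F"
proof -
  have "((\<lambda>n. cmod c * norm (x n - x0)) \<longlongrightarrow> cmod c * 0) F"
    using assms by (intro tendsto_intros tendsto_norm_zero LIM_zero)
  then have "((\<lambda>n. norm (c *\<^sub>C x n - c *\<^sub>C x0)) \<longlongrightarrow> 0) F"
    unfolding scaleC_diff_right[symmetric] norm_scaleC by simp
  then show ?thesis by (rule LIM_zero_cancel[OF tendsto_norm_zero_cancel])
qed

lemma vm_integral_add:
  fixes \<nu> :: "'g::topological_space set \<Rightarrow> 'x::complex_banach"
  assumes \<nu>: "vector_measure \<nu>" and u: "regulated u" and v: "regulated v"
  shows "vm_integral \<nu> (\<lambda>t. u t + c * v t) = vm_integral \<nu> u + c *\<^sub>C vm_integral \<nu> v"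
proof -
  obtain s r where s: "\<And>n. simple_function borel (s n)" "uniform_limit UNIV s u sequentially"
    and r: "\<And>n. simple_function borel (r n)" "uniform_limit UNIV r v sequentially"
    using u v unfolding regulated_def by blast
  note fa = vector_measure_finitely_additive[OF \<nu>]
  have "(\<lambda>n. simple_vm_integral \<nu> (\<lambda>t. s n t + c * r n t)) \<longlonglongrightarrow> vm_integral \<nu> (\<lambda>t. u t + c * v t)"
    by (rule vm_integral_tendsto[OF \<nu> simple_function_add_mult[OF s(1) r(1)] uniform_limit_add_mult[OF s(2) r(2)]])
  moreover have "(\<lambda>n. simple_vm_integral \<nu> (\<lambda>t. s n t + c * r n t)) \<longlonglongrightarrow> vm_integral \<nu> u + c *\<^sub>C vm_integral \<nu> v"
    unfolding simple_vm_integral_add[OF fa s(1) r(1)]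
    by (rule tendsto_add[OF vm_integral_tendsto[OF \<nu> s] tendsto_scaleC[OF vm_integral_tendsto[OF \<nu> r]]])
  ultimately show ?thesis by (rule LIMSEQ_unique)
qed

lemma regulated_zero: "regulated (\<lambda>t. 0)"
  by (rule regulated_simple[OF simple_function_const])

lemma vm_integral_zero:
  fixes \<nu> :: "'g::topological_space set \<Rightarrow> 'x::complex_banach"
  assumes "vector_measure \<nu>"
  shows "vm_integral \<nu> (\<lambda>t. 0) = 0"
  unfolding vm_integral_simple[OF assms simple_function_const] by (simp add: simple_vm_integral_def)

lemma regulated_sum:
  "(\<And>i. i \<in> I \<Longrightarrow> regulated (h i)) \<Longrightarrow> regulated (\<lambda>t. \<Sum>i\<in>I. c i * h i t)"
proof (induction I rule: infinite_finite_induct)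
  case (insert j I)
  then have "regulated (\<lambda>t. (\<Sum>i\<in>I. c i * h i t) + c j * h j t)"
    by (intro regulated_add) auto
  then show ?case using insert.hyps by (simp add: add.commute)
qed (simp_all add: regulated_zero)

lemma vm_integral_sum:
  fixes \<nu> :: "'g::topological_space set \<Rightarrow> 'x::complex_banach"
  assumes \<nu>: "vector_measure \<nu>" and "\<And>i. i \<in> I \<Longrightarrow> regulated (h i)"
  shows "vm_integral \<nu> (\<lambda>t. \<Sum>i\<in>I. c i * h i t) = (\<Sum>i\<in>I. c i *\<^sub>C vm_integral \<nu> (h i))"
  using assms(2)
proof (induction I rule: infinite_finite_induct)
  case (insert j I)
  then have "vm_integral \<nu> (\<lambda>t. (\<Sum>i\<in>I. c i * h i t) + c j * h j t)
      = vm_integral \<nu> (\<lambda>t. \<Sum>i\<in>I. c i * h i t) + c j *\<^sub>C vm_integral \<nu> (h j)"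
    by (intro vm_integral_add[OF \<nu>] regulated_sum) auto
  then show ?case using insert by (simp add: add.commute)
qed (simp_all add: vm_integral_zero[OF \<nu>])

lemma regulated_diff: "regulated u \<Longrightarrow> regulated v \<Longrightarrow> regulated (\<lambda>t. u t - v t)"
  by (drule (1) regulated_add[where c="- 1"]) simp

lemma vm_integral_diff:
  fixes \<nu> :: "'g::topological_space set \<Rightarrow> 'x::complex_banach"
  shows "vector_measure \<nu> \<Longrightarrow> regulated u \<Longrightarrow> regulated v \<Longrightarrow>
    vm_integral \<nu> (\<lambda>t. u t - v t) = vm_integral \<nu> u - vm_integral \<nu> v"
  using vm_integral_add[of \<nu> u v "- 1"] by (simp add: scaleC_minus_one)

text \<open>Dropping finitely many terms makes the approximation uniformly within 1, which supplies
  the constant dominating functions used in passing to the limit.\<close>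

lemma regulatedE:
  assumes "regulated h"
  obtains s where "\<And>n. simple_function borel (s n)" "uniform_limit UNIV s h sequentially"
    "\<And>n t. dist (s n t) (h t) < 1"
proof -
  obtain s where s: "\<And>n. simple_function borel (s n)" "uniform_limit UNIV s h sequentially"
    using assms unfolding regulated_def by blast
  from uniform_limitD[OF s(2) zero_less_one]
  obtain N where N: "\<And>n t. n \<ge> N \<Longrightarrow> dist (s n t) (h t) < 1"
    unfolding eventually_sequentially by blast
  have "uniform_limit UNIV (\<lambda>n. s (n + N)) h sequentially"
    by (rule filterlim_compose[OF s(2) filterlim_add_const_nat_at_top])
  then show ?thesis
    by (rule that[of "\<lambda>n. s (n + N)", OF s(1)]) (simp add: N)
qed

lemma regulated_measurable:
  assumes "regulated h"
  shows "h \<in> borel_measurable borel"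
proof -
  obtain s where s: "\<And>n. simple_function borel (s n)" "uniform_limit UNIV s h sequentially"
    using assms unfolding regulated_def by blast
  show ?thesis
    by (rule borel_measurable_LIMSEQ_metric[OF borel_measurable_simple_function[OF s(1)]])
      (rule tendsto_uniform_limitI[OF s(2)], simp)
qed

lemma regulated_bounded:
  assumes "regulated h"
  shows "\<exists>B. \<forall>t. cmod (h t) \<le> B"
proof -
  obtain s where s: "\<And>n::nat. simple_function borel (s n)" "\<And>n t. dist (s n t) (h t) < 1"
    by (rule regulatedE[OF assms]) blast
  obtain B where B: "\<forall>z\<in>range (s 0). cmod z \<le> B"
    using finite_imp_bounded[OF finite_range_simple[OF s(1)]] by (auto simp: bounded_iff)
  then have "cmod (h t) \<le> B + 1" for t
  proof -
    have "cmod (s 0 t) \<le> B" using B by blast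
    then show ?thesis
      using s(2)[of 0 t] norm_triangle_sub[of "h t" "s 0 t"] by (simp add: dist_norm norm_minus_commute)
  qed
  then show ?thesis by blast
qed

lemma norm_vm_integral_le_semivariation:
  fixes \<nu> :: "'g::topological_space set \<Rightarrow> 'x::complex_banach"
  assumes \<nu>: "vector_measure \<nu>" and h: "regulated h" and B: "\<And>t. cmod (h t) \<le> B"
  shows "norm (vm_integral \<nu> h) \<le> B * enn2real (semivariation \<nu>)"
proof (rule field_le_epsilon)
  fix e :: real assume e: "e > 0"
  define S where "S = enn2real (semivariation \<nu>)"
  define d where "d = e / (S + 1)"
  have S: "S \<ge> 0" by (simp add: S_def)
  have d: "d > 0" "d * S \<le> e" using e S by (auto simp: d_def field_simps)
  obtain s where s: "\<And>n. simple_function borel (s n)" "uniform_limit UNIV s h sequentially"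
    by (rule regulatedE[OF h]) blast
  have "\<forall>\<^sub>F n in sequentially. norm (simple_vm_integral \<nu> (s n)) \<le> (B + d) * S"
    using uniform_limitD[OF s(2) d(1)]
  proof eventually_elim
    case (elim n)
    have "cmod (s n t) \<le> B + d" for t
      using bspec[OF elim, of t] B[of t] norm_triangle_sub[of "s n t" "h t"] by (simp add: dist_norm)
    then show ?case
      unfolding S_def by (intro norm_simple_vm_integral_le_semivariation \<nu> s)
  qed
  then have "norm (vm_integral \<nu> h) \<le> (B + d) * S"
    using tendsto_norm[OF vm_integral_tendsto[OF \<nu> s]] by (intro tendsto_upperbound) auto
  then show "norm (vm_integral \<nu> h) \<le> B * enn2real (semivariation \<nu>) + e"
    using d(2) by (simp add: S_def distrib_right)
qed

text \<open>The mean values of the approximating simple functions converge by bounded convergence, which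
  carries the estimate from simple functions to their uniform limits.\<close>

lemma norm_vm_integral_le_p_semivariation:
  fixes \<nu> :: "'g::topological_space set \<Rightarrow> 'x::complex_banach"
  assumes M: "sets M = sets borel" "finite_measure M" and p: "1 < p"
    and \<nu>: "vector_measure \<nu>" and fin: "p_semivariation (ennreal p) M \<nu> < \<infinity>"
    and h: "regulated h" and C: "C \<ge> 0"
    and le: "(\<integral>\<^sup>+t. ennreal (cmod (h t) powr (p / (p - 1))) \<partial>M) \<le> ennreal (C powr (p / (p - 1)))"
  shows "norm (vm_integral \<nu> h) \<le> C * enn2real (p_semivariation (ennreal p) M \<nu>)"
proof -
  interpret finite_measure M by (rule M(2))
  define P where "P = p / (p - 1)"
  define V where "V = enn2real (p_semivariation (ennreal p) M \<nu>)"
  have V: "V \<ge> 0" by (simp add: V_def)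
  have P: "P > 0" using p by (simp add: P_def)
  obtain s where s: "\<And>n. simple_function borel (s n)" "uniform_limit UNIV s h sequentially"
    and s1: "\<And>n t. dist (s n t) (h t) < 1"
    by (rule regulatedE[OF h]) blast
  obtain B where B: "\<And>t. cmod (h t) \<le> B" using regulated_bounded[OF h] by auto
  have B0: "B \<ge> 0" using B[of undefined] norm_ge_zero[of "h undefined"] by linarith
  have sB: "cmod (s n t) \<le> B + 1" for n t
    using s1[of n t] B[of t] norm_triangle_sub[of "s n t" "h t"] by (simp add: dist_norm)
  have meas: "s n \<in> borel_measurable M" "h \<in> borel_measurable M" for n
    unfolding measurable_cong_sets[OF M(1) refl]
    using borel_measurable_simple_function[OF s(1)] regulated_measurable[OF h] by auto
  define I where "I u = (\<integral>t. cmod (u t) powr P \<partial>M)" for u :: "'g \<Rightarrow> complex"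
  have int: "integrable M (\<lambda>t. cmod (u t) powr P)" if "u \<in> borel_measurable M" "\<And>t. cmod (u t) \<le> B + 1" for u
    using that B0 P by (intro integrable_const_bound[of _ "(B + 1) powr P"]) (auto intro!: powr_mono2)
  have nn: "(\<integral>\<^sup>+t. ennreal (cmod (u t) powr P) \<partial>M) = ennreal (I u)" "I u \<ge> 0"
    if "u \<in> borel_measurable M" "\<And>t. cmod (u t) \<le> B + 1" for u
    using int[OF that] unfolding I_def by (auto intro: nn_integral_eq_integral)
  have lim: "(\<lambda>n. I (s n)) \<longlonglongrightarrow> I h"
    unfolding I_def
  proof (rule integral_dominated_convergence[where w="\<lambda>_. (B + 1) powr P"])
    have "(\<lambda>n. s n t) \<longlonglongrightarrow> h t" for t
      using s(2) by (rule tendsto_uniform_limitI) auto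
    then show "AE t in M. (\<lambda>n. cmod (s n t) powr P) \<longlonglongrightarrow> cmod (h t) powr P"
      using P by (intro AE_I2 tendsto_powr') (auto intro: tendsto_norm)
    show "AE t in M. norm (cmod (s n t) powr P) \<le> (B + 1) powr P" for n
      using sB P by (auto intro!: powr_mono2)
  qed (use meas in auto)
  show ?thesis
  proof (rule field_le_epsilon)
    fix e :: real assume e: "e > 0"
    define d where "d = e / (V + 1)"
    have d: "d > 0" "d * V \<le> e" using e V by (auto simp: d_def field_simps)
    have "norm (simple_vm_integral \<nu> (s n)) \<le> (I (s n) powr (1 / P) + d) * V" for n
      unfolding V_def
    proof (rule norm_simple_vm_integral_le_p_semivariation[OF M(1) p fin s(1)])
      show "I (s n) powr (1 / P) + d > 0" using d by (simp add: add_nonneg_pos)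
      have "I (s n) = (I (s n) powr (1 / P)) powr P"
        using nn(2)[OF meas(1) sB] P by (simp add: powr_powr)
      also have "\<dots> \<le> (I (s n) powr (1 / P) + d) powr P"
        using P d by (intro powr_mono2) auto
      finally show "(\<integral>\<^sup>+t. ennreal (cmod (s n t) powr (p / (p - 1))) \<partial>M)
          \<le> ennreal ((I (s n) powr (1 / P) + d) powr (p / (p - 1)))"
        unfolding P_def[symmetric] nn(1)[OF meas(1) sB] by (rule ennreal_leI)
    qed
    moreover have "(\<lambda>n. (I (s n) powr (1 / P) + d) * V) \<longlonglongrightarrow> (I h powr (1 / P) + d) * V"
      using P nn(2)[OF meas(1) sB] lim by (intro tendsto_intros tendsto_powr') auto
    ultimately have "norm (vm_integral \<nu> h) \<le> (I h powr (1 / P) + d) * V"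
      using tendsto_norm[OF vm_integral_tendsto[OF \<nu> s]] by (intro LIMSEQ_le) auto
    moreover have "I h powr (1 / P) \<le> C"
    proof -
      have hB: "cmod (h t) \<le> B + 1" for t using B[of t] by simp
      have "I h \<le> C powr P"
        using le nn[OF meas(2) hB] unfolding P_def[symmetric] by (simp add: ennreal_le_iff)
      then have "I h powr (1 / P) \<le> (C powr P) powr (1 / P)"
        using P nn(2)[OF meas(2) hB] by (intro powr_mono2) auto
      then show ?thesis using P C by (simp add: powr_powr)
    qed
    then have "(I h powr (1 / P) + d) * V \<le> C * V + d * V"
      using V by (simp add: distrib_right mult_right_mono)
    ultimately show "norm (vm_integral \<nu> h) \<le> C * enn2real (p_semivariation (ennreal p) M \<nu>) + e"
      using d(2) by (simp add: V_def)
  qed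
qed

subsection \<open>Simple selections\<close>

text \<open>A finite Borel cover yields a finite Borel partition, encoded by the function that sends a point
  to the index of its piece.\<close>

lemma simple_selection:
  fixes U :: "'c \<Rightarrow> 'g::topological_space set"
  assumes "finite F" "\<And>x. x \<in> F \<Longrightarrow> U x \<in> sets borel"
  shows "\<exists>c. simple_function borel c \<and> (\<forall>t\<in>(\<Union>x\<in>F. U x). t \<in> U (c t))"
  using assms
proof (induction F rule: finite_induct)
  case empty
  then show ?case by (intro exI[of _ "\<lambda>_. undefined"]) auto
next
  case (insert x F)
  then obtain c where c: "simple_function borel c" "\<forall>t\<in>(\<Union>x\<in>F. U x). t \<in> U (c t)" by auto
  have "simple_function borel (\<lambda>t. if t \<in> U x then x else c t)"
    using insert.prems c(1) by (intro simple_function_If_set) auto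
  then show ?case
    using c(2) by (intro exI[of _ "\<lambda>t. if t \<in> U x then x else c t"]) auto
qed

lemma compact_simple_selection:
  fixes U :: "'g::topological_space \<Rightarrow> 'g set"
  assumes "compact (UNIV :: 'g set)" "\<And>x. open (U x)" "\<And>x. x \<in> U x"
  shows "\<exists>c. simple_function borel c \<and> (\<forall>t. t \<in> U (c t))"
proof -
  obtain F where F: "finite F" "UNIV \<subseteq> (\<Union>x\<in>F. U x)"
    by (rule compactE_image[OF assms(1), of UNIV U]) (use assms in auto)
  then show ?thesis
    using simple_selection[of F U] assms(2) by fastforce
qed

lemma regulated_continuous:
  fixes h :: "'g::topological_space \<Rightarrow> complex"
  assumes "compact (UNIV :: 'g set)" and h: "continuous_on UNIV h"
  shows "regulated h"
proof -
  have "\<exists>c. simple_function borel c \<and> (\<forall>t. t \<in> {t'. dist (h t') (h (c t)) < 1 / real (Suc n)})" for n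
  proof (rule compact_simple_selection[OF assms(1), where U="\<lambda>x. {t. dist (h t) (h x) < 1 / real (Suc n)}"])
    show "open {t. dist (h t) (h x) < 1 / real (Suc n)}" for x
      using h by (intro open_Collect_less continuous_intros) auto
  qed auto
  then obtain c where c: "\<And>n. simple_function borel (c n)" "\<And>n t. dist (h t) (h (c n t)) < 1 / real (Suc n)"
    by (metis mem_Collect_eq)
  have "uniform_limit UNIV (\<lambda>n t. h (c n t)) h sequentially"
  proof (rule uniform_limitI)
    fix e :: real assume "e > 0"
    then obtain N where N: "1 / real (Suc N) < e" using nat_approx_posE by blast
    show "\<forall>\<^sub>F n in sequentially. \<forall>t\<in>UNIV. dist (h (c n t)) (h t) < e"
      using eventually_ge_at_top[of N]
    proof eventually_elim
      case (elim n)
      then have "1 / real (Suc n) \<le> 1 / real (Suc N)" by (simp add: frac_le)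
      then show ?case using c(2)[of _ n] N by (force simp: dist_commute intro: less_trans less_le_trans)
    qed
  qed
  moreover have "simple_function borel (\<lambda>t. h (c n t))" for n
    using simple_function_compose1[OF c(1)] .
  ultimately show ?thesis
    unfolding regulated_def by (intro exI[of _ "\<lambda>n t. h (c n t)"]) blast
qed

section \<open>Haar measure on a compact group\<close>

locale compact_haar =
  fixes m :: "'g::{topological_group_add, t2_space} measure"
  assumes compact_UNIV: "compact (UNIV :: 'g set)"
    and haar: "normalized_haar_measure m"
begin

lemma sets_m [simp, measurable_cong]: "sets m = sets borel"
  and finite_m: "finite_measure m"
  and outer: "A \<in> sets borel \<Longrightarrow> emeasure m A = (INF U\<in>{U. open U \<and> A \<subseteq> U}. emeasure m U)"
  and inner: "A \<in> sets borel \<Longrightarrow> emeasure m A = (SUP K\<in>{K. compact K \<and> K \<in> sets m \<and> K \<subseteq> A}. emeasure m K)"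
  and emeasure_UNIV [simp]: "emeasure m UNIV = 1"
  and image_left: "A \<in> sets borel \<Longrightarrow> emeasure m ((\<lambda>a. g + a) ` A) = emeasure m A"
proof -
  note defs = normalized_haar_measure_def radon_finite_measure_def
  show sets: "sets m = sets borel" and "finite_measure m" and "emeasure m UNIV = 1"
    using haar unfolding defs by blast+
  show "emeasure m A = (INF U\<in>{U. open U \<and> A \<subseteq> U}. emeasure m U)"
    "emeasure m A = (SUP K\<in>{K. compact K \<and> K \<in> sets m \<and> K \<subseteq> A}. emeasure m K)"
    "emeasure m ((\<lambda>a. g + a) ` A) = emeasure m A" if "A \<in> sets borel"
    using haar that unfolding defs sets by blast+
qed

sublocale finite_measure m
  by (rule finite_m)

lemma space_m [simp]: "space m = UNIV"
  using sets_eq_imp_space_eq[OF sets_m] by simp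

lemma translations_continuous:
  "continuous_on UNIV (\<lambda>a::'g. g + a)" "continuous_on UNIV (\<lambda>a::'g. a + g)"
  "continuous_on UNIV (\<lambda>a::'g. - a)" "continuous_on UNIV (\<lambda>a::'g. g - a)" "continuous_on UNIV (\<lambda>a::'g. a - g)"
  unfolding diff_conv_add_uminus by (intro continuous_intros)+

lemmas translations_measurable [measurable] = translations_continuous[THEN borel_measurable_continuous_onI]

lemma borel_vimage: "f \<in> borel_measurable borel \<Longrightarrow> A \<in> sets borel \<Longrightarrow> f -` A \<in> sets borel"
  using measurable_sets[of f borel borel A] by simp

lemma compact_borel: "compact K \<Longrightarrow> (K :: 'g set) \<in> sets borel"
  by (intro borel_closed compact_imp_closed)

lemma emeasure_left:
  assumes A: "A \<in> sets borel"
  shows "emeasure m ((\<lambda>a. g + a) -` A) = emeasure m A"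
proof -
  have "(\<lambda>a. g + a) -` A = (\<lambda>a. - g + a) ` A"
    by (auto simp: image_iff add.assoc[symmetric] intro!: bexI[of _ "g + _"])
  then show ?thesis using image_left[OF A] by simp
qed

lemma compact_neighbourhood:
  fixes f :: "'g \<Rightarrow> 'g \<Rightarrow> 'g"
  assumes f: "continuous_on UNIV (\<lambda>(w, k). f w k)" "\<And>k. f 0 k = k" and K: "compact K" "open U" "K \<subseteq> U"
  shows "\<exists>W. open W \<and> 0 \<in> W \<and> (\<forall>w\<in>W. \<forall>k\<in>K. f w k \<in> U)"
proof -
  have "open ((\<lambda>(w, k). f w k) -` U)"
    by (rule open_vimage[OF K(2) f(1)])
  moreover have "{0} \<times> K \<subseteq> (\<lambda>(w, k). f w k) -` U"
    using f(2) K(3) by auto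
  ultimately obtain W where "0 \<in> W" "open W" "W \<times> K \<subseteq> (\<lambda>(w, k). f w k) -` U"
    using Elementary_Topology.tube_lemma[OF K(1)] by metis
  then show ?thesis by (intro exI[of _ W]) auto
qed

text \<open>The averaging argument behind the uniqueness of Haar measure, with an arbitrary measure \<open>n\<close> as
  the second one. If \<open>K \<subseteq> U\<close> with \<open>U\<close> open, then shifting \<open>y\<close> slightly to a representative \<open>c y\<close>
  moves \<open>y + t \<in> K\<close> into \<open>U\<close>. As \<open>c\<close> has finitely many values, the integral over \<open>t\<close> can be taken
  summand by summand, and left invariance of \<open>m\<close> makes each summand a multiple of the measure of \<open>U\<close>.\<close>

lemma nn_integral_translates_le_open:
  assumes sets_n: "sets n = sets borel" and K: "compact K" "open U" "K \<subseteq> U"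
  shows "(\<integral>\<^sup>+t. emeasure n ((\<lambda>y. y + t) -` K) \<partial>m) \<le> emeasure n UNIV * emeasure m U"
proof -
  obtain W where W: "open W" "0 \<in> W" "\<And>w k. w \<in> W \<Longrightarrow> k \<in> K \<Longrightarrow> w + k \<in> U"
  proof -
    have cont: "continuous_on UNIV (\<lambda>(w::'g, k). w + k)"
      unfolding case_prod_unfold by (intro continuous_intros)
    have "\<exists>W. open W \<and> 0 \<in> W \<and> (\<forall>w\<in>W. \<forall>k\<in>K. w + k \<in> U)"
      by (rule compact_neighbourhood[OF cont _ K]) simp
    then show ?thesis using that by blast
  qed
  have "\<exists>c. simple_function borel c \<and> (\<forall>y. y \<in> (\<lambda>y. c y - y) -` W)"
  proof -
    have "\<exists>c. simple_function borel c \<and> (\<forall>y. y \<in> (\<lambda>x. (\<lambda>y. x - y) -` W) (c y))"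
      using W by (intro compact_simple_selection compact_UNIV open_vimage translations_continuous) auto
    then show ?thesis by simp
  qed
  then obtain c where c: "simple_function borel c" "\<And>y. c y - y \<in> W" by auto
  note fin = finite_range_simple[OF c(1)]
  have cs: "c -` {x} \<in> sets n" for x
    using fibre_in_borel[OF c(1)] sets_n by simp
  have U: "(\<lambda>t. x + t) -` U \<in> sets borel" for x
    using K(2) by (intro borel_vimage translations_measurable) auto
  have "emeasure n ((\<lambda>y. y + t) -` K) \<le> (\<Sum>x\<in>range c. emeasure n (c -` {x}) * indicator ((\<lambda>t. x + t) -` U) t)" for t
  proof -
    let ?X = "{x \<in> range c. x + t \<in> U}"
    have "(\<lambda>y. y + t) -` K \<subseteq> (\<Union>x\<in>?X. c -` {x})"
    proof
      fix y assume "y \<in> (\<lambda>y. y + t) -` K"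
      then have "(c y - y) + (y + t) \<in> U" using W(3) c(2) by auto
      then show "y \<in> (\<Union>x\<in>?X. c -` {x})" by (simp add: add.assoc[symmetric])
    qed
    then have "emeasure n ((\<lambda>y. y + t) -` K) \<le> emeasure n (\<Union>x\<in>?X. c -` {x})"
      using cs fin by (intro emeasure_mono) auto
    also have "\<dots> = (\<Sum>x\<in>?X. emeasure n (c -` {x}))"
      using cs fin by (intro sum_emeasure[symmetric]) (auto simp: disjoint_family_on_def)
    also have "\<dots> = (\<Sum>x\<in>range c. emeasure n (c -` {x}) * indicator ((\<lambda>t. x + t) -` U) t)"
      using fin by (intro sum.mono_neutral_cong_left) (auto simp: indicator_def)
    finally show ?thesis .
  qed
  then have "(\<integral>\<^sup>+t. emeasure n ((\<lambda>y. y + t) -` K) \<partial>m)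
      \<le> (\<integral>\<^sup>+t. (\<Sum>x\<in>range c. emeasure n (c -` {x}) * indicator ((\<lambda>t. x + t) -` U) t) \<partial>m)"
    by (intro nn_integral_mono)
  also have "\<dots> = (\<Sum>x\<in>range c. emeasure n (c -` {x}) * emeasure m ((\<lambda>t. x + t) -` U))"
    using U by (subst nn_integral_sum) (auto simp: nn_integral_cmult_indicator)
  also have "\<dots> = (\<Sum>x\<in>range c. emeasure n (c -` {x})) * emeasure m U"
    using K(2) by (simp add: emeasure_left sum_distrib_right)
  also have "(\<Sum>x\<in>range c. emeasure n (c -` {x})) = emeasure n (\<Union>x\<in>range c. c -` {x})"
    using cs fin by (intro sum_emeasure) (auto simp: disjoint_family_on_def)
  also have "(\<Union>x\<in>range c. c -` {x}) = UNIV" by auto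
  finally show ?thesis .
qed

text \<open>Half of Fubini's theorem for the function \<open>(y, t) \<mapsto> indicator K (y + t)\<close>, from the previous
  lemma by outer regularity.\<close>

lemma nn_integral_translates_le_compact:
  assumes sets_n: "sets n = sets borel" and fin: "finite_measure n" and K: "compact K"
  shows "(\<integral>\<^sup>+t. emeasure n ((\<lambda>y. y + t) -` K) \<partial>m) \<le> emeasure n UNIV * emeasure m K"
proof -
  interpret n: finite_measure n by (rule fin)
  obtain N where N: "N \<ge> 0" "emeasure n UNIV = ennreal N"
    using n.emeasure_finite[of UNIV] by (cases "emeasure n UNIV") auto
  show ?thesis
  proof (rule ennreal_le_epsilon)
    fix e :: real assume e: "e > 0"
    define d where "d = e / (N + 1)"
    have d: "d > 0" "N * d \<le> e" using e N by (auto simp: d_def field_simps)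
    have "emeasure m K < emeasure m K + ennreal d"
      using d emeasure_finite[of K] by (auto simp: ennreal_add_left_cancel_less less_top[symmetric])
    then obtain U where U: "open U" "K \<subseteq> U" "emeasure m U < emeasure m K + ennreal d"
      unfolding outer[OF compact_borel[OF K]] INF_less_iff by blast
    have "(\<integral>\<^sup>+t. emeasure n ((\<lambda>y. y + t) -` K) \<partial>m) \<le> emeasure n UNIV * emeasure m U"
      by (rule nn_integral_translates_le_open[OF sets_n K U(1,2)])
    also have "\<dots> \<le> emeasure n UNIV * (emeasure m K + ennreal d)"
      using U(3) by (intro mult_left_mono) auto
    also have "\<dots> \<le> emeasure n UNIV * emeasure m K + ennreal e"
      using d N by (auto simp: distrib_left ennreal_mult'[symmetric] intro!: add_left_mono ennreal_leI)
    finally show "(\<integral>\<^sup>+t. emeasure n ((\<lambda>y. y + t) -` K) \<partial>m) \<le> emeasure n UNIV * emeasure m K + ennreal e" .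
  qed
qed

text \<open>The averaging inequality for the image of \<open>m\<close> under inversion. That image is right invariant, so
  the averaged function is constant.\<close>

lemma emeasure_uminus_compact_le:
  assumes K: "compact K"
  shows "emeasure m (uminus -` K) \<le> emeasure m K"
proof -
  let ?n = "distr m borel uminus"
  have Kb: "K \<in> sets borel" using K by (rule compact_borel)
  have "emeasure ?n ((\<lambda>y. y + t) -` K) = emeasure m (uminus -` K)" for t
  proof -
    have "emeasure ?n ((\<lambda>y. y + t) -` K) = emeasure m (uminus -` ((\<lambda>y. y + t) -` K))"
      using Kb by (subst emeasure_distr) (auto intro!: borel_vimage)
    also have "uminus -` ((\<lambda>y. y + t) -` K) = (\<lambda>a. - t + a) -` (uminus -` K)"
      by (auto simp: minus_add)
    also have "emeasure m \<dots> = emeasure m (uminus -` K)"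
      using Kb by (intro emeasure_left borel_vimage) auto
    finally show ?thesis .
  qed
  moreover have "(\<integral>\<^sup>+t. emeasure ?n ((\<lambda>y. y + t) -` K) \<partial>m) \<le> emeasure ?n UNIV * emeasure m K"
    using K by (intro nn_integral_translates_le_compact finite_measure_distr) auto
  ultimately show ?thesis by (simp add: emeasure_distr)
qed

text \<open>Inner regularity extends the inequality from compact sets to \<open>A\<close>; the converse inequality is the
  same one for \<open>- A\<close>, as inversion is an involution.\<close>

lemma emeasure_uminus:
  assumes A: "A \<in> sets borel"
  shows "emeasure m (uminus -` A) = emeasure m A"
proof -
  have le: "emeasure m (uminus -` A) \<le> emeasure m A" if A: "A \<in> sets borel" for A
  proof -
    have "uminus -` A \<in> sets borel" using A by (intro borel_vimage) auto
    then have "emeasure m (uminus -` A) = (SUP K\<in>{K. compact K \<and> K \<in> sets m \<and> K \<subseteq> uminus -` A}. emeasure m K)"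
      by (rule inner)
    also have "\<dots> \<le> emeasure m A"
    proof (rule SUP_least)
      fix K assume "K \<in> {K. compact K \<and> K \<in> sets m \<and> K \<subseteq> uminus -` A}"
      then have K: "compact K" "K \<subseteq> uminus -` A" by auto
      have K': "compact (uminus ` K)"
        using K(1) by (intro compact_continuous_image continuous_on_subset[OF translations_continuous(3)]) auto
      have "emeasure m K = emeasure m (uminus -` (uminus ` K))"
        by (intro arg_cong[where f="emeasure m"]) (auto simp: image_iff)
      also have "\<dots> \<le> emeasure m (uminus ` K)" by (rule emeasure_uminus_compact_le[OF K'])
      also have "\<dots> \<le> emeasure m A" using K A by (intro emeasure_mono) auto
      finally show "emeasure m K \<le> emeasure m A" .
    qed
    finally show ?thesis .
  qed
  have "emeasure m (uminus -` (uminus -` A)) \<le> emeasure m (uminus -` A)"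
    using A by (intro le borel_vimage) auto
  moreover have "uminus -` (uminus -` A) = A" by auto
  ultimately show ?thesis using le[OF A] by simp
qed

text \<open>A compact group is unimodular: inversion exchanges left and right translations.\<close>

lemma emeasure_right:
  assumes A: "A \<in> sets borel"
  shows "emeasure m ((\<lambda>a. a + t) -` A) = emeasure m A"
proof -
  have "emeasure m ((\<lambda>a. a + t) -` A) = emeasure m (uminus -` ((\<lambda>a. a + t) -` A))"
    using A by (intro emeasure_uminus[symmetric] borel_vimage) auto
  also have "uminus -` ((\<lambda>a. a + t) -` A) = (\<lambda>a. - t + a) -` (uminus -` A)"
    by (auto simp: minus_add)
  also have "emeasure m \<dots> = emeasure m (uminus -` A)"
    using A by (intro emeasure_left borel_vimage) auto
  also have "\<dots> = emeasure m A" by (rule emeasure_uminus[OF A])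
  finally show ?thesis .
qed

lemma distr_right: "distr m m (\<lambda>a. a + t) = m"
  by (rule measure_eqI) (auto simp: emeasure_distr emeasure_right)

lemma integral_right:
  fixes f :: "'g \<Rightarrow> 'b::{banach, second_countable_topology}"
  assumes "f \<in> borel_measurable borel"
  shows "(\<integral>a. f (a + t) \<partial>m) = (\<integral>a. f a \<partial>m)"
  using integral_distr[of "\<lambda>a. a + t" m m f] assms unfolding distr_right by simp

lemma integrable_right:
  fixes f :: "'g \<Rightarrow> 'b::{banach, second_countable_topology}"
  assumes "integrable m f"
  shows "integrable m (\<lambda>a. f (a + t))"
  using integrable_distr[of "\<lambda>a. a + t" m m f] assms unfolding distr_right by simp

lemma compact_inside:
  assumes A: "A \<in> sets borel" and e: "e > 0"
  obtains K where "compact K" "K \<subseteq> A" "measure m A \<le> measure m K + e"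
proof (cases "measure m A \<le> e")
  case True
  then show ?thesis by (intro that[of "{}"]) auto
next
  case False
  then have "ennreal (measure m A - e) < emeasure m A"
    using e by (simp add: emeasure_eq_measure ennreal_less_iff)
  then obtain K where "compact K" "K \<subseteq> A" "ennreal (measure m A - e) < emeasure m K"
    unfolding inner[OF A] less_SUP_iff by blast
  then show ?thesis
    using False by (intro that[of K]) (auto simp: emeasure_eq_measure ennreal_less_iff)
qed

text \<open>Translation moves a Borel set continuously in measure: squeeze it between a compact set and an
  open set of nearly the same measure.\<close>

lemma translation_continuous_zero:
  assumes A: "A \<in> sets borel" and e: "e > 0"
  shows "\<exists>V. open V \<and> 0 \<in> V \<and> (\<forall>v\<in>V. measure m {s. (s + v \<in> A) \<noteq> (s \<in> A)} < e)"
proof -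
  have "emeasure m A < emeasure m A + ennreal (e / 8)"
    using e by (auto simp: ennreal_add_left_cancel_less less_top[symmetric])
  then obtain U where U: "open U" "A \<subseteq> U" "emeasure m U < emeasure m A + ennreal (e / 8)"
    unfolding outer[OF A] INF_less_iff by blast
  obtain K where K: "compact K" "K \<subseteq> A" "measure m A \<le> measure m K + e / 8"
    by (rule compact_inside[OF A, of "e / 8"]) (use e in auto)
  have Ub: "U \<in> sets borel" using U(1) by auto
  have Kb: "K \<in> sets borel" using K(1) by (rule compact_borel)
  have U': "measure m U \<le> measure m A + e / 8"
    using U(3) e by (simp add: emeasure_eq_measure ennreal_less_iff flip: ennreal_plus)
  obtain V where V: "open V" "0 \<in> V" "\<And>v k. v \<in> V \<Longrightarrow> k \<in> K \<Longrightarrow> k + v \<in> U"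
  proof -
    have cont: "continuous_on UNIV (\<lambda>(w::'g, k). k + w)"
      unfolding case_prod_unfold by (intro continuous_intros)
    have "\<exists>W. open W \<and> 0 \<in> W \<and> (\<forall>w\<in>W. \<forall>k\<in>K. k + w \<in> U)"
      by (rule compact_neighbourhood[OF cont _ K(1) U(1)]) (use K(2) U(2) in auto)
    then show ?thesis using that by blast
  qed
  have "measure m {s. (s + v \<in> A) \<noteq> (s \<in> A)} < e" if v: "v \<in> V" for v
  proof -
    define A' where "A' = (\<lambda>a. a + v) -` A"
    have A': "A' \<in> sets borel" "measure m A' = measure m A"
      using A by (auto simp: A'_def measure_def emeasure_right intro!: borel_vimage)
    have U': "measure m ((\<lambda>a. a + v) -` (U - A)) = measure m U - measure m A" "(\<lambda>a. a + v) -` (U - A) \<in> sets borel"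
      using A Ub U(2) finite_measure_Diff[of U A]
      by (auto simp: measure_def emeasure_right intro!: borel_vimage)
    have "A - A' \<subseteq> (A - K) \<union> ((\<lambda>a. a + v) -` (U - A))"
      using V(3)[OF v] by (auto simp: A'_def)
    then have "measure m (A - A') \<le> measure m ((A - K) \<union> ((\<lambda>a. a + v) -` (U - A)))"
      using A Kb U' by (intro finite_measure_mono) auto
    also have "\<dots> \<le> measure m (A - K) + measure m ((\<lambda>a. a + v) -` (U - A))"
      using A Kb U' by (intro measure_Un_le) auto
    also have "\<dots> = (measure m A - measure m K) + (measure m U - measure m A)"
      using A Kb K(2) U' by (simp add: finite_measure_Diff)
    also have "\<dots> \<le> e / 8 + (measure m U - measure m A)" using K(3) by simp
    also have "measure m U - measure m A \<le> e / 8" using \<open>measure m U \<le> measure m A + e / 8\<close> by simp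
    finally have 1: "measure m (A - A') \<le> e / 4" by simp
    \<comment> \<open>right invariance: \<open>A\<close> and its translate \<open>A'\<close> have the same measure\<close>
    have 2: "measure m (A' - A) = measure m (A - A')"
      using A A' by (simp add: finite_measure_Diff' Int_commute)
    have "{s. (s + v \<in> A) \<noteq> (s \<in> A)} = (A - A') \<union> (A' - A)"
      by (auto simp: A'_def)
    also have "measure m \<dots> \<le> measure m (A - A') + measure m (A' - A)"
      using A A' by (intro measure_Un_le) auto
    also have "\<dots> < e" using 1 2 e by simp
    finally show ?thesis .
  qed
  then show ?thesis using V by blast
qed

end

section \<open>Integral inequalities\<close>

text \<open>Absolute continuity of the integral, by truncating \<open>f\<close>.\<close>

lemma integral_small_on_small_sets:
  fixes f :: "'a \<Rightarrow> 'b::{banach, second_countable_topology}"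
  assumes "finite_measure M" and f: "integrable M f" and e: "e > 0"
  shows "\<exists>\<delta>>0. \<forall>A\<in>sets M. measure M A < \<delta> \<longrightarrow> (\<integral>x. indicator A x * norm (f x) \<partial>M) < e"
proof -
  interpret finite_measure M by fact
  have f' [measurable]: "f \<in> borel_measurable M" using f by auto
  define g where "g n x = indicator {x. norm (f x) > real n} x * norm (f x)" for n x
  have g [measurable]: "g n \<in> borel_measurable M" for n
    unfolding g_def by measurable
  have g_le: "norm (g n x) \<le> norm (f x)" for n x
    by (auto simp: g_def indicator_def)
  have nf: "integrable M (\<lambda>x. norm (f x))" using f by (rule integrable_norm)
  have gi: "integrable M (g n)" for n
    by (rule Bochner_Integration.integrable_bound[OF nf]) (use g_le in auto)
  have "(\<lambda>n. \<integral>x. g n x \<partial>M) \<longlonglongrightarrow> (\<integral>x. 0 \<partial>M)"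
  proof (rule integral_dominated_convergence[where w="\<lambda>x. norm (f x)"])
    show "AE x in M. (\<lambda>n. g n x) \<longlonglongrightarrow> 0"
    proof (rule AE_I2)
      fix x
      obtain N where "norm (f x) \<le> real N" using real_arch_simple by blast
      then have "\<forall>\<^sub>F n in sequentially. g n x = 0"
        by (intro eventually_sequentiallyI[of N]) (auto simp: g_def)
      then show "(\<lambda>n. g n x) \<longlonglongrightarrow> 0" by (rule tendsto_eventually)
    qed
  qed (use nf g_le in auto)
  then have "\<forall>\<^sub>F n in sequentially. (\<integral>x. g n x \<partial>M) < e / 2"
    using e by (intro order_tendstoD) auto
  then obtain n where n: "(\<integral>x. g n x \<partial>M) < e / 2" by (auto simp: eventually_sequentially)
  have "(\<integral>x. indicator A x * norm (f x) \<partial>M) < e"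
    if A: "A \<in> sets M" "measure M A < e / (2 * (real n + 1))" for A
  proof -
    have iA: "integrable M (\<lambda>x. real n * indicator A x)"
      using A(1) by (intro integrable_mult_right integrable_real_indicator) (auto simp: emeasure_eq_measure)
    have "(\<integral>x. indicator A x * norm (f x) \<partial>M) \<le> (\<integral>x. real n * indicator A x + g n x \<partial>M)"
    proof (rule integral_mono)
      show "integrable M (\<lambda>x. indicator A x * norm (f x))"
        using A(1) nf by (rule integrable_real_mult_indicator[of _ _ "\<lambda>x. norm (f x)", simplified mult.commute])
      show "integrable M (\<lambda>x. real n * indicator A x + g n x)"
        using iA gi by (rule Bochner_Integration.integrable_add)
    qed (auto simp: g_def indicator_def)
    also have "\<dots> = real n * measure M A + (\<integral>x. g n x \<partial>M)"
      using iA gi A(1) by simp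
    also have "real n * measure M A \<le> e / 2"
    proof -
      have "real n * measure M A \<le> (real n + 1) * measure M A" by (simp add: mult_right_mono)
      also have "\<dots> \<le> (real n + 1) * (e / (2 * (real n + 1)))"
        using A(2) by (intro mult_left_mono) auto
      also have "\<dots> = e / 2" by (simp add: divide_simps)
      finally show ?thesis .
    qed
    finally show ?thesis using n by simp
  qed
  then show ?thesis
    using e by (intro exI[of _ "e / (2 * (real n + 1))"]) auto
qed

lemma weighted_arith_geo_mean3:
  fixes a b c :: real
  assumes "a \<ge> 0" "b \<ge> 0" "c \<ge> 0" and w: "\<alpha> \<ge> 0" "\<beta> \<ge> 0" "\<gamma> \<ge> 0" "\<alpha> + \<beta> + \<gamma> = 1"
  shows "a powr \<alpha> * b powr \<beta> * c powr \<gamma> \<le> \<alpha> * a + \<beta> * b + \<gamma> * c"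
proof (cases "a = 0 \<or> b = 0 \<or> c = 0")
  case True
  then show ?thesis using assms by auto
next
  case False
  then have pos: "a > 0" "b > 0" "c > 0" using assms by auto
  define x where "x = \<alpha> * a + \<beta> * b + \<gamma> * c"
  have x: "x > 0"
  proof -
    have "\<alpha> > 0 \<or> \<beta> > 0 \<or> \<gamma> > 0" using w by linarith
    then have "\<alpha> * a > 0 \<or> \<beta> * b > 0 \<or> \<gamma> * c > 0"
      using pos by (auto simp: zero_less_mult_iff)
    moreover have "\<alpha> * a \<ge> 0" "\<beta> * b \<ge> 0" "\<gamma> * c \<ge> 0" using pos w by auto
    ultimately show ?thesis unfolding x_def by linarith
  qed
  have ln_le: "ln y \<le> ln x + (y / x - 1)" if "y > 0" for y
    using ln_le_minus_one[of "y / x"] that x by (simp add: ln_div)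
  have "\<alpha> * ln a + \<beta> * ln b + \<gamma> * ln c
      \<le> \<alpha> * (ln x + (a / x - 1)) + \<beta> * (ln x + (b / x - 1)) + \<gamma> * (ln x + (c / x - 1))"
    using pos w by (intro add_mono mult_left_mono ln_le)
  also have "\<dots> = (\<alpha> + \<beta> + \<gamma>) * (ln x - 1) + (\<alpha> * a + \<beta> * b + \<gamma> * c) / x"
    by (simp add: algebra_simps add_divide_distrib)
  also have "\<dots> = ln x" using w(4) x by (simp add: x_def[symmetric])
  finally have "exp (\<alpha> * ln a + \<beta> * ln b + \<gamma> * ln c) \<le> exp (ln x)" by simp
  then show ?thesis
    using pos x by (simp add: powr_def exp_add x_def)
qed

text \<open>Hoelder's inequality with weights as exponents. A weight may be zero: then \<open>u x powr 0\<close> is the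
  indicator of the set where \<open>u\<close> does not vanish, since \<open>0 powr 0 = 0\<close>.\<close>

lemma Hoelder3:
  fixes u v w :: "'a \<Rightarrow> real"
  assumes u: "integrable M u" "\<And>x. u x \<ge> 0" and v: "integrable M v" "\<And>x. v x \<ge> 0"
    and w: "integrable M w" "\<And>x. w x \<ge> 0"
    and weights: "\<alpha> \<ge> 0" "\<beta> \<ge> 0" "\<gamma> \<ge> 0" "\<alpha> + \<beta> + \<gamma> = 1"
  shows "integrable M (\<lambda>x. u x powr \<alpha> * v x powr \<beta> * w x powr \<gamma>)" (is ?int)
    and "(\<integral>x. u x powr \<alpha> * v x powr \<beta> * w x powr \<gamma> \<partial>M)
      \<le> (\<integral>x. u x \<partial>M) powr \<alpha> * (\<integral>x. v x \<partial>M) powr \<beta> * (\<integral>x. w x \<partial>M) powr \<gamma>" (is ?le)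
proof -
  let ?h = "\<lambda>x. u x powr \<alpha> * v x powr \<beta> * w x powr \<gamma>"
  have meas [measurable]: "u \<in> borel_measurable M" "v \<in> borel_measurable M" "w \<in> borel_measurable M"
    using u v w by auto
  have sum_int: "integrable M (\<lambda>x. a * u x + b * v x + c * w x)" for a b c
    using u(1) v(1) w(1) by (intro Bochner_Integration.integrable_add integrable_mult_right)
  show int: ?int
  proof (rule Bochner_Integration.integrable_bound[OF sum_int[of \<alpha> \<beta> \<gamma>]])
    show "AE x in M. norm (?h x) \<le> norm (\<alpha> * u x + \<beta> * v x + \<gamma> * w x)"
    proof (rule AE_I2)
      fix x
      have "?h x \<le> \<alpha> * u x + \<beta> * v x + \<gamma> * w x"
        using weights u v w by (intro weighted_arith_geo_mean3)
      moreover have "?h x \<ge> 0" by simp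
      ultimately show "norm (?h x) \<le> norm (\<alpha> * u x + \<beta> * v x + \<gamma> * w x)" by simp
    qed
  qed measurable
  define U where "U = (\<integral>x. u x \<partial>M)"
  define V where "V = (\<integral>x. v x \<partial>M)"
  define W where "W = (\<integral>x. w x \<partial>M)"
  have nonneg: "U \<ge> 0" "V \<ge> 0" "W \<ge> 0"
    unfolding U_def V_def W_def using u v w by (auto intro: integral_nonneg_AE)
  have zero: "AE x in M. k x = 0" if "integrable M k" "\<And>x. k x \<ge> 0" "(\<integral>x. k x \<partial>M) = 0" for k :: "'a \<Rightarrow> real"
    using integral_nonneg_eq_0_iff_AE[of M k] that by auto
  have "(\<integral>x. ?h x \<partial>M) \<le> U powr \<alpha> * V powr \<beta> * W powr \<gamma>"
  proof (cases "U = 0 \<or> V = 0 \<or> W = 0")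
    case True
    then have "AE x in M. u x = 0 \<or> v x = 0 \<or> w x = 0"
      using zero[OF u] zero[OF v] zero[OF w] unfolding U_def V_def W_def by (elim disjE) auto
    then have "AE x in M. ?h x = 0" by eventually_elim auto
    then have "(\<integral>x. ?h x \<partial>M) = 0" by (rule integral_eq_zero_AE)
    then show ?thesis by simp
  next
    case False
    then have pos: "U > 0" "V > 0" "W > 0" using nonneg by auto
    have "(\<integral>x. ?h x / (U powr \<alpha> * V powr \<beta> * W powr \<gamma>) \<partial>M)
        \<le> (\<integral>x. \<alpha> / U * u x + \<beta> / V * v x + \<gamma> / W * w x \<partial>M)"
    proof (rule integral_mono[OF _ sum_int])
      show "integrable M (\<lambda>x. ?h x / (U powr \<alpha> * V powr \<beta> * W powr \<gamma>))" using int by simp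
      fix x
      have "(u x / U) powr \<alpha> * (v x / V) powr \<beta> * (w x / W) powr \<gamma>
          \<le> \<alpha> * (u x / U) + \<beta> * (v x / V) + \<gamma> * (w x / W)"
        using weights u v w nonneg by (intro weighted_arith_geo_mean3) auto
      then show "?h x / (U powr \<alpha> * V powr \<beta> * W powr \<gamma>) \<le> \<alpha> / U * u x + \<beta> / V * v x + \<gamma> / W * w x"
        using u(2)[of x] v(2)[of x] w(2)[of x] pos by (simp add: powr_divide)
    qed
    also have "\<dots> = \<alpha> / U * U + \<beta> / V * V + \<gamma> / W * W"
      using u(1) v(1) w(1) unfolding U_def V_def W_def by simp
    also have "\<dots> = 1" using weights pos by simp
    finally show ?thesis using pos by (simp add: divide_le_eq)
  qed
  then show ?le unfolding U_def V_def W_def .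
qed

lemma powr_inverse_exponent: "x \<ge> 0 \<Longrightarrow> p > 0 \<Longrightarrow> (x powr p) powr (1 / p) = (x::real)"
  by (simp add: powr_powr)

lemma integrable_of_powr:
  fixes f :: "'a \<Rightarrow> complex"
  assumes "finite_measure M" and f: "f \<in> borel_measurable M" "integrable M (\<lambda>x. cmod (f x) powr p)" and p: "p \<ge> 1"
  shows "integrable M f"
proof -
  interpret finite_measure M by fact
  show ?thesis
  proof (rule Bochner_Integration.integrable_bound)
    show "integrable M (\<lambda>x. 1 + cmod (f x) powr p)" using f(2) by simp
    have "cmod (f x) \<le> 1 + cmod (f x) powr p" for x
    proof (cases "cmod (f x) \<le> 1")
      case False
      then have "cmod (f x) powr 1 \<le> cmod (f x) powr p" using p by (intro powr_mono) auto
      then show ?thesis using False by simp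
    qed (simp add: add_increasing2)
    then show "AE x in M. norm (f x) \<le> norm (1 + cmod (f x) powr p)" by auto
  qed (rule f(1))
qed

text \<open>Hoelder's inequality for conjugate exponents, uniformly in \<open>1 \<le> p < \<infinity>\<close>; for \<open>p = 1\<close> the norm of
  \<open>g\<close> is the essential supremum.\<close>

lemma pairing_le:
  fixes g k :: "'a \<Rightarrow> complex"
  assumes "finite_measure M" and p: "1 \<le> p"
    and g: "g \<in> borel_measurable M" "Lp_norm (conjugate_exponent (ennreal p)) M g \<le> 1"
    and k: "k \<in> borel_measurable M" "integrable M (\<lambda>x. cmod (k x) powr p)"
  shows "cmod (\<integral>x. g x * k x \<partial>M) \<le> (\<integral>x. cmod (k x) powr p \<partial>M) powr (1 / p)"
proof -
  interpret finite_measure M by fact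
  note [measurable] = g(1) k(1)
  have "(\<integral>x. cmod (g x * k x) \<partial>M) \<le> (\<integral>x. cmod (k x) powr p \<partial>M) powr (1 / p)"
  proof (cases "p = 1")
    case True
    have "conjugate_exponent (ennreal p) = \<infinity>"
      using True by (simp add: conjugate_exponent_def)
    then have "esssup M (\<lambda>x. ennreal (cmod (g x))) \<le> 1"
      using g(2) by (simp add: Lp_norm_def)
    then have AE: "AE x in M. cmod (g x) \<le> 1"
      using esssup_AE[of "\<lambda>x. ennreal (cmod (g x))" M]
      by (auto elim!: eventually_mono dest: order_trans)
    have ik: "integrable M (\<lambda>x. cmod (k x))" using k(2) True by simp
    have "(\<integral>x. cmod (g x * k x) \<partial>M) \<le> (\<integral>x. cmod (k x) \<partial>M)"
    proof (rule integral_mono_AE)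
      show "AE x in M. cmod (g x * k x) \<le> cmod (k x)"
        using AE by eventually_elim (simp add: norm_mult mult_left_le_one_le)
      then show "integrable M (\<lambda>x. cmod (g x * k x))"
        by (intro Bochner_Integration.integrable_bound[OF ik]) auto
    qed (use ik in auto)
    then show ?thesis using True by (simp add: integral_nonneg_AE)
  next
    case False
    define P where "P = p / (p - 1)"
    have p1: "1 < p" using p False by simp
    have P: "1 \<le> P" "1 / P + 1 / p = 1" "0 < P"
      using p1 by (auto simp: P_def field_simps)
    have nn: "(\<integral>\<^sup>+x. ennreal (cmod (g x) powr P) \<partial>M) \<le> 1"
      using g(2) Lp_norm_le_iff[OF P(1), of 1 M g] unfolding conjugate_exponent_real[OF p1] P_def[symmetric]
      by simp
    have ig: "integrable M (\<lambda>x. cmod (g x) powr P)"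
      using nn by (intro integrableI_bounded) (auto intro: order_le_less_trans)
    have "ennreal (\<integral>x. cmod (g x) powr P \<partial>M) \<le> 1"
      using nn nn_integral_eq_integral[OF ig] by simp
    then have Ig: "(\<integral>x. cmod (g x) powr P \<partial>M) \<le> 1" by simp
    have eq: "cmod (g x * k x) = (cmod (g x) powr P) powr (1 / P) * (cmod (k x) powr p) powr (1 / p) * 1 powr 0" for x
      using P p1 by (simp add: norm_mult powr_inverse_exponent)
    have "(\<integral>x. cmod (g x * k x) \<partial>M) \<le> (\<integral>x. cmod (g x) powr P \<partial>M) powr (1 / P) *
        (\<integral>x. cmod (k x) powr p \<partial>M) powr (1 / p) * (\<integral>x. 1 \<partial>M) powr 0"
      unfolding eq using ig k(2) P p1 by (intro Hoelder3) auto
    also have "\<dots> \<le> 1 * (\<integral>x. cmod (k x) powr p \<partial>M) powr (1 / p) * 1"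
    proof -
      have "(\<integral>x. cmod (g x) powr P \<partial>M) powr (1 / P) \<le> 1"
        using Ig P by (intro powr_le1) (auto simp: integral_nonneg_AE)
      moreover have "(\<integral>x. 1 \<partial>M) powr 0 \<le> (1::real)" by simp
      ultimately show ?thesis by (intro mult_mono) auto
    qed
    finally show ?thesis by simp
  qed
  then show ?thesis
    by (rule order_trans[OF integral_norm_bound])
qed

text \<open>Simple approximants of \<open>f\<close> dominated by \<open>2 * norm f\<close> converge in every mean by dominated
  convergence.\<close>

lemma simple_dense_powr:
  fixes f :: "'a \<Rightarrow> complex"
  assumes f: "f \<in> borel_measurable M" "integrable M (\<lambda>x. cmod (f x) powr p)" and p: "p \<ge> 1" and e: "e > 0"
  shows "\<exists>f0. simple_function M f0 \<and> integrable M (\<lambda>x. cmod (f x - f0 x) powr p) \<and>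
    (\<integral>x. cmod (f x - f0 x) powr p \<partial>M) < e"
proof -
  obtain F where F: "\<And>i. simple_function M (F i)" "\<And>x. x \<in> space M \<Longrightarrow> (\<lambda>i. F i x) \<longlonglongrightarrow> f x"
    "\<And>i x. x \<in> space M \<Longrightarrow> dist (F i x) 0 \<le> 2 * dist (f x) 0"
    using borel_measurable_implies_sequence_metric[OF f(1), of 0] by blast
  note [measurable] = f(1) borel_measurable_simple_function[OF F(1)]
  have dom: "integrable M (\<lambda>x. 3 powr p * cmod (f x) powr p)"
    using f(2) by simp
  have le: "cmod (f x - F i x) powr p \<le> 3 powr p * cmod (f x) powr p" if "x \<in> space M" for i x
  proof -
    have "cmod (f x - F i x) \<le> 3 * cmod (f x)"
      using norm_triangle_ineq4[of "f x" "F i x"] F(3)[OF that, of i] by simp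
    then have "cmod (f x - F i x) powr p \<le> (3 * cmod (f x)) powr p"
      using p by (intro powr_mono2) auto
    then show ?thesis by (simp add: powr_mult)
  qed
  have int: "integrable M (\<lambda>x. cmod (f x - F i x) powr p)" for i
    by (rule Bochner_Integration.integrable_bound[OF dom]) (use le in auto)
  have "(\<lambda>i. \<integral>x. cmod (f x - F i x) powr p \<partial>M) \<longlonglongrightarrow> (\<integral>x. 0 \<partial>M)"
  proof (rule integral_dominated_convergence[OF _ _ dom])
    show "AE x in M. (\<lambda>i. cmod (f x - F i x) powr p) \<longlonglongrightarrow> 0"
    proof (rule AE_I2)
      fix x assume "x \<in> space M"
      then have "(\<lambda>i. cmod (f x - F i x)) \<longlonglongrightarrow> cmod (f x - f x)"
        using F(2) by (intro tendsto_intros)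
      then have "(\<lambda>i. cmod (f x - F i x) powr p) \<longlonglongrightarrow> cmod (f x - f x) powr p"
        using p by (intro tendsto_powr') auto
      then show "(\<lambda>i. cmod (f x - F i x) powr p) \<longlonglongrightarrow> 0" using p by simp
    qed
  qed (use le in auto)
  then have "\<forall>\<^sub>F i in sequentially. (\<integral>x. cmod (f x - F i x) powr p \<partial>M) < e"
    using e by (intro order_tendstoD) auto
  then obtain i where "(\<integral>x. cmod (f x - F i x) powr p \<partial>M) < e" by (auto simp: eventually_sequentially)
  then show ?thesis using F(1) int by blast
qed

section \<open>Convolution\<close>

context compact_haar
begin

text \<open>The integral of \<open>f\<close> over \<open>A - t\<close>, as a function of \<open>t\<close> the integrand of the convolution. By right
  invariance it is also the integral of \<open>f (s - t)\<close> over \<open>s \<in> A\<close>.\<close>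

definition shift_integral :: "('g \<Rightarrow> 'b::{banach, second_countable_topology}) \<Rightarrow> 'g set \<Rightarrow> 'g \<Rightarrow> 'b" where
  "shift_integral f A t = (\<integral>s. indicator A (s + t) *\<^sub>R f s \<partial>m)"

lemma fun_convolution_eq: "fun_convolution m f \<nu> A = vm_integral \<nu> (shift_integral f A)"
proof -
  have "indicator ((\<lambda>a. a - t) ` A) s = (indicator A (s + t) :: real)" for s t
    by (auto simp: indicator_def image_iff intro!: bexI[of _ "s + t"])
  then show ?thesis
    unfolding fun_convolution_def convolution_def set_lebesgue_integral_def shift_integral_def by simp
qed

lemma measure_right:
  assumes "A \<in> sets borel"
  shows "measure m ((\<lambda>a. a + t) -` A) = measure m A"
  unfolding measure_def emeasure_right[OF assms] ..

lemma right_vimage_borel: "A \<in> sets borel \<Longrightarrow> (\<lambda>a::'g. a + t) -` A \<in> sets borel"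
  by (rule borel_vimage[OF translations_measurable(2)])

lemma indicator_shift_measurable [measurable]:
  fixes A :: "'g set"
  shows "A \<in> sets borel \<Longrightarrow> (\<lambda>s. indicator A (s + t) :: real) \<in> borel_measurable borel"
  using borel_measurable_indicator[OF right_vimage_borel, of A t]
  by (simp add: indicator_def vimage_def)

lemma integrable_shift:
  fixes f :: "'g \<Rightarrow> 'b::{banach, second_countable_topology}"
  assumes f: "integrable m f" and A: "A \<in> sets borel"
  shows "integrable m (\<lambda>s. indicator A (s + t) *\<^sub>R f s)"
proof (rule Bochner_Integration.integrable_bound[OF f])
  have "f \<in> borel_measurable m" using f by auto
  then show "(\<lambda>s. indicator A (s + t) *\<^sub>R f s) \<in> borel_measurable m"
    using A by (intro borel_measurable_scaleR) auto
qed (auto simp: indicator_def)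

lemma finitely_additive_shift_integral:
  assumes f: "integrable m f"
  shows "finitely_additive (\<lambda>A. shift_integral f A t)"
  unfolding finitely_additive_def
proof (intro ballI impI)
  fix A B :: "'g set" assume AB: "A \<in> sets borel" "B \<in> sets borel" "A \<inter> B = {}"
  have "shift_integral f (A \<union> B) t = (\<integral>s. indicator A (s + t) *\<^sub>R f s + indicator B (s + t) *\<^sub>R f s \<partial>m)"
    unfolding shift_integral_def using AB(3)
    by (intro Bochner_Integration.integral_cong) (auto simp: indicator_def)
  also have "\<dots> = shift_integral f A t + shift_integral f B t"
    unfolding shift_integral_def by (intro Bochner_Integration.integral_add integrable_shift f AB)
  finally show "shift_integral f (A \<union> B) t = shift_integral f A t + shift_integral f B t" .
qed

text \<open>Uniformity in \<open>t\<close> holds because all translates of \<open>A\<close> have the same measure.\<close>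

lemma shift_integral_small:
  assumes f: "integrable m f" and e: "e > 0"
  shows "\<exists>\<delta>>0. \<forall>A\<in>sets borel. measure m A < \<delta> \<longrightarrow> (\<forall>t. norm (shift_integral f A t) < e)"
proof -
  obtain \<delta> where \<delta>: "\<delta> > 0" "\<And>A. A \<in> sets borel \<Longrightarrow> measure m A < \<delta> \<Longrightarrow> (\<integral>x. indicator A x * norm (f x) \<partial>m) < e"
    using integral_small_on_small_sets[OF finite_m f e] by auto
  have "norm (shift_integral f A t) < e" if A: "A \<in> sets borel" "measure m A < \<delta>" for A t
  proof -
    have "norm (shift_integral f A t) \<le> (\<integral>s. norm (indicator A (s + t) *\<^sub>R f s) \<partial>m)"
      unfolding shift_integral_def by (rule integral_norm_bound)
    also have "\<dots> = (\<integral>s. indicator ((\<lambda>a. a + t) -` A) s * norm (f s) \<partial>m)"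
      by (intro Bochner_Integration.integral_cong) (auto simp: indicator_def)
    also have "\<dots> < e"
      using A by (intro \<delta>(2) right_vimage_borel) (auto simp: measure_right)
    finally show ?thesis .
  qed
  then show ?thesis using \<delta>(1) by blast
qed

lemma symmetric_difference_borel:
  assumes A: "A \<in> sets borel"
  shows "{s. (s + t \<in> A) \<noteq> (s + u \<in> A)} \<in> sets (borel :: 'g measure)"
proof -
  have "{s. (s + t \<in> A) \<noteq> (s + u \<in> A)}
      = (((\<lambda>s. s + t) -` A) - ((\<lambda>s. s + u) -` A)) \<union> (((\<lambda>s. s + u) -` A) - ((\<lambda>s. s + t) -` A))"
    by auto
  also have "\<dots> \<in> sets borel"
    by (intro sets.Un sets.Diff right_vimage_borel A)
  finally show ?thesis .
qed

lemma measure_symmetric_difference: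
  assumes A: "A \<in> sets borel"
  shows "measure m {s. (s + t \<in> A) \<noteq> (s + u \<in> A)} = measure m {s. (s + (- u + t) \<in> A) \<noteq> (s \<in> A)}"
proof -
  have "{s. (s + t \<in> A) \<noteq> (s + u \<in> A)} = (\<lambda>s. s + u) -` {s. (s + (- u + t) \<in> A) \<noteq> (s \<in> A)}"
    by (auto simp: add.assoc)
  moreover have "{s. (s + (- u + t) \<in> A) \<noteq> (s \<in> A)} \<in> sets borel"
    using symmetric_difference_borel[OF A, of "- u + t" 0] by simp
  then have "measure m ((\<lambda>s. s + u) -` {s. (s + (- u + t) \<in> A) \<noteq> (s \<in> A)})
      = measure m {s. (s + (- u + t) \<in> A) \<noteq> (s \<in> A)}"
    by (rule measure_right)
  ultimately show ?thesis by (rule trans[OF arg_cong[where f="measure m"]])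
qed

lemma continuous_shift_integral:
  assumes f: "integrable m f" and A: "A \<in> sets borel"
  shows "continuous_on UNIV (shift_integral f A)"
  unfolding continuous_on_def
proof (intro ballI tendstoI)
  fix t0 :: 'g and e :: real assume e: "e > 0"
  obtain \<delta> where \<delta>: "\<delta> > 0" "\<And>A. A \<in> sets borel \<Longrightarrow> measure m A < \<delta> \<Longrightarrow> (\<integral>x. indicator A x * norm (f x) \<partial>m) < e"
    using integral_small_on_small_sets[OF finite_m f e] by auto
  obtain V where V: "open V" "0 \<in> V" "\<And>v. v \<in> V \<Longrightarrow> measure m {s. (s + v \<in> A) \<noteq> (s \<in> A)} < \<delta>"
    using translation_continuous_zero[OF A \<delta>(1)] by blast
  have close: "dist (shift_integral f A t) (shift_integral f A t0) < e" if t: "- t0 + t \<in> V" for t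
  proof -
    let ?D = "{s. (s + t \<in> A) \<noteq> (s + t0 \<in> A)}"
    have "shift_integral f A t - shift_integral f A t0
        = (\<integral>s. indicator A (s + t) *\<^sub>R f s - indicator A (s + t0) *\<^sub>R f s \<partial>m)"
      unfolding shift_integral_def
      by (intro Bochner_Integration.integral_diff[symmetric] integrable_shift f A)
    also have "norm \<dots> \<le> (\<integral>s. norm (indicator A (s + t) *\<^sub>R f s - indicator A (s + t0) *\<^sub>R f s) \<partial>m)"
      by (rule integral_norm_bound)
    also have "\<dots> = (\<integral>s. indicator ?D s * norm (f s) \<partial>m)"
      by (intro Bochner_Integration.integral_cong) (auto simp: indicator_def)
    also have "\<dots> < e"
      by (rule \<delta>(2)[OF symmetric_difference_borel[OF A]])
        (subst measure_symmetric_difference[OF A], rule V(3)[OF t])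
    finally show ?thesis by (simp add: dist_norm)
  qed
  have "open ((\<lambda>t. - t0 + t) -` V)"
    by (rule open_vimage[OF V(1) translations_continuous(1)])
  then show "\<forall>\<^sub>F t in at t0. dist (shift_integral f A t) (shift_integral f A t0) < e"
    unfolding eventually_at_topological using V(2) close
    by (intro exI[of _ "(\<lambda>t. - t0 + t) -` V"]) auto
qed

lemma regulated_shift_integral:
  "integrable m f \<Longrightarrow> A \<in> sets borel \<Longrightarrow> regulated (shift_integral f A)"
  by (rule regulated_continuous[OF compact_UNIV continuous_shift_integral])

text \<open>The remainders of a disjoint union have small Haar measure, so their integrands are uniformly
  small.\<close>

lemma vector_measure_fun_convolution:
  fixes \<nu> :: "'g set \<Rightarrow> 'x::complex_banach"
  assumes \<nu>: "vector_measure \<nu>" and f: "integrable m f"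
  shows "vector_measure (fun_convolution m f \<nu>)"
proof -
  let ?\<xi> = "fun_convolution m f \<nu>"
  define S where "S = enn2real (semivariation \<nu>)"
  have S: "S \<ge> 0" by (simp add: S_def)
  have add: "finitely_additive ?\<xi>"
    unfolding finitely_additive_def
  proof (intro ballI impI)
    fix A B :: "'g set" assume AB: "A \<in> sets borel" "B \<in> sets borel" "A \<inter> B = {}"
    have "shift_integral f (A \<union> B) = (\<lambda>t. shift_integral f A t + 1 * shift_integral f B t)"
      using finitely_additive_Un[OF finitely_additive_shift_integral[OF f] AB] by auto
    then show "?\<xi> (A \<union> B) = ?\<xi> A + ?\<xi> B"
      using AB by (simp only: fun_convolution_eq vm_integral_add[OF \<nu> regulated_shift_integral regulated_shift_integral, OF f _ f] scaleC_one)
  qed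
  show ?thesis
    unfolding vector_measure_def
  proof (intro allI impI)
    fix A :: "nat \<Rightarrow> 'g set" assume "range A \<subseteq> sets borel \<and> disjoint_family A"
    then have A: "\<And>i. A i \<in> sets borel" "disjoint_family A" by auto
    define C where "C n = (\<Union>i. A i) - (\<Union>i<n. A i)" for n
    have C: "C n \<in> sets borel" for n unfolding C_def using A(1) by auto
    have "decseq C" by (auto simp: C_def decseq_def)
    moreover have "(\<Inter>n. C n) = {}" by (auto simp: C_def)
    ultimately have lim: "(\<lambda>n. measure m (C n)) \<longlonglongrightarrow> 0"
      using finite_Lim_measure_decseq[of C] C by auto
    have split: "?\<xi> (\<Union>i. A i) = (\<Sum>i<n. ?\<xi> (A i)) + ?\<xi> (C n)" for n
    proof -
      have "?\<xi> ((\<Union>i<n. A i) \<union> C n) = ?\<xi> (\<Union>i<n. A i) + ?\<xi> (C n)"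
        using A C by (intro finitely_additive_Un[OF add]) (auto simp: C_def)
      moreover have "(\<Union>i<n. A i) \<union> C n = (\<Union>i. A i)" by (auto simp: C_def)
      moreover have "?\<xi> (\<Union>i<n. A i) = (\<Sum>i<n. ?\<xi> (A i))"
        using A by (intro finitely_additive_UN[OF add]) (auto intro: disjoint_family_on_mono)
      ultimately show ?thesis by simp
    qed
    show "(\<lambda>i. ?\<xi> (A i)) sums ?\<xi> (\<Union>i. A i)"
      unfolding sums_def
    proof (rule tendstoI)
      fix e :: real assume e: "e > 0"
      define d where "d = e / (S + 1)"
      have d: "d > 0" "d * S < e" using e S by (auto simp: d_def field_simps)
      obtain \<delta> where \<delta>: "\<delta> > 0" "\<And>A t. A \<in> sets borel \<Longrightarrow> measure m A < \<delta> \<Longrightarrow> cmod (shift_integral f A t) < d"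
        using shift_integral_small[OF f d(1)] by blast
      have "\<forall>\<^sub>F n in sequentially. measure m (C n) < \<delta>"
        using lim \<delta>(1) by (rule order_tendstoD)
      then show "\<forall>\<^sub>F n in sequentially. dist (\<Sum>i<n. ?\<xi> (A i)) (?\<xi> (\<Union>i. A i)) < e"
      proof eventually_elim
        case (elim n)
        have "norm (?\<xi> (C n)) \<le> d * S"
          unfolding fun_convolution_eq S_def
          using \<delta>(2)[OF C elim]
          by (intro norm_vm_integral_le_semivariation[OF \<nu>] regulated_shift_integral f C) (auto intro: less_imp_le)
        then show ?case using d(2) split[of n] by (simp add: dist_norm)
      qed
    qed
  qed
qed

subsection \<open>Testing against simple functions\<close>

lemma borel_partitionsD:
  assumes "\<rho> \<in> borel_partitions"
  shows "finite \<rho>" "\<And>A. A \<in> \<rho> \<Longrightarrow> A \<in> sets borel"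
  using assms by (auto simp: borel_partitions_def)

lemma sum_fun_convolution:
  fixes \<nu> :: "'g set \<Rightarrow> 'x::complex_banach"
  assumes \<nu>: "vector_measure \<nu>" and f: "integrable m f" and \<rho>: "\<rho> \<in> borel_partitions"
  shows "(\<Sum>A\<in>\<rho>. \<alpha> A *\<^sub>C fun_convolution m f \<nu> A) = vm_integral \<nu> (\<lambda>t. \<Sum>A\<in>\<rho>. \<alpha> A * shift_integral f A t)"
  unfolding fun_convolution_eq
  by (rule vm_integral_sum[OF \<nu>, symmetric]) (rule regulated_shift_integral[OF f borel_partitionsD(2)[OF \<rho>]])

lemma regulated_sum_shift:
  assumes f: "integrable m f" and \<rho>: "\<rho> \<in> borel_partitions"
  shows "regulated (\<lambda>t. \<Sum>A\<in>\<rho>. \<alpha> A * shift_integral f A t)"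
  by (rule regulated_sum) (rule regulated_shift_integral[OF f borel_partitionsD(2)[OF \<rho>]])

lemma sum_shift_integral:
  fixes f :: "'g \<Rightarrow> complex"
  assumes f: "integrable m f" and \<rho>: "\<rho> \<in> borel_partitions"
  shows "(\<Sum>A\<in>\<rho>. \<alpha> A * shift_integral f A t) = (\<integral>s. (\<Sum>A\<in>\<rho>. \<alpha> A * indicator A (s + t)) * f s \<partial>m)"
proof -
  have eq: "(\<Sum>A\<in>\<rho>. \<alpha> A * indicator A (s + t)) * f s = (\<Sum>A\<in>\<rho>. \<alpha> A * (indicator A (s + t) *\<^sub>R f s))" for s
    by (simp add: sum_distrib_right scaleR_conv_of_real of_real_indicator mult.assoc)
  have "(\<integral>s. (\<Sum>A\<in>\<rho>. \<alpha> A * (indicator A (s + t) *\<^sub>R f s)) \<partial>m)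
      = (\<Sum>A\<in>\<rho>. (\<integral>s. \<alpha> A * (indicator A (s + t) *\<^sub>R f s) \<partial>m))"
    by (rule Bochner_Integration.integral_sum)
      (rule integrable_mult_right[OF integrable_shift[OF f borel_partitionsD(2)[OF \<rho>]]])
  then show ?thesis
    unfolding eq shift_integral_def integral_mult_right_zero ..
qed

lemma sum_indicator_measurable:
  assumes "\<rho> \<in> borel_partitions"
  shows "(\<lambda>s. \<Sum>A\<in>\<rho>. \<alpha> A * indicator A s :: complex) \<in> borel_measurable borel"
  using borel_partitionsD[OF assms]
  by (intro borel_measurable_sum borel_measurable_times borel_measurable_const borel_measurable_indicator)

lemma integrable_left_factor:
  fixes f :: "'g \<Rightarrow> complex"
  assumes f: "integrable m f" and \<rho>: "\<rho> \<in> borel_partitions"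
  shows "integrable m (\<lambda>s. (\<Sum>A\<in>\<rho>. \<alpha> A * indicator A s) * f s)"
proof -
  have eq: "(\<Sum>A\<in>\<rho>. \<alpha> A * indicator A s) * f s = (\<Sum>A\<in>\<rho>. \<alpha> A * (indicator A (s + 0) *\<^sub>R f s))" for s
    by (simp add: sum_distrib_right scaleR_conv_of_real of_real_indicator mult.assoc)
  show ?thesis unfolding eq
    by (intro Bochner_Integration.integrable_sum integrable_mult_right integrable_shift f borel_partitionsD(2)[OF \<rho>])
qed

lemma sum_shift_integral':
  fixes f :: "'g \<Rightarrow> complex"
  assumes f: "integrable m f" and \<rho>: "\<rho> \<in> borel_partitions"
  shows "(\<Sum>A\<in>\<rho>. \<alpha> A * shift_integral f A t) = (\<integral>s. (\<Sum>A\<in>\<rho>. \<alpha> A * indicator A s) * f (s - t) \<partial>m)"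
proof -
  have "f \<in> borel_measurable borel" using borel_measurable_integrable[OF f] by simp
  then have "(\<lambda>s. (\<Sum>A\<in>\<rho>. \<alpha> A * indicator A s) * f (s - t)) \<in> borel_measurable borel"
    by (intro borel_measurable_times sum_indicator_measurable[OF \<rho>] measurable_compose[OF translations_measurable(5)])
  from integral_right[OF this, of t] show ?thesis
    unfolding sum_shift_integral[OF f \<rho>] by simp
qed

lemma
  fixes f :: "'g \<Rightarrow> complex"
  assumes f: "f \<in> borel_measurable m" "integrable m (\<lambda>x. cmod (f x) powr p)"
  shows integrable_powr_right: "integrable m (\<lambda>s. cmod (f (s - t)) powr p)"
    and integral_powr_right: "(\<integral>s. cmod (f (s - t)) powr p \<partial>m) = (\<integral>s. cmod (f s) powr p \<partial>m)"
  using integrable_right[OF f(2), of "- t"] integral_right[of "\<lambda>x. cmod (f x) powr p" "- t"] f(1)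
  by auto

text \<open>Hoelder's inequality; by right invariance all translates of \<open>f\<close> have the same \<open>p\<close>-norm.\<close>

lemma norm_sum_shift_integral_le:
  fixes f :: "'g \<Rightarrow> complex"
  assumes f: "f \<in> borel_measurable m" "integrable m (\<lambda>x. cmod (f x) powr p)" and p: "1 \<le> p"
    and \<rho>: "\<rho> \<in> borel_partitions"
    and g: "Lp_norm (conjugate_exponent (ennreal p)) m (\<lambda>t. \<Sum>A\<in>\<rho>. \<alpha> A * indicator A t) \<le> 1"
  shows "cmod (\<Sum>A\<in>\<rho>. \<alpha> A * shift_integral f A t) \<le> (\<integral>x. cmod (f x) powr p \<partial>m) powr (1 / p)"
proof -
  have fi: "integrable m f" by (rule integrable_of_powr[OF finite_m f p])
  have fb: "f \<in> borel_measurable borel" using f(1) by simp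
  have "cmod (\<integral>s. (\<Sum>A\<in>\<rho>. \<alpha> A * indicator A s) * f (s - t) \<partial>m)
      \<le> (\<integral>s. cmod (f (s - t)) powr p \<partial>m) powr (1 / p)"
    using sum_indicator_measurable[OF \<rho>, of \<alpha>] measurable_compose[OF translations_measurable(5) fb, of t]
    by (intro pairing_le finite_m p g integrable_powr_right f) auto
  then show ?thesis
    unfolding sum_shift_integral'[OF fi \<rho>] integral_powr_right[OF f] .
qed

end

section \<open>Young's inequality\<close>

lemma partition_simple_function:
  fixes \<alpha> :: "'g::topological_space set \<Rightarrow> 'b::comm_semiring_1" and h :: "'b \<Rightarrow> 'c::comm_semiring_1"
  assumes \<rho>: "\<rho> \<in> borel_partitions"
  shows "h (\<Sum>A\<in>\<rho>. \<alpha> A * indicator A x) = (\<Sum>A\<in>\<rho>. h (\<alpha> A) * indicator A x)"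
proof -
  have fin: "finite \<rho>" and dj: "disjoint \<rho>" and un: "\<Union>\<rho> = UNIV"
    using \<rho> unfolding borel_partitions_def partition_on_def by simp_all
  obtain A where A: "A \<in> \<rho>" "x \<in> A"
    using UnionE[of x \<rho>] un by auto
  have ind: "indicator B x = (if B = A then 1 else 0)" if "B \<in> \<rho>" for B
    using disjointD[OF dj that A(1)] A(2) by (auto simp: indicator_def)
  have "(\<Sum>B\<in>\<rho>. \<alpha> B * indicator B x) = (\<Sum>B\<in>\<rho>. if B = A then \<alpha> B else 0)"
    by (rule sum.cong) (auto simp: ind)
  moreover have "(\<Sum>B\<in>\<rho>. h (\<alpha> B) * indicator B x) = (\<Sum>B\<in>\<rho>. if B = A then h (\<alpha> B) else 0)"
    by (rule sum.cong) (auto simp: ind)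
  ultimately show ?thesis using fin A(1) by simp
qed

context compact_haar
begin

text \<open>The averaging inequality for the measure with density \<open>F\<close>.\<close>

lemma nn_integral_shift_integral_le_compact:
  fixes F :: "'g \<Rightarrow> real"
  assumes F: "integrable m F" "\<And>x. F x \<ge> 0" and K: "compact K"
  shows "(\<integral>\<^sup>+t. ennreal (shift_integral F K t) \<partial>m) \<le> ennreal (\<integral>x. F x \<partial>m) * emeasure m K"
proof -
  have Kb: "K \<in> sets borel" by (rule compact_borel[OF K])
  have F' [measurable]: "F \<in> borel_measurable m" using F(1) by auto
  define n where "n = density m (\<lambda>x. ennreal (F x))"
  have em: "emeasure n ((\<lambda>y. y + t) -` A) = ennreal (shift_integral F A t)" if A: "A \<in> sets borel" for A t
  proof -
    have "emeasure n ((\<lambda>y. y + t) -` A) = (\<integral>\<^sup>+s. ennreal (F s) * indicator ((\<lambda>y. y + t) -` A) s \<partial>m)"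
      unfolding n_def using right_vimage_borel[OF A] by (subst emeasure_density) auto
    also have "\<dots> = (\<integral>\<^sup>+s. ennreal (indicator A (s + t) *\<^sub>R F s) \<partial>m)"
      by (intro nn_integral_cong) (auto simp: indicator_def)
    also have "\<dots> = ennreal (shift_integral F A t)"
      unfolding shift_integral_def using F(2)
      by (intro nn_integral_eq_integral integrable_shift F(1) A) (auto simp: indicator_def)
    finally show ?thesis .
  qed
  have nU: "emeasure n UNIV = ennreal (\<integral>x. F x \<partial>m)"
    using em[of UNIV 0] by (simp add: shift_integral_def)
  have "(\<integral>\<^sup>+t. emeasure n ((\<lambda>y. y + t) -` K) \<partial>m) \<le> emeasure n UNIV * emeasure m K"
  proof (rule nn_integral_translates_le_compact[OF _ _ K])
    show "sets n = sets borel" by (simp add: n_def)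
    show "finite_measure n"
      by (rule finite_measureI) (simp add: nU n_def[symmetric], simp add: n_def nU[unfolded n_def])
  qed
  then show ?thesis unfolding em[OF Kb] nU .
qed

text \<open>Inner regularity extends the inequality from compact sets, the error being small uniformly in \<open>t\<close>.\<close>

lemma nn_integral_shift_integral_le:
  fixes F :: "'g \<Rightarrow> real"
  assumes F: "integrable m F" "\<And>x. F x \<ge> 0" and A: "A \<in> sets borel"
  shows "(\<integral>\<^sup>+t. ennreal (shift_integral F A t) \<partial>m) \<le> ennreal (\<integral>x. F x \<partial>m) * emeasure m A"
proof (rule ennreal_le_epsilon)
  fix e :: real assume e: "e > 0"
  obtain \<delta> where \<delta>: "\<delta> > 0" "\<And>A t. A \<in> sets borel \<Longrightarrow> measure m A < \<delta> \<Longrightarrow> norm (shift_integral F A t) < e"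
    using shift_integral_small[OF F(1) e] by blast
  obtain K where K: "compact K" "K \<subseteq> A" "measure m A \<le> measure m K + \<delta> / 2"
    by (rule compact_inside[OF A, of "\<delta> / 2"]) (use \<delta>(1) in auto)
  have Kb: "K \<in> sets borel" by (rule compact_borel[OF K(1)])
  have diff: "measure m (A - K) < \<delta>"
    using K A Kb \<delta>(1) by (simp add: finite_measure_Diff)
  have nonneg: "shift_integral F K t \<ge> 0" for t
    unfolding shift_integral_def using F(2) by (intro integral_nonneg_AE) auto
  have "shift_integral F A t \<le> shift_integral F K t + e" for t
  proof -
    have "shift_integral F (K \<union> (A - K)) t = shift_integral F K t + shift_integral F (A - K) t"
      using A Kb by (intro finitely_additive_Un[OF finitely_additive_shift_integral[OF F(1)]]) auto
    moreover have "K \<union> (A - K) = A" using K(2) by auto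
    moreover have "norm (shift_integral F (A - K) t) < e" using A Kb diff by (intro \<delta>(2)) auto
    ultimately show ?thesis by simp
  qed
  then have "(\<integral>\<^sup>+t. ennreal (shift_integral F A t) \<partial>m) \<le> (\<integral>\<^sup>+t. ennreal (shift_integral F K t) + ennreal e \<partial>m)"
    using nonneg e by (intro nn_integral_mono) (simp add: ennreal_leI flip: ennreal_plus)
  also have "\<dots> = (\<integral>\<^sup>+t. ennreal (shift_integral F K t) \<partial>m) + ennreal e"
  proof (subst nn_integral_add)
    show "(\<lambda>t. ennreal (shift_integral F K t)) \<in> borel_measurable m"
      using borel_measurable_continuous_onI[OF continuous_shift_integral[OF F(1) Kb]] by simp
  qed auto
  also have "\<dots> \<le> ennreal (\<integral>x. F x \<partial>m) * emeasure m A + ennreal e"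
    using A K(2) by (intro add_right_mono order_trans[OF nn_integral_shift_integral_le_compact[OF F K(1)]]
      mult_left_mono emeasure_mono) auto
  finally show "(\<integral>\<^sup>+t. ennreal (shift_integral F A t) \<partial>m) \<le> ennreal (\<integral>x. F x \<partial>m) * emeasure m A + ennreal e" .
qed

text \<open>With \<open>g\<close> the simple function given by \<open>\<alpha>\<close>, the integrand \<open>\<bar>g\<bar> * \<bar>f\<bar>\<close> is split as
  \<open>(\<bar>g\<bar> powr R * \<bar>f\<bar> powr q) powr (1/P) * (\<bar>g\<bar> powr R) powr (1/R - 1/P) * (\<bar>f\<bar> powr q) powr (1/q - 1/P)\<close>.
  The relation between the exponents says that the three weights add up to one, and Hoelder's
  inequality leaves only the first factor depending on \<open>t\<close>.\<close>

lemma Young_pointwise: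
  fixes f :: "'g \<Rightarrow> complex"
  assumes f: "f \<in> borel_measurable m" "integrable m (\<lambda>x. cmod (f x) powr q)"
    and \<rho>: "\<rho> \<in> borel_partitions"
    and exponents: "1 \<le> R" "R \<le> P" "1 \<le> q" "q \<le> P" "1 / R + 1 / q = 1 + 1 / P"
    and g: "(\<integral>t. cmod (\<Sum>A\<in>\<rho>. \<alpha> A * indicator A t) powr R \<partial>m) \<le> 1"
  shows "cmod (\<Sum>A\<in>\<rho>. \<alpha> A * shift_integral f A t) powr P
    \<le> (\<integral>x. cmod (f x) powr q \<partial>m) powr (P / q - 1) *
       (\<Sum>A\<in>\<rho>. cmod (\<alpha> A) powr R * shift_integral (\<lambda>x. cmod (f x) powr q) A t)"
proof -
  define G where "G x = (\<Sum>A\<in>\<rho>. \<alpha> A * indicator A x)" for x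
  define F where "F x = cmod (f x) powr q" for x
  define N where "N = (\<integral>x. F x \<partial>m)"
  define J where "J = (\<Sum>A\<in>\<rho>. cmod (\<alpha> A) powr R * shift_integral F A t)"
  have fb: "f \<in> borel_measurable borel" using f(1) by simp
  have fi: "integrable m f" by (rule integrable_of_powr[OF finite_m f exponents(3)])
  have Fi: "integrable m F" using f(2) by (simp add: F_def[abs_def])
  have Gb [measurable]: "G \<in> borel_measurable borel"
    unfolding G_def by (rule sum_indicator_measurable[OF \<rho>])
  have GR: "cmod (G x) powr R = (\<Sum>A\<in>\<rho>. cmod (\<alpha> A) powr R * indicator A x)" for x
    unfolding G_def by (rule partition_simple_function[OF \<rho>, of "\<lambda>z. cmod z powr R"])
  have pos: "0 < R" "0 < P" "0 < q" using exponents by auto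
  have eqF: "cmod (G (s + t)) powr R * F s = (\<Sum>A\<in>\<rho>. cmod (\<alpha> A) powr R * (indicator A (s + t) *\<^sub>R F s))" for s
    by (simp add: GR sum_distrib_right mult.assoc)
  have iJ: "integrable m (\<lambda>s. cmod (G (s + t)) powr R * F s)"
    unfolding eqF
    by (intro Bochner_Integration.integrable_sum integrable_mult_right integrable_shift Fi borel_partitionsD(2)[OF \<rho>])
  have J: "(\<integral>s. cmod (G (s + t)) powr R * F s \<partial>m) = J"
  proof -
    have "(\<integral>s. (\<Sum>A\<in>\<rho>. cmod (\<alpha> A) powr R * (indicator A (s + t) *\<^sub>R F s)) \<partial>m)
        = (\<Sum>A\<in>\<rho>. (\<integral>s. cmod (\<alpha> A) powr R * (indicator A (s + t) *\<^sub>R F s) \<partial>m))"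
      by (rule Bochner_Integration.integral_sum)
        (rule integrable_mult_right[OF integrable_shift[OF Fi borel_partitionsD(2)[OF \<rho>]]])
    then show ?thesis
      unfolding eqF J_def shift_integral_def integral_mult_right_zero .
  qed
  have iG: "integrable m (\<lambda>x. cmod (G x) powr R)"
    unfolding GR using borel_partitionsD[OF \<rho>]
    by (intro Bochner_Integration.integrable_sum integrable_mult_right integrable_real_indicator)
      (auto simp: emeasure_eq_measure)
  have iGt: "integrable m (\<lambda>s. cmod (G (s + t)) powr R)"
    using integrable_right[OF iG] by simp
  have IG: "(\<integral>s. cmod (G (s + t)) powr R \<partial>m) \<le> 1"
    using g integral_right[of "\<lambda>x. cmod (G x) powr R" t] by (simp add: G_def[symmetric])
  have beta: "0 \<le> 1 / R - 1 / P" and gamma: "0 \<le> 1 / q - 1 / P"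
    using exponents pos by (auto simp: frac_le)
  have eq: "cmod (G (s + t) * f s) = (cmod (G (s + t)) powr R * F s) powr (1 / P) *
      (cmod (G (s + t)) powr R) powr (1 / R - 1 / P) * F s powr (1 / q - 1 / P)" for s
  proof -
    have "R / P + R * (1 / R - 1 / P) = 1" "q / P + q * (1 / q - 1 / P) = 1"
      using pos by (auto simp: field_simps)
    moreover have "x powr (R / P) * x powr (R * (1 / R - 1 / P)) = x powr (R / P + R * (1 / R - 1 / P))"
      "x powr (q / P) * x powr (q * (1 / q - 1 / P)) = x powr (q / P + q * (1 / q - 1 / P))" for x :: real
      by (auto simp: powr_add)
    ultimately have *: "x powr (R / P) * x powr (R * (1 / R - 1 / P)) = x"
      "x powr (q / P) * x powr (q * (1 / q - 1 / P)) = x" if "x \<ge> 0" for x :: real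
      using that by auto
    have "(cmod (G (s + t)) powr R * F s) powr (1 / P) *
      (cmod (G (s + t)) powr R) powr (1 / R - 1 / P) * F s powr (1 / q - 1 / P)
      = (cmod (G (s + t)) powr (R / P) * cmod (G (s + t)) powr (R * (1 / R - 1 / P))) *
        (cmod (f s) powr (q / P) * cmod (f s) powr (q * (1 / q - 1 / P)))"
      by (simp add: F_def powr_mult powr_powr mult_ac)
    also have "\<dots> = cmod (G (s + t) * f s)"
      by (simp only: * norm_ge_zero norm_mult)
    finally show ?thesis ..
  qed
  have J0: "J \<ge> 0" unfolding J[symmetric] by (intro integral_nonneg_AE) (auto simp: F_def)
  have N0: "N \<ge> 0" unfolding N_def by (intro integral_nonneg_AE) (auto simp: F_def)
  have "(\<Sum>A\<in>\<rho>. \<alpha> A * shift_integral f A t) = (\<integral>s. G (s + t) * f s \<partial>m)"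
    unfolding sum_shift_integral[OF fi \<rho>] G_def ..
  then have "cmod (\<Sum>A\<in>\<rho>. \<alpha> A * shift_integral f A t) \<le> (\<integral>s. cmod (G (s + t) * f s) \<partial>m)"
    using integral_norm_bound[of m "\<lambda>s. G (s + t) * f s"] by simp
  also have "\<dots> \<le> (\<integral>s. cmod (G (s + t)) powr R * F s \<partial>m) powr (1 / P) *
      (\<integral>s. cmod (G (s + t)) powr R \<partial>m) powr (1 / R - 1 / P) * (\<integral>s. F s \<partial>m) powr (1 / q - 1 / P)"
    unfolding eq using exponents pos beta gamma
    by (intro Hoelder3 iJ iGt Fi) (auto simp: F_def)
  also have "\<dots> \<le> J powr (1 / P) * 1 * N powr (1 / q - 1 / P)"
    unfolding J N_def using IG beta by (intro mult_right_mono mult_left_mono powr_le1) (auto simp: integral_nonneg_AE)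
  finally have "cmod (\<Sum>A\<in>\<rho>. \<alpha> A * shift_integral f A t) powr P \<le> (J powr (1 / P) * 1 * N powr (1 / q - 1 / P)) powr P"
    using pos by (intro powr_mono2) auto
  also have "\<dots> = (J powr (1 / P)) powr P * (N powr (1 / q - 1 / P)) powr P"
    by (simp add: powr_mult)
  also have "\<dots> = N powr (P / q - 1) * J"
  proof -
    have "(1 / q - 1 / P) * P = P / q - 1" using pos by (simp add: field_simps)
    then show ?thesis using J0 pos by (simp add: powr_powr)
  qed
  finally show ?thesis unfolding J_def N_def F_def .
qed

text \<open>Integrate the pointwise estimate over \<open>t\<close> and interchange the integrations in its last factor by the
  averaging inequality.\<close>

lemma Young:
  fixes f :: "'g \<Rightarrow> complex"
  assumes f: "f \<in> borel_measurable m" "integrable m (\<lambda>x. cmod (f x) powr q)"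
    and \<rho>: "\<rho> \<in> borel_partitions"
    and exponents: "1 \<le> R" "R \<le> P" "1 \<le> q" "q \<le> P" "1 / R + 1 / q = 1 + 1 / P"
    and g: "(\<integral>t. cmod (\<Sum>A\<in>\<rho>. \<alpha> A * indicator A t) powr R \<partial>m) \<le> 1"
  shows "(\<integral>\<^sup>+t. ennreal (cmod (\<Sum>A\<in>\<rho>. \<alpha> A * shift_integral f A t) powr P) \<partial>m)
    \<le> ennreal (((\<integral>x. cmod (f x) powr q \<partial>m) powr (1 / q)) powr P)"
proof -
  define F where "F x = cmod (f x) powr q" for x
  define N where "N = (\<integral>x. F x \<partial>m)"
  note \<rho>D = borel_partitionsD[OF \<rho>]
  have F: "integrable m F" "\<And>x. F x \<ge> 0" using f(2) by (auto simp: F_def[abs_def])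
  have N0: "N \<ge> 0" unfolding N_def by (intro integral_nonneg_AE) (auto simp: F_def)
  have nonneg: "shift_integral F A t \<ge> 0" for A t
    unfolding shift_integral_def using F(2) by (intro integral_nonneg_AE) auto
  have meas: "(\<lambda>t. ennreal (shift_integral F A t)) \<in> borel_measurable m" if "A \<in> \<rho>" for A
    using borel_measurable_continuous_onI[OF continuous_shift_integral[OF F(1) \<rho>D(2)[OF that]]] by simp
  have gm: "(\<integral>t. cmod (\<Sum>A\<in>\<rho>. \<alpha> A * indicator A t) powr R \<partial>m) = (\<Sum>A\<in>\<rho>. cmod (\<alpha> A) powr R * measure m A)"
  proof -
    have "(\<integral>t. (\<Sum>A\<in>\<rho>. cmod (\<alpha> A) powr R * indicator A t) \<partial>m)
        = (\<Sum>A\<in>\<rho>. (\<integral>t. cmod (\<alpha> A) powr R * indicator A t \<partial>m))"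
      using \<rho>D(2) by (intro Bochner_Integration.integral_sum integrable_mult_right integrable_real_indicator)
        (auto simp: emeasure_eq_measure)
    then show ?thesis
      unfolding partition_simple_function[OF \<rho>, of "\<lambda>z. cmod z powr R"] by simp
  qed
  have "(\<integral>\<^sup>+t. ennreal (cmod (\<Sum>A\<in>\<rho>. \<alpha> A * shift_integral f A t) powr P) \<partial>m)
      \<le> (\<integral>\<^sup>+t. ennreal (N powr (P / q - 1)) * (\<Sum>A\<in>\<rho>. ennreal (cmod (\<alpha> A) powr R) * ennreal (shift_integral F A t)) \<partial>m)"
  proof (rule nn_integral_mono)
    fix t
    have "ennreal (N powr (P / q - 1)) * (\<Sum>A\<in>\<rho>. ennreal (cmod (\<alpha> A) powr R) * ennreal (shift_integral F A t))
        = ennreal (N powr (P / q - 1) * (\<Sum>A\<in>\<rho>. cmod (\<alpha> A) powr R * shift_integral F A t))"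
      using nonneg by (simp add: ennreal_mult sum_nonneg flip: sum_ennreal)
    then show "ennreal (cmod (\<Sum>A\<in>\<rho>. \<alpha> A * shift_integral f A t) powr P)
        \<le> ennreal (N powr (P / q - 1)) * (\<Sum>A\<in>\<rho>. ennreal (cmod (\<alpha> A) powr R) * ennreal (shift_integral F A t))"
      using ennreal_leI[OF Young_pointwise[OF f \<rho> exponents g, of t]]
      unfolding N_def F_def[abs_def] by simp
  qed
  also have "\<dots> = ennreal (N powr (P / q - 1)) *
      (\<Sum>A\<in>\<rho>. ennreal (cmod (\<alpha> A) powr R) * (\<integral>\<^sup>+t. ennreal (shift_integral F A t) \<partial>m))"
    using meas by (simp add: nn_integral_cmult nn_integral_sum borel_measurable_sum)
  also have "\<dots> \<le> ennreal (N powr (P / q - 1)) *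
      (\<Sum>A\<in>\<rho>. ennreal (cmod (\<alpha> A) powr R) * (ennreal N * emeasure m A))"
    unfolding N_def by (intro mult_left_mono sum_mono nn_integral_shift_integral_le F \<rho>D) auto
  also have "\<dots> = ennreal (N powr (P / q - 1) * (N * (\<Sum>A\<in>\<rho>. cmod (\<alpha> A) powr R * measure m A)))"
    using N0 by (simp add: emeasure_eq_measure sum_distrib_left mult_ac sum_nonneg flip: ennreal_mult' sum_ennreal ennreal_mult)
  also have "\<dots> \<le> ennreal (N powr (P / q - 1) * (N * 1))"
    using g N0 unfolding gm by (intro ennreal_leI mult_left_mono) auto
  also have "N powr (P / q - 1) * (N * 1) = (N powr (1 / q)) powr P"
  proof -
    have "N powr (P / q - 1) * N powr 1 = N powr (P / q)"
      unfolding powr_add[symmetric] by simp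
    then show ?thesis using N0 by (simp add: powr_powr)
  qed
  finally show ?thesis unfolding N_def F_def .
qed

end

section \<open>Approximation by simple densities\<close>

lemma simple_density_add:
  fixes M :: "'g::topological_space measure" and u v :: "'g \<Rightarrow> 'x::complex_banach"
  assumes M: "sets M = sets borel" "finite_measure M"
    and u: "simple_function borel u" and v: "simple_function borel v" and A: "A \<in> sets borel"
  shows "simple_density M (\<lambda>t. u t + v t) A = simple_density M u A + simple_density M v A"
proof -
  note comp = simple_density_comp[OF M simple_function_Pair[OF u v] A]
  show ?thesis
    using comp[of "\<lambda>y. fst y + snd y"] comp[of fst] comp[of snd] by (simp add: scaleR_add_right sum.distrib)
qed

lemma integral_simple_function:
  fixes k :: "'g::topological_space \<Rightarrow> complex"
  assumes M: "sets M = sets borel" "finite_measure M" and k: "simple_function borel k" and A: "A \<in> sets borel"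
  shows "(\<integral>s. indicator A s *\<^sub>R k s \<partial>M) = (\<Sum>y\<in>range k. measure M (A \<inter> k -` {y}) *\<^sub>R y)"
proof -
  interpret finite_measure M by (rule M(2))
  have sets: "A \<inter> k -` {y} \<in> sets M" for y using A fibre_in_borel[OF k] M(1) by simp
  have "indicator A s *\<^sub>R k s = (\<Sum>y\<in>range k. indicator (A \<inter> k -` {y}) s *\<^sub>R y)" for s
  proof -
    have "(\<Sum>y\<in>range k. indicator (A \<inter> k -` {y}) s *\<^sub>R y)
        = (\<Sum>y\<in>range k. if y = k s then indicator A s *\<^sub>R k s else 0)"
      by (intro sum.cong) (auto simp: indicator_def)
    then show ?thesis using finite_range_simple[OF k] by simp
  qed
  then have "(\<integral>s. indicator A s *\<^sub>R k s \<partial>M) = (\<integral>s. (\<Sum>y\<in>range k. indicator (A \<inter> k -` {y}) s *\<^sub>R y) \<partial>M)"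
    by simp
  also have "\<dots> = (\<Sum>y\<in>range k. (\<integral>s. indicator (A \<inter> k -` {y}) s *\<^sub>R y \<partial>M))"
    using sets by (intro Bochner_Integration.integral_sum integrable_scaleR_left integrable_real_indicator)
      (auto simp: emeasure_eq_measure)
  also have "\<dots> = (\<Sum>y\<in>range k. measure M (A \<inter> k -` {y}) *\<^sub>R y)"
  proof (rule sum.cong[OF refl])
    fix y
    have "integrable M (\<lambda>s. indicator (A \<inter> k -` {y}) s :: real)"
      using sets by (intro integrable_real_indicator) (auto simp: emeasure_eq_measure)
    then have "(\<integral>s. indicator (A \<inter> k -` {y}) s *\<^sub>R y \<partial>M) = (\<integral>s. indicator (A \<inter> k -` {y}) s \<partial>M) *\<^sub>R y"
      by (rule integral_scaleR_left)
    also have "(\<integral>s. indicator (A \<inter> k -` {y}) s \<partial>M) = measure M (A \<inter> k -` {y})"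
      using sets.sets_into_space[OF sets] by (simp add: Int_absorb2)
    finally show "(\<integral>s. indicator (A \<inter> k -` {y}) s *\<^sub>R y \<partial>M) = measure M (A \<inter> k -` {y}) *\<^sub>R y" .
  qed
  finally show ?thesis .
qed

lemma simple_density_scaleC:
  fixes k :: "'g::topological_space \<Rightarrow> complex" and x :: "'x::complex_banach"
  assumes M: "sets M = sets borel" "finite_measure M" and k: "simple_function borel k" and A: "A \<in> sets borel"
  shows "simple_density M (\<lambda>s. k s *\<^sub>C x) A = (\<integral>s. indicator A s *\<^sub>R k s \<partial>M) *\<^sub>C x"
  unfolding simple_density_comp[OF M k A, of "\<lambda>y. y *\<^sub>C x"] integral_simple_function[OF M k A] scaleC_sum_left
  by (simp add: scaleR_conv_scaleC scaleC_scaleC scaleR_conv_of_real)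

lemma simple_function_scaleC:
  "simple_function borel k \<Longrightarrow> simple_function borel (\<lambda>s. k s *\<^sub>C (x::'x::complex_banach))"
  by (rule simple_function_compose1)

lemma
  fixes k :: "'i \<Rightarrow> 'g::topological_space \<Rightarrow> complex" and x :: "'i \<Rightarrow> 'x::complex_banach"
  assumes M: "sets M = sets borel" "finite_measure M" and k: "\<And>i. i \<in> I \<Longrightarrow> simple_function borel (k i)"
    and I: "finite I"
  shows simple_function_sum_scaleC: "simple_function borel (\<lambda>s. \<Sum>i\<in>I. k i s *\<^sub>C x i)"
    and simple_density_sum_scaleC: "A \<in> sets borel \<Longrightarrow>
      simple_density M (\<lambda>s. \<Sum>i\<in>I. k i s *\<^sub>C x i) A = (\<Sum>i\<in>I. (\<integral>s. indicator A s *\<^sub>R k i s \<partial>M) *\<^sub>C x i)"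
proof -
  have "simple_function borel (\<lambda>s. \<Sum>i\<in>I. k i s *\<^sub>C x i) \<and> (A \<in> sets borel \<longrightarrow>
      simple_density M (\<lambda>s. \<Sum>i\<in>I. k i s *\<^sub>C x i) A = (\<Sum>i\<in>I. (\<integral>s. indicator A s *\<^sub>R k i s \<partial>M) *\<^sub>C x i))" for A
    using I k
  proof (induction I rule: finite_induct)
    case empty
    then show ?case by (simp add: simple_density_def)
  next
    case (insert j I)
    have j: "simple_function borel (\<lambda>s. k j s *\<^sub>C x j)"
      using insert.prems by (intro simple_function_scaleC) auto
    have IH: "simple_function borel (\<lambda>s. \<Sum>i\<in>I. k i s *\<^sub>C x i)"
      "A \<in> sets borel \<Longrightarrow> simple_density M (\<lambda>s. \<Sum>i\<in>I. k i s *\<^sub>C x i) A = (\<Sum>i\<in>I. (\<integral>s. indicator A s *\<^sub>R k i s \<partial>M) *\<^sub>C x i)"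
      using insert by auto
    show ?case
      using insert.hyps simple_function_compose1[OF simple_function_Pair[OF j IH(1)], of "\<lambda>y. fst y + snd y"]
        simple_density_add[OF M j IH(1), of A] IH(2) simple_density_scaleC[OF M, of "k j" A "x j"] insert.prems
      by simp
  qed
  then show "simple_function borel (\<lambda>s. \<Sum>i\<in>I. k i s *\<^sub>C x i)"
    "A \<in> sets borel \<Longrightarrow> simple_density M (\<lambda>s. \<Sum>i\<in>I. k i s *\<^sub>C x i) A = (\<Sum>i\<in>I. (\<integral>s. indicator A s *\<^sub>R k i s \<partial>M) *\<^sub>C x i)"
    by auto
qed

lemma p_semivariation_leI:
  fixes \<nu> :: "'g::topological_space set \<Rightarrow> 'x::complex_banach"
  assumes "\<And>\<rho> \<alpha>. \<rho> \<in> borel_partitions \<Longrightarrow>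
      Lp_norm (conjugate_exponent (ennreal r)) M (\<lambda>t. \<Sum>A\<in>\<rho>. \<alpha> A * indicator A t) \<le> 1 \<Longrightarrow>
      norm (\<Sum>A\<in>\<rho>. \<alpha> A *\<^sub>C \<nu> A) \<le> B"
  shows "p_semivariation (ennreal r) M \<nu> \<le> ennreal B"
  unfolding p_semivariation_def if_not_P[OF ennreal_neq_top, folded infinity_ennreal_def]
  by (rule SUP_least) (use assms in \<open>auto intro: ennreal_leI\<close>)

context compact_haar
begin

lemma shift_integral_diff:
  assumes "integrable m f" "integrable m g" "A \<in> sets borel"
  shows "shift_integral (\<lambda>x. f x - g x) A t = shift_integral f A t - shift_integral g A t"
  unfolding shift_integral_def scaleR_diff_right
  by (intro Bochner_Integration.integral_diff integrable_shift assms)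

text \<open>Two translates of a simple function differ only on symmetric differences of translates of its
  fibres, which have small measure when the translations are close. As \<open>f\<close> is bounded, the \<open>r\<close>-th
  mean of the difference is small as well, and finitely many translations suffice by compactness.\<close>

lemma simple_translates_approx:
  fixes f :: "'g \<Rightarrow> complex"
  assumes f: "simple_function borel f" and r: "r \<ge> 1" and e: "e > 0"
  shows "\<exists>c. simple_function borel c \<and>
    (\<forall>t. integrable m (\<lambda>s. cmod (f (s - t) - f (s - c t)) powr r) \<and>
         (\<integral>s. cmod (f (s - t) - f (s - c t)) powr r \<partial>m) \<le> e)"
proof -
  note fin = finite_range_simple[OF f]
  obtain B where "\<forall>z\<in>range f. cmod z \<le> B"
    using finite_imp_bounded[OF fin] unfolding bounded_iff by blast
  then have B: "cmod (f s) \<le> B" for s by blast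
  define D where "D = (2 * (B + 1)) powr r"
  define d where "d = e / (D * card (range f))"
  have B0: "B \<ge> 0" using B[of undefined] norm_ge_zero[of "f undefined"] by linarith
  have D: "D > 0" using B0 by (simp add: D_def)
  have card: "card (range f) > 0" using fin by (simp add: card_gt_0_iff)
  have d: "d > 0" "D * (card (range f) * d) = e"
    using D card e by (auto simp: d_def)
  have "\<exists>V. open V \<and> 0 \<in> V \<and> (\<forall>v\<in>V. measure m {s. (s + v \<in> f -` {y}) \<noteq> (s \<in> f -` {y})} < d)" for y
    by (rule translation_continuous_zero[OF fibre_in_borel[OF f] d(1)])
  then obtain V where V: "\<And>y. open (V y)" "\<And>y. 0 \<in> V y"
    "\<And>y v. v \<in> V y \<Longrightarrow> measure m {s. (s + v \<in> f -` {y}) \<noteq> (s \<in> f -` {y})} < d"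
    by metis
  define W where "W = (\<Inter>y\<in>range f. V y)"
  have W: "open W" "0 \<in> W"
    unfolding W_def using V fin by (intro open_INT ballI, auto)
  have "\<exists>c. simple_function borel c \<and> (\<forall>t. t \<in> (\<lambda>u. c t - u) -` W)"
  proof (rule compact_simple_selection[OF compact_UNIV, where U="\<lambda>x. (\<lambda>u. x - u) -` W"])
    show "open ((\<lambda>u. x - u) -` W)" for x
      by (rule open_vimage[OF W(1) translations_continuous(4)])
  qed (use W(2) in auto)
  then obtain c where c: "simple_function borel c" "\<And>t. c t - t \<in> W" by auto
  have "integrable m (\<lambda>s. cmod (f (s - t) - f (s - c t)) powr r) \<and>
         (\<integral>s. cmod (f (s - t) - f (s - c t)) powr r \<partial>m) \<le> e" for t
  proof -
    define Z where "Z y = {s. (s + - t \<in> f -` {y}) \<noteq> (s + - c t \<in> f -` {y})}" for y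
    have Z: "Z y \<in> sets borel" for y
      unfolding Z_def by (rule symmetric_difference_borel[OF fibre_in_borel[OF f]])
    have mZ: "measure m (Z y) < d" if "y \<in> range f" for y
    proof -
      have "- (- c t) + - t \<in> V y" using c(2)[of t] that by (auto simp: W_def)
      then show ?thesis
        unfolding Z_def measure_symmetric_difference[OF fibre_in_borel[OF f]] by (rule V(3))
    qed
    let ?Z = "\<Union>y\<in>range f. Z y"
    have Zs: "?Z \<in> sets borel" by (intro sets.finite_UN fin Z)
    have fb: "f \<in> borel_measurable borel" using f by (rule borel_measurable_simple_function)
    have meas: "(\<lambda>s. f (s - u)) \<in> borel_measurable m" for u
      using measurable_compose[OF translations_measurable(5) fb, of u] by simp
    have iZ: "integrable m (\<lambda>s. D * indicator ?Z s)"
      using Zs by (intro integrable_mult_right integrable_real_indicator) (auto simp: emeasure_eq_measure)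
    have le: "cmod (f (s - t) - f (s - c t)) powr r \<le> D * indicator ?Z s" for s
    proof (cases "f (s - t) = f (s - c t)")
      case True
      then show ?thesis using D by simp
    next
      case False
      then have "s \<in> Z (f (s - t))" by (simp add: Z_def)
      then have "s \<in> ?Z" by blast
      have "cmod (f (s - t) - f (s - c t)) \<le> 2 * (B + 1)"
        by (rule order_trans[OF norm_triangle_ineq4 order_trans[OF add_mono[OF B B]]]) simp
      then have "cmod (f (s - t) - f (s - c t)) powr r \<le> D"
        unfolding D_def using r by (intro powr_mono2) auto
      then show ?thesis using \<open>s \<in> ?Z\<close> by simp
    qed
    have int: "integrable m (\<lambda>s. cmod (f (s - t) - f (s - c t)) powr r)"
    proof (rule Bochner_Integration.integrable_bound[OF iZ])
      show "(\<lambda>s. cmod (f (s - t) - f (s - c t)) powr r) \<in> borel_measurable m"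
        using borel_measurable_diff[OF meas[of t] meas[of "c t"]] by measurable
      show "AE s in m. norm (cmod (f (s - t) - f (s - c t)) powr r) \<le> norm (D * indicator ?Z s)"
        using le by (intro AE_I2) (auto intro: order_trans[OF _ abs_ge_self])
    qed
    have "(\<integral>s. cmod (f (s - t) - f (s - c t)) powr r \<partial>m) \<le> (\<integral>s. D * indicator ?Z s \<partial>m)"
      by (rule integral_mono[OF int iZ le])
    also have "\<dots> = D * measure m ?Z" using Zs by simp
    also have "\<dots> \<le> D * (\<Sum>y\<in>range f. measure m (Z y))"
      using Z fin D by (intro mult_left_mono finite_measure_subadditive_finite) auto
    also have "\<dots> \<le> D * (card (range f) * d)"
      using mZ D by (intro mult_left_mono sum_bounded_above) (auto intro: less_imp_le)
    also have "\<dots> = e" by (rule d(2))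
    finally show ?thesis using int by simp
  qed
  then show ?thesis using c(1) by blast
qed

text \<open>The assumed bound on the scalar integrands is the \<open>r\<close>-semivariation estimate. It also allows \<open>f\<close> to be
  replaced by a simple \<open>f0\<close>, for which the continuous integrand is then approximated by finitely many
  of its values. This turns the integral against \<open>\<nu>\<close> into a finite sum of translates of \<open>f0\<close> with
  coefficients in \<open>X\<close>, the density \<open>\<phi>\<close>. The second step is controlled by the semivariation of \<open>\<nu>\<close>,
  which is finite for every vector measure.\<close>

lemma fun_convolution_in_P_space:
  fixes \<nu> :: "'g set \<Rightarrow> 'x::complex_banach" and f :: "'g \<Rightarrow> complex"
  assumes \<nu>: "vector_measure \<nu>" and r: "1 \<le> r" and q: "1 \<le> q" and V: "V \<ge> 0"
    and bound: "\<And>f \<rho> \<alpha>. f \<in> borel_measurable m \<Longrightarrow> integrable m (\<lambda>x. cmod (f x) powr q) \<Longrightarrow>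
      \<rho> \<in> borel_partitions \<Longrightarrow>
      Lp_norm (conjugate_exponent (ennreal r)) m (\<lambda>t. \<Sum>A\<in>\<rho>. \<alpha> A * indicator A t) \<le> 1 \<Longrightarrow>
      norm (vm_integral \<nu> (\<lambda>t. \<Sum>A\<in>\<rho>. \<alpha> A * shift_integral f A t))
        \<le> (\<integral>x. cmod (f x) powr q \<partial>m) powr (1 / q) * V"
    and f: "f \<in> borel_measurable m" "integrable m (\<lambda>x. cmod (f x) powr q)"
  shows "fun_convolution m f \<nu> \<in> P_space (ennreal r) m"
    and "p_semivariation (ennreal r) m (fun_convolution m f \<nu>)
      \<le> ennreal ((\<integral>x. cmod (f x) powr q \<partial>m) powr (1 / q) * V)"
proof -
  have fi: "integrable m f" by (rule integrable_of_powr[OF finite_m f q])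
  show le: "p_semivariation (ennreal r) m (fun_convolution m f \<nu>)
      \<le> ennreal ((\<integral>x. cmod (f x) powr q \<partial>m) powr (1 / q) * V)"
    by (rule p_semivariation_leI) (simp only: sum_fun_convolution[OF \<nu> fi] bound[OF f])
  have "p_semivariation (ennreal r) m (fun_convolution m f \<nu>) < \<infinity>"
    by (rule order_le_less_trans[OF le]) simp
  then have M: "fun_convolution m f \<nu> \<in> M_space (ennreal r) m"
    using vector_measure_fun_convolution[OF \<nu> fi] by (simp add: M_space_def)
  have approx: "\<exists>\<phi>. simple_function borel \<phi> \<and>
      p_semivariation (ennreal r) m (\<lambda>A. fun_convolution m f \<nu> A - simple_density m \<phi> A) \<le> ennreal e"
    if e: "e > 0" for e
  proof -
    define S where "S = enn2real (semivariation \<nu>)"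
    have S: "S \<ge> 0" by (simp add: S_def)
    define d where "d = e / (2 * (V + 1))"
    define d' where "d' = e / (2 * (S + 1))"
    have d: "d > 0" "d * V \<le> e / 2" using e V by (auto simp: d_def field_simps)
    have d': "d' > 0" "d' * S \<le> e / 2" using e S by (auto simp: d'_def field_simps)
    obtain f0 where f0: "simple_function m f0" "integrable m (\<lambda>x. cmod (f x - f0 x) powr q)"
      "(\<integral>x. cmod (f x - f0 x) powr q \<partial>m) < d powr q"
      using simple_dense_powr[OF f q, of "d powr q"] d(1) by auto
    have f0': "simple_function borel f0"
      using f0(1) by (simp add: simple_function_def)
    have f0m: "f0 \<in> borel_measurable m" by (rule borel_measurable_simple_function[OF f0(1)])
    have fd: "(\<lambda>x. f x - f0 x) \<in> borel_measurable m" using f(1) f0m by simp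
    have fdi: "integrable m (\<lambda>x. f x - f0 x)" by (rule integrable_of_powr[OF finite_m fd f0(2) q])
    have f0i: "integrable m f0"
      using Bochner_Integration.integrable_diff[OF fi fdi] by simp
    obtain c where c: "simple_function borel c"
      and ci: "\<And>t. integrable m (\<lambda>s. cmod (f0 (s - t) - f0 (s - c t)) powr r)"
      and ce: "\<And>t. (\<integral>s. cmod (f0 (s - t) - f0 (s - c t)) powr r \<partial>m) \<le> d' powr r"
      using simple_translates_approx[OF f0' r, of "d' powr r"] d'(1) by auto
    define \<phi> where "\<phi> s = (\<Sum>x\<in>range c. f0 (s - x) *\<^sub>C \<nu> (c -` {x}))" for s
    have f0t: "simple_function borel (\<lambda>s. f0 (s - x))" for x
      by (rule simple_function_comp[OF translations_measurable(5) f0'])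
    have \<phi>: "simple_function borel \<phi>"
      unfolding \<phi>_def using f0t finite_range_simple[OF c]
      by (intro simple_function_sum_scaleC[OF sets_m finite_m])
    \<comment> \<open>on sets, \<open>\<phi>\<close> amounts to freezing \<open>t\<close> at the representative \<open>c t\<close> in the integrand\<close>
    have density: "simple_density m \<phi> A = vm_integral \<nu> (\<lambda>t. shift_integral f0 A (c t))"
      if A: "A \<in> sets borel" for A
    proof -
      have "(\<integral>s. indicator A s *\<^sub>R f0 (s - x) \<partial>m) = shift_integral f0 A x" for x
      proof -
        have "(\<lambda>s. indicator A s *\<^sub>R f0 (s - x)) \<in> borel_measurable borel"
          using A borel_measurable_simple_function[OF f0t] by (intro borel_measurable_scaleR) auto
        from integral_right[OF this, of x] show ?thesis
          by (simp add: shift_integral_def)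
      qed
      then have "simple_density m \<phi> A = (\<Sum>x\<in>range c. shift_integral f0 A x *\<^sub>C \<nu> (c -` {x}))"
        unfolding \<phi>_def
        using simple_density_sum_scaleC[OF sets_m finite_m, of "range c" "\<lambda>x s. f0 (s - x)" A "\<lambda>x. \<nu> (c -` {x})"]
          f0t finite_range_simple[OF c] A by simp
      also have "\<dots> = simple_vm_integral \<nu> (\<lambda>t. shift_integral f0 A (c t))"
        by (rule simple_vm_integral_comp[OF vector_measure_finitely_additive[OF \<nu>] c, symmetric])
      also have "\<dots> = vm_integral \<nu> (\<lambda>t. shift_integral f0 A (c t))"
        by (rule vm_integral_simple[OF \<nu> simple_function_compose1[OF c], symmetric])
      finally show ?thesis .
    qed
    have "p_semivariation (ennreal r) m (\<lambda>A. fun_convolution m f \<nu> A - simple_density m \<phi> A) \<le> ennreal e"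
    proof (rule p_semivariation_leI)
      fix \<rho> and \<alpha> :: "'g set \<Rightarrow> complex"
      assume \<rho>: "\<rho> \<in> borel_partitions"
        and g: "Lp_norm (conjugate_exponent (ennreal r)) m (\<lambda>t. \<Sum>A\<in>\<rho>. \<alpha> A * indicator A t) \<le> 1"
      define H where "H f t = (\<Sum>A\<in>\<rho>. \<alpha> A * shift_integral f A t)" for f t
      have reg: "regulated (H f)" if "integrable m f" for f
        unfolding H_def using that \<rho> by (rule regulated_sum_shift)
      have regc: "regulated (\<lambda>t. H f0 (c t))"
        by (rule regulated_simple[OF simple_function_compose1[OF c]])
      have "(\<Sum>A\<in>\<rho>. \<alpha> A *\<^sub>C (fun_convolution m f \<nu> A - simple_density m \<phi> A))
          = vm_integral \<nu> (H f) - (\<Sum>A\<in>\<rho>. \<alpha> A *\<^sub>C vm_integral \<nu> (\<lambda>t. shift_integral f0 A (c t)))"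
        using density borel_partitionsD(2)[OF \<rho>]
        by (simp add: scaleC_diff_right sum_subtractf sum_fun_convolution[OF \<nu> fi \<rho>] H_def[abs_def])
      also have "(\<Sum>A\<in>\<rho>. \<alpha> A *\<^sub>C vm_integral \<nu> (\<lambda>t. shift_integral f0 A (c t))) = vm_integral \<nu> (\<lambda>t. H f0 (c t))"
        unfolding H_def
        by (rule vm_integral_sum[OF \<nu>, symmetric]) (rule regulated_simple[OF simple_function_compose1[OF c]])
      also have "vm_integral \<nu> (H f) - vm_integral \<nu> (\<lambda>t. H f0 (c t))
          = (vm_integral \<nu> (H f) - vm_integral \<nu> (H f0)) + (vm_integral \<nu> (H f0) - vm_integral \<nu> (\<lambda>t. H f0 (c t)))"
        by simp
      also have "vm_integral \<nu> (H f) - vm_integral \<nu> (H f0) = vm_integral \<nu> (H (\<lambda>x. f x - f0 x))"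
      proof -
        have "H f t - H f0 t = H (\<lambda>x. f x - f0 x) t" for t
          unfolding H_def sum_subtractf[symmetric] right_diff_distrib[symmetric]
          by (intro sum.cong refl arg_cong2[where f="(*)"] shift_integral_diff[symmetric] fi f0i borel_partitionsD(2)[OF \<rho>])
        then show ?thesis
          using vm_integral_diff[OF \<nu> reg[OF fi] reg[OF f0i]] by simp
      qed
      also have "vm_integral \<nu> (H f0) - vm_integral \<nu> (\<lambda>t. H f0 (c t)) = vm_integral \<nu> (\<lambda>t. H f0 t - H f0 (c t))"
        by (rule vm_integral_diff[OF \<nu> reg[OF f0i] regc, symmetric])
      finally have split: "(\<Sum>A\<in>\<rho>. \<alpha> A *\<^sub>C (fun_convolution m f \<nu> A - simple_density m \<phi> A))
          = vm_integral \<nu> (H (\<lambda>x. f x - f0 x)) + vm_integral \<nu> (\<lambda>t. H f0 t - H f0 (c t))" .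
      have 1: "norm (vm_integral \<nu> (H (\<lambda>x. f x - f0 x))) \<le> d * V"
      proof -
        have "(\<integral>x. cmod (f x - f0 x) powr q \<partial>m) powr (1 / q) \<le> (d powr q) powr (1 / q)"
          using f0(3) q by (intro powr_mono2) (auto intro: integral_nonneg_AE)
        then have "(\<integral>x. cmod (f x - f0 x) powr q \<partial>m) powr (1 / q) * V \<le> d * V"
          using d(1) q V by (intro mult_right_mono) (auto simp: powr_inverse_exponent)
        then show ?thesis
          using bound[OF fd f0(2) \<rho> g] unfolding H_def by simp
      qed
      have 2: "norm (vm_integral \<nu> (\<lambda>t. H f0 t - H f0 (c t))) \<le> d' * S"
        unfolding S_def
      proof (rule norm_vm_integral_le_semivariation[OF \<nu> regulated_diff[OF reg[OF f0i] regc]])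
        fix t
        let ?g = "\<lambda>s. \<Sum>A\<in>\<rho>. \<alpha> A * indicator A s"
        have "cmod (\<integral>s. ?g s * (f0 (s - t) - f0 (s - c t)) \<partial>m)
            \<le> (\<integral>s. cmod (f0 (s - t) - f0 (s - c t)) powr r \<partial>m) powr (1 / r)"
          using sum_indicator_measurable[OF \<rho>, of \<alpha>] borel_measurable_simple_function[OF f0t]
          by (intro pairing_le finite_m r g ci) auto
        also have "\<dots> \<le> (d' powr r) powr (1 / r)"
          using ce r by (intro powr_mono2) (auto intro: integral_nonneg_AE)
        also have "\<dots> = d'" using d'(1) r by (simp add: powr_inverse_exponent)
        also have "(\<integral>s. ?g s * (f0 (s - t) - f0 (s - c t)) \<partial>m) = H f0 t - H f0 (c t)"
          unfolding H_def sum_shift_integral'[OF f0i \<rho>] right_diff_distrib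
          using integrable_left_factor[OF integrable_right[OF f0i, of "- t"] \<rho>, of \<alpha>]
            integrable_left_factor[OF integrable_right[OF f0i, of "- c t"] \<rho>, of \<alpha>]
          by (intro Bochner_Integration.integral_diff) simp_all
        finally show "cmod (H f0 t - H f0 (c t)) \<le> d'" .
      qed
      show "norm (\<Sum>A\<in>\<rho>. \<alpha> A *\<^sub>C (fun_convolution m f \<nu> A - simple_density m \<phi> A)) \<le> e"
        unfolding split using 1 2 d(2) d'(2) by (intro order_trans[OF norm_triangle_ineq]) linarith
    qed
    then show ?thesis using \<phi> by blast
  qed
  show "fun_convolution m f \<nu> \<in> P_space (ennreal r) m"
    unfolding P_space_def
  proof (intro CollectI conjI M allI impI)
    fix \<epsilon> :: ennreal assume "\<epsilon> > 0"
    then obtain x where x: "0 < x" "x < \<epsilon>" using dense by blast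
    then obtain e where "x = ennreal e" "e > 0" by (cases x) auto
    then show "\<exists>\<phi>. simple_function borel \<phi> \<and>
        p_semivariation (ennreal r) m (\<lambda>A. fun_convolution m f \<nu> A - simple_density m \<phi> A) < \<epsilon>"
      using approx[of e] x(2) by (auto intro: order_le_less_trans)
  qed
qed

end

section \<open>Bounds for convolutions\<close>

lemma Lp_space_real:
  assumes f: "f \<in> Lp_space (ennreal p) M" and p: "p \<ge> 1"
  shows "f \<in> borel_measurable M" "integrable M (\<lambda>x. cmod (f x) powr p)"
    "Lp_norm (ennreal p) M f = ennreal ((\<integral>x. cmod (f x) powr p \<partial>M) powr (1 / p))"
proof -
  show f': "f \<in> borel_measurable M" using f by (simp add: Lp_space_def)
  have fin: "(\<integral>\<^sup>+x. ennreal (cmod (f x) powr p) \<partial>M) < \<infinity>"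
    using f p by (auto simp: Lp_space_def Lp_norm_def Let_def less_top split: if_splits)
  show int: "integrable M (\<lambda>x. cmod (f x) powr p)"
    using fin f' by (intro integrableI_bounded) auto
  have "(\<integral>\<^sup>+x. ennreal (cmod (f x) powr p) \<partial>M) = ennreal (\<integral>x. cmod (f x) powr p \<partial>M)"
    by (rule nn_integral_eq_integral[OF int]) auto
  then show "Lp_norm (ennreal p) M f = ennreal ((\<integral>x. cmod (f x) powr p \<partial>M) powr (1 / p))"
    using p by (simp add: Lp_norm_def integral_nonneg_AE)
qed

text \<open>The hypothesis \<open>q' > p\<close> excludes \<open>q = \<infinity>\<close>, where \<open>q' = 1\<close>, and \<open>r = \<infinity>\<close>, where \<open>q' = p\<close>. So all
  exponents are real, and \<open>r > 1\<close> because \<open>r \<ge> p\<close>.\<close>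

lemma Young_exponents_real:
  fixes p q r :: ennreal
  assumes p: "1 < p" "p < \<infinity>" and q: "1 \<le> q" "conjugate_exponent q > p" and eq: "1 / p + 1 / q = 1 + 1 / r"
  obtains p' q' r' where "p = ennreal p'" "q = ennreal q'" "r = ennreal r'" "1 < p'" "1 \<le> q'" "1 < r'"
    "1 / p' + 1 / q' = 1 + 1 / r'"
proof -
  obtain p' where p': "p = ennreal p'" "1 < p'"
    using p by (cases p) (auto simp: ennreal_less_iff simp flip: ennreal_1)
  have "q \<noteq> \<infinity>"
    using p q(2) by (auto simp: conjugate_exponent_def)
  then obtain q' where q': "q = ennreal q'" "1 \<le> q'"
    using q(1) by (cases q) (auto simp flip: ennreal_1)
  have lhs: "1 / p + 1 / q = ennreal (1 / p' + 1 / q')"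
    using p' q' by (simp add: divide_ennreal flip: ennreal_1 ennreal_plus)
  have r0: "r \<noteq> 0"
    using eq unfolding lhs by auto
  have rtop: "r \<noteq> \<infinity>"
  proof
    assume "r = \<infinity>"
    then have "ennreal (1 / p' + 1 / q') = ennreal 1" using eq unfolding lhs by simp
    then have sum: "1 / p' + 1 / q' = 1"
      by (subst (asm) ennreal_inj) (use p'(2) q'(2) in auto)
    then have "q' \<noteq> 1" using p'(2) by auto
    then have q1: "1 < q'" using q'(2) by simp
    have "1 / p' = (q' - 1) / q'" using sum q1 by (simp add: diff_divide_distrib)
    then have "p' = q' / (q' - 1)" using p'(2) q1 by (simp add: field_simps)
    then show False
      using q(2) unfolding q'(1) conjugate_exponent_real[OF q1] p'(1) by simp
  qed
  obtain r' where r': "r = ennreal r'" "r' > 0"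
    using r0 rtop by (cases r) auto
  have "1 + 1 / r = ennreal (1 + 1 / r')"
    using r' by (simp add: divide_ennreal flip: ennreal_1 ennreal_plus)
  then have eq': "1 / p' + 1 / q' = 1 + 1 / r'"
    using eq unfolding lhs \<open>1 + 1 / r = ennreal (1 + 1 / r')\<close>
    by (subst (asm) ennreal_inj) (use p'(2) q'(2) r'(2) in auto)
  have "1 / q' \<le> 1" using q'(2) by simp
  then have "1 / r' \<le> 1 / p'" using eq' by linarith
  also have "\<dots> < 1" using p'(2) by simp
  finally have "1 < r'" using r'(2) by (simp add: divide_less_eq)
  then show ?thesis using that p' q' r' eq' by blast
qed

context compact_haar
begin

lemma fun_convolution_Lp_semivariation:
  fixes \<nu> :: "'g set \<Rightarrow> 'x::complex_banach"
  assumes \<nu>: "vector_measure \<nu>" and p: "1 \<le> p" and f: "f \<in> Lp_space (ennreal p) m"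
  shows "fun_convolution m f \<nu> \<in> P_space (ennreal p) m"
    and "p_semivariation (ennreal p) m (fun_convolution m f \<nu>) \<le> Lp_norm (ennreal p) m f * semivariation \<nu>"
proof -
  have S: "semivariation \<nu> = ennreal (enn2real (semivariation \<nu>))"
    using semivariation_finite[OF \<nu>] by simp
  have bound: "norm (vm_integral \<nu> (\<lambda>t. \<Sum>A\<in>\<rho>. \<alpha> A * shift_integral f A t))
        \<le> (\<integral>x. cmod (f x) powr p \<partial>m) powr (1 / p) * enn2real (semivariation \<nu>)"
    if f: "f \<in> borel_measurable m" "integrable m (\<lambda>x. cmod (f x) powr p)" and \<rho>: "\<rho> \<in> borel_partitions"
      and g: "Lp_norm (conjugate_exponent (ennreal p)) m (\<lambda>t. \<Sum>A\<in>\<rho>. \<alpha> A * indicator A t) \<le> 1" for f \<rho> \<alpha>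
    by (rule norm_vm_integral_le_semivariation[OF \<nu> regulated_sum_shift[OF integrable_of_powr[OF finite_m f p] \<rho>]
          norm_sum_shift_integral_le[OF f p \<rho> g]])
  note fD = Lp_space_real[OF f p]
  note * = fun_convolution_in_P_space[OF \<nu> p p enn2real_nonneg bound fD(1,2)]
  show "fun_convolution m f \<nu> \<in> P_space (ennreal p) m" by (rule *(1))
  have "Lp_norm (ennreal p) m f * semivariation \<nu>
      = ennreal ((\<integral>x. cmod (f x) powr p \<partial>m) powr (1 / p) * enn2real (semivariation \<nu>))"
    unfolding fD(3) by (subst S) (simp add: ennreal_mult)
  then show "p_semivariation (ennreal p) m (fun_convolution m f \<nu>) \<le> Lp_norm (ennreal p) m f * semivariation \<nu>"
    using *(2) by simp
qed

lemma fun_convolution_Lp_p_semivariation: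
  fixes \<nu> :: "'g set \<Rightarrow> 'x::complex_banach"
  assumes \<nu>: "vector_measure \<nu>" and fin: "p_semivariation (ennreal p) m \<nu> < \<infinity>"
    and exponents: "1 < p" "1 \<le> q" "1 < r" "1 / p + 1 / q = 1 + 1 / r" and f: "f \<in> Lp_space (ennreal q) m"
  shows "fun_convolution m f \<nu> \<in> P_space (ennreal r) m"
    and "p_semivariation (ennreal r) m (fun_convolution m f \<nu>) \<le> Lp_norm (ennreal q) m f * p_semivariation (ennreal p) m \<nu>"
proof -
  define V where "V = enn2real (p_semivariation (ennreal p) m \<nu>)"
  define P where "P = p / (p - 1)"
  define R where "R = r / (r - 1)"
  have P: "1 / P = 1 - 1 / p" "1 \<le> P" and R: "1 / R = 1 - 1 / r" "1 \<le> R"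
    using exponents by (auto simp: P_def R_def field_simps)
  have RP: "R \<le> P"
  proof -
    have "1 / q \<le> 1" using exponents(2) by simp
    then have "1 / P \<le> 1 / R" using P R exponents(4) by linarith
    then show ?thesis using P(2) R(2) by (simp add: field_simps)
  qed
  have qP: "q \<le> P"
  proof -
    have "0 < 1 / r" using exponents(3) by simp
    then have "1 / P \<le> 1 / q" using P exponents(4) by linarith
    then show ?thesis using P(2) exponents(2) by (simp add: field_simps)
  qed
  have bound: "norm (vm_integral \<nu> (\<lambda>t. \<Sum>A\<in>\<rho>. \<alpha> A * shift_integral f A t))
        \<le> (\<integral>x. cmod (f x) powr q \<partial>m) powr (1 / q) * V"
    if f: "f \<in> borel_measurable m" "integrable m (\<lambda>x. cmod (f x) powr q)" and \<rho>: "\<rho> \<in> borel_partitions"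
      and g: "Lp_norm (conjugate_exponent (ennreal r)) m (\<lambda>t. \<Sum>A\<in>\<rho>. \<alpha> A * indicator A t) \<le> 1" for f \<rho> \<alpha>
  proof -
    let ?g = "\<lambda>t. \<Sum>A\<in>\<rho>. \<alpha> A * indicator A t"
    have nn: "(\<integral>\<^sup>+t. ennreal (cmod (?g t) powr R) \<partial>m) \<le> ennreal 1"
      using g Lp_norm_le_iff[OF R(2), of 1 m ?g] unfolding conjugate_exponent_real[OF exponents(3)] R_def[symmetric]
      by simp
    have gm: "(\<lambda>t. cmod (?g t) powr R) \<in> borel_measurable m"
      using sum_indicator_measurable[OF \<rho>, of \<alpha>] by (intro powr_real_measurable) auto
    have int: "integrable m (\<lambda>t. cmod (?g t) powr R)"
      using nn gm by (intro integrableI_bounded) (auto intro: order_le_less_trans)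
    have "ennreal (\<integral>t. cmod (?g t) powr R \<partial>m) \<le> ennreal 1"
      using nn nn_integral_eq_integral[OF int] by simp
    then have g1: "(\<integral>t. cmod (?g t) powr R \<partial>m) \<le> 1" by simp
    have "1 / R + 1 / q = 1 + 1 / P" using P R exponents(4) by simp
    from Young[OF f \<rho> R(2) RP exponents(2) qP this g1] show ?thesis
      unfolding V_def P_def
      by (intro norm_vm_integral_le_p_semivariation[OF sets_m finite_m exponents(1) \<nu> fin
            regulated_sum_shift[OF integrable_of_powr[OF finite_m f exponents(2)] \<rho>]]) auto
  qed
  note fD = Lp_space_real[OF f exponents(2)]
  have V0: "V \<ge> 0" by (simp add: V_def)
  note * = fun_convolution_in_P_space[OF \<nu> less_imp_le[OF exponents(3)] exponents(2) V0 bound fD(1,2)]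
  show "fun_convolution m f \<nu> \<in> P_space (ennreal r) m" by (rule *(1))
  have "Lp_norm (ennreal q) m f * p_semivariation (ennreal p) m \<nu>
      = ennreal ((\<integral>x. cmod (f x) powr q \<partial>m) powr (1 / q) * V)"
    unfolding fD(3) V_def using fin by (simp add: ennreal_mult)
  then show "p_semivariation (ennreal r) m (fun_convolution m f \<nu>)
      \<le> Lp_norm (ennreal q) m f * p_semivariation (ennreal p) m \<nu>"
    using *(2) by simp
qed

end

theorem proposition9p1:
  fixes m :: "'g::{topological_group_add, t2_space} measure"
    and \<nu> :: "'g set \<Rightarrow> 'x::operator_space"
  assumes "compact (UNIV :: 'g set)"
    and "normalized_haar_measure m"
    and "vector_measure \<nu>"
  shows "(\<forall>p f. 1 \<le> p \<and> p < \<infinity> \<and> f \<in> Lp_space p m \<longrightarrow>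
            fun_convolution m f \<nu> \<in> P_space p m \<and>
            p_semivariation p m (fun_convolution m f \<nu>) \<le> Lp_norm p m f * semivariation \<nu>)
       \<and> (\<forall>p q r f. 1 < p \<and> p < \<infinity> \<and> \<nu> \<in> M_space p m \<and>
            1 \<le> q \<and> conjugate_exponent q > p \<and> f \<in> Lp_space q m \<and> 1 / p + 1 / q = 1 + 1 / r \<longrightarrow>
            fun_convolution m f \<nu> \<in> P_space r m \<and>
            p_semivariation r m (fun_convolution m f \<nu>) \<le> Lp_norm q m f * p_semivariation p m \<nu>)"
proof (intro conjI allI impI; elim conjE)
  interpret compact_haar m
    using assms(1,2) by unfold_locales
  fix p :: ennreal and f :: "'g \<Rightarrow> complex"
  assume p: "1 \<le> p" "p < \<infinity>" and f: "f \<in> Lp_space p m"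
  obtain p' where p': "p = ennreal p'" "1 \<le> p'"
    using p by (cases p) (auto simp: ennreal_less_iff simp flip: ennreal_1)
  note * = fun_convolution_Lp_semivariation[OF assms(3) p'(2) f[unfolded p'(1)]]
  show "fun_convolution m f \<nu> \<in> P_space p m"
    and "p_semivariation p m (fun_convolution m f \<nu>) \<le> Lp_norm p m f * semivariation \<nu>"
    unfolding p'(1) by (fact *)+
next
  interpret compact_haar m
    using assms(1,2) by unfold_locales
  fix p q r :: ennreal and f :: "'g \<Rightarrow> complex"
  assume exponents: "1 < p" "p < \<infinity>" "1 \<le> q" "conjugate_exponent q > p" "1 / p + 1 / q = 1 + 1 / r"
    and \<nu>: "\<nu> \<in> M_space p m" and f: "f \<in> Lp_space q m"
  from exponents obtain p' q' r' where pqr: "p = ennreal p'" "q = ennreal q'" "r = ennreal r'"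
    and real: "1 < p'" "1 \<le> q'" "1 < r'" "1 / p' + 1 / q' = 1 + 1 / r'"
    by (rule Young_exponents_real)
  have fin: "p_semivariation (ennreal p') m \<nu> < \<infinity>"
    using \<nu> by (simp add: M_space_def pqr)
  note * = fun_convolution_Lp_p_semivariation[OF assms(3) fin real f[unfolded pqr]]
  show "fun_convolution m f \<nu> \<in> P_space r m"
    and "p_semivariation r m (fun_convolution m f \<nu>) \<le> Lp_norm q m f * p_semivariation p m \<nu>"
    unfolding pqr by (fact *)+
qed

end
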